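(* Let $K/k$ be a cyclic extension of number fields with Galois group $G=\langle\sigma\rangle$. Let $\mathfrak m$ be a nonzero integral ideal (modulus) of $k$ with support $T$ (the set of prime ideals dividing $\mathfrak m$), also viewed (by extension of ideals) as a modulus of $K$. Let $\mathcal I$ be a subgroup of $I_{K,T}$ such that $\mathcal H:=\mathcal I\cdot P_{K,\mathfrak m}^+/P_{K,\mathfrak m}^+$ is a sub-$G$-module of $\mathcal C\ell_{K,\mathfrak m}^+=I_{K,T}/P^+_{K,\mathfrak m}$, and put $$\widetilde{\mathcal H}=\{h\in \mathcal C\ell_{K,\mathfrak m}^+ : h^{1-\sigma}\in\mathcal H\},\qquad {}_{\rm N}\mathcal H=\ker\big(\mathrm N_{K/k}:\mathcal H\to \mathcal C\ell^+_{k,\mathfrak m}\big),$$ $$\Lambda=\{x\in U_{k,\mathfrak m}^+ : (x)\in \mathrm N_{K/k}(\mathcal I)\}.$$ Then $(\widetilde{\mathcal H})^{1-\sigma}\subseteq {}_{\rm N}\mathcal H$ and there is an exact sequence $$1\longrightarrow \big(E_{k,\mathfrak m}^+\,\mathrm N_{K/k}(U_{K,\mathfrak m}^+)\big)\cap\Lambda\longrightarrow \Lambda\xrightarrow{\ \varphi\ } {}_{\rm N}\mathcal H/(\widetilde{\mathcal H})^{1-\sigma}\longrightarrow 1,$$ where for $x\in\Lambda$, $\varphi(x)=c\ell_K(\mathfrak A)\cdot(\widetilde{\mathcal H})^{1-\sigma}$ for any $\mathfrak A\in\mathcal I$ with $\mathrm N_{K/k}(\mathfrak A)=(x)$ (this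 being well defined).
   Context: For a number field $F$ and a modulus $\mathfrak m$ with support $T$: $I_{F,T}$ is the group of fractional ideals of $F$ prime to $T$; $F^{\times+}$ is the group of totally positive elements of $F^\times$; $U_{F,\mathfrak m}^+=\{x\in F^{\times+}: v_{\mathfrak p}(x)=0\ \forall\mathfrak p\in T,\ x\equiv1\pmod{\mathfrak m}\}$; $P_{F,\mathfrak m}^+=\{(x): x\in U^+_{F,\mathfrak m}\}$ is the ray group modulo $\mathfrak m$ in the narrow sense; $\mathcal C\ell^+_{F,\mathfrak m}=I_{F,T}/P^+_{F,\mathfrak m}$ is the narrow ray class group, with class map $c\ell_F:I_{F,T}\to\mathcal C\ell^+_{F,\mathfrak m}$; $E_{F,\mathfrak m}^+$ is the group of totally positive units $\varepsilon$ of $F$ with $\varepsilon\equiv1\pmod{\mathfrak m}$. $\mathrm N_{K/k}$ denotes the arithmetical norm on ideals ($\mathrm N_{K/k}(\mathfrak P)=\mathfrak p^{f_{\mathfrak p}}$, $f_{\mathfrak p}$ the residue degree), the usual norm on elements, and the induced map on ray class groups $\mathcal C\ell^+_{K,\mathfrak m}\to\mathcal C\ell^+_{k,\mathfrak m}$. $G$ acts on $\mathcal C\ell^+_{K,\mathfrak m}$ via its action on ideals. *)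

theory Defs
  imports "HOL-Algebra.Algebra" "HOL-Algebra.Algebraic_Closure_Type"
begin

text \<open>
  All fields live inside an arbitrary ambient field of characteristic 0, given by the
  type \<^typ>\<open>'a\<close>; a number field is a subset of that type. Ideals are sets of field elements.
\<close>

subsection \<open>Number fields\<close>

abbreviation ring_on :: "'a::field_char_0 set \<Rightarrow> 'a ring" where
  "ring_on S \<equiv> ring_of_type_algebra\<lparr>carrier := S\<rparr>"

definition number_field :: "'a::field_char_0 set \<Rightarrow> bool" where
  "number_field F \<longleftrightarrow> subfield F (ring_of_type_algebra :: 'a ring) \<and>
     (\<exists>n. ring.dimension (ring_of_type_algebra :: 'a ring) n \<rat> F)"

definition ints_of :: "'a::field_char_0 set \<Rightarrow> 'a set" where
  "ints_of F = {x \<in> F. algebraic_int x}"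

definition tot_pos :: "'a::field_char_0 set \<Rightarrow> 'a set" where
  "tot_pos F = {x \<in> F. x \<noteq> 0 \<and>
     (\<forall>\<tau> \<in> ring_hom (ring_on F) (ring_of_type_algebra :: real ring). \<tau> x > 0)}"

subsection \<open>Galois extensions\<close>

definition gal_group :: "'a::field_char_0 set \<Rightarrow> 'a set \<Rightarrow> ('a \<Rightarrow> 'a) monoid" where
  "gal_group K k = (BijGroup K)\<lparr>carrier :=
     {s \<in> Bij K. s \<in> ring_hom (ring_on K) (ring_on K) \<and> (\<forall>x\<in>k. s x = x)}\<rparr>"

definition galois_ext :: "'a::field_char_0 set \<Rightarrow> 'a set \<Rightarrow> bool" where
  "galois_ext K k \<longleftrightarrow> k \<subseteq> K \<and> {x \<in> K. \<forall>s \<in> carrier (gal_group K k). s x = x} = k"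

text \<open>The norm on elements, for a Galois extension \<open>K/k\<close>.\<close>

definition elem_norm :: "'a::field_char_0 set \<Rightarrow> 'a set \<Rightarrow> 'a \<Rightarrow> 'a" where
  "elem_norm K k x = (\<Prod>s \<in> carrier (gal_group K k). s x)"

subsection \<open>Fractional ideals\<close>

definition ideal_mult :: "'a::field_char_0 set \<Rightarrow> 'a set \<Rightarrow> 'a set" where
  "ideal_mult A B =
     {\<Sum>i<n. f i * g i | (n::nat) f g. (\<forall>i<n. f i \<in> A) \<and> (\<forall>i<n. g i \<in> B)}"

definition frac_ideals :: "'a::field_char_0 set \<Rightarrow> 'a set set" where
  "frac_ideals F = {A. A \<subseteq> F \<and> A \<noteq> {0} \<and> 0 \<in> A \<and> (\<forall>a\<in>A. \<forall>b\<in>A. a + b \<in> A) \<and>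
     (\<forall>r\<in>ints_of F. \<forall>a\<in>A. r * a \<in> A) \<and>
     (\<exists>d\<in>ints_of F. d \<noteq> 0 \<and> (\<forall>a\<in>A. d * a \<in> ints_of F))}"

definition integral_ideals :: "'a::field_char_0 set \<Rightarrow> 'a set set" where
  "integral_ideals F = {A \<in> frac_ideals F. A \<subseteq> ints_of F}"

definition frac_group :: "'a::field_char_0 set \<Rightarrow> 'a set monoid" where
  "frac_group F = \<lparr>carrier = frac_ideals F, monoid.mult = ideal_mult, one = ints_of F\<rparr>"

definition principal :: "'a::field_char_0 set \<Rightarrow> 'a \<Rightarrow> 'a set" where
  "principal F x = (\<lambda>r. x * r) ` ints_of F"

definition primes_of :: "'a::field_char_0 set \<Rightarrow> 'a set set" where
  "primes_of F = {P. primeideal P (ring_on (ints_of F)) \<and> P \<noteq> {0}}"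

text \<open>\<open>ideal_val F A P\<close> is the exponent of the prime \<open>P\<close> in the factorization of \<open>A\<close>.\<close>

definition ideal_val :: "'a::field_char_0 set \<Rightarrow> 'a set \<Rightarrow> 'a set \<Rightarrow> int" where
  "ideal_val F A = (THE e. finite {P. e P \<noteq> 0} \<and> {P. e P \<noteq> 0} \<subseteq> primes_of F \<and>
     A = finprod (frac_group F) (\<lambda>P. P [^]\<^bsub>frac_group F\<^esub> e P) {P. e P \<noteq> 0})"

definition elem_val :: "'a::field_char_0 set \<Rightarrow> 'a \<Rightarrow> 'a set \<Rightarrow> int" where
  "elem_val F x P = ideal_val F (principal F x) P"

subsection \<open>Norms of ideals\<close>

text \<open>
  The degree of \<open>O\<^sub>K/P\<close> over \<open>O\<^sub>k/(P \<inter> O\<^sub>k)\<close>, the latter being identified with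
  the image of \<open>O\<^sub>k\<close> in \<open>O\<^sub>K/P\<close>.
\<close>

definition res_degree :: "'a::field_char_0 set \<Rightarrow> 'a set \<Rightarrow> 'a set \<Rightarrow> nat" where
  "res_degree K k P = (let R = ring_on (ints_of K) in
     THE n. ring.dimension (R Quot P) n ((\<lambda>x. P +>\<^bsub>R\<^esub> x) ` ints_of k) (carrier (R Quot P)))"

definition ideal_norm :: "'a::field_char_0 set \<Rightarrow> 'a set \<Rightarrow> 'a set \<Rightarrow> 'a set" where
  "ideal_norm K k A = finprod (frac_group k)
     (\<lambda>P. (P \<inter> ints_of k) [^]\<^bsub>frac_group k\<^esub> (int (res_degree K k P) * ideal_val K A P))
     {P \<in> primes_of K. ideal_val K A P \<noteq> 0}"

subsection \<open>Moduli and ray class groups\<close>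

definition modulus_ext :: "'a::field_char_0 set \<Rightarrow> 'a set \<Rightarrow> 'a set" where
  "modulus_ext K \<mm> = ideal_mult \<mm> (ints_of K)"

definition supp :: "'a::field_char_0 set \<Rightarrow> 'a set \<Rightarrow> 'a set set" where
  "supp F \<mm> = {P \<in> primes_of F. \<exists>C \<in> integral_ideals F. \<mm> = ideal_mult P C}"

definition ideal_group :: "'a::field_char_0 set \<Rightarrow> 'a set set \<Rightarrow> 'a set monoid" where
  "ideal_group F T = (frac_group F)\<lparr>carrier :=
     {A \<in> frac_ideals F. \<forall>P\<in>T. ideal_val F A P = 0}\<rparr>"

text \<open>
  The congruence \<open>x \<equiv> 1 (mod \<mm>)\<close> for an element \<open>x\<close> of \<open>F\<close>, not necessarily integral:
  \<open>v\<^sub>P(x - 1) \<ge> v\<^sub>P(\<mm>)\<close> for all \<open>P\<close> dividing \<open>\<mm>\<close>, where \<open>v\<^sub>P(0) = \<infinity>\<close>.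
\<close>

definition cong_one :: "'a::field_char_0 set \<Rightarrow> 'a set \<Rightarrow> 'a \<Rightarrow> bool" where
  "cong_one F \<mm> x \<longleftrightarrow>
     x = 1 \<or> (\<forall>P \<in> supp F \<mm>. elem_val F (x - 1) P \<ge> ideal_val F \<mm> P)"

definition ray_elems :: "'a::field_char_0 set \<Rightarrow> 'a set \<Rightarrow> 'a set" where
  "ray_elems F \<mm> =
     {x \<in> tot_pos F. (\<forall>P \<in> supp F \<mm>. elem_val F x P = 0) \<and> cong_one F \<mm> x}"

definition ray_units :: "'a::field_char_0 set \<Rightarrow> 'a set \<Rightarrow> 'a set" where
  "ray_units F \<mm> =
     {x \<in> tot_pos F. x \<in> Units (ring_on (ints_of F)) \<and> cong_one F \<mm> x}"

definition ray_group :: "'a::field_char_0 set \<Rightarrow> 'a set \<Rightarrow> 'a set set" where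
  "ray_group F \<mm> = principal F ` ray_elems F \<mm>"

definition ray_class_group :: "'a::field_char_0 set \<Rightarrow> 'a set \<Rightarrow> 'a set set monoid" where
  "ray_class_group F \<mm> = ideal_group F (supp F \<mm>) Mod ray_group F \<mm>"

definition ray_class :: "'a::field_char_0 set \<Rightarrow> 'a set \<Rightarrow> 'a set \<Rightarrow> 'a set set" where
  "ray_class F \<mm> A = ray_group F \<mm> #>\<^bsub>ideal_group F (supp F \<mm>)\<^esub> A"

text \<open>
  Classes are cosets, i.e. sets of ideals. The union below ranges over equal cosets, so
  it is their common value: the map induced on classes by the norm of ideals.
\<close>

definition class_norm :: "'a::field_char_0 set \<Rightarrow> 'a set \<Rightarrow> 'a set \<Rightarrow> 'a set set \<Rightarrow> 'a set set" where
  "class_norm K k \<mm> c = (\<Union>A\<in>c. ray_class k \<mm> (ideal_norm K k A))"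

definition class_act :: "('a::field_char_0 \<Rightarrow> 'a) \<Rightarrow> 'a set set \<Rightarrow> 'a set set" where
  "class_act s c = (\<lambda>A. s ` A) ` c"

subsection \<open>Exact sequences\<close>

definition mult_group_on :: "'a::field_char_0 set \<Rightarrow> 'a monoid" where
  "mult_group_on S = \<lparr>carrier = S, monoid.mult = (*), one = 1\<rparr>"

text \<open>
  Exactness of \<open>1 \<rightarrow> A \<rightarrow> B \<rightarrow> C \<rightarrow> 1\<close> for groups over different types, which the
  predicate \<^const>\<open>exact_seq\<close> does not allow.
\<close>

definition short_exact ::
  "'a monoid \<Rightarrow> ('a \<Rightarrow> 'b) \<Rightarrow> 'b monoid \<Rightarrow> ('b \<Rightarrow> 'c) \<Rightarrow> 'c monoid \<Rightarrow> bool" where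
  "short_exact A f B g C \<longleftrightarrow> group_hom A B f \<and> group_hom B C g \<and>
     inj_on f (carrier A) \<and> f ` carrier A = kernel B C g \<and> g ` carrier B = carrier C"

end

theory Submission
  imports Defs "Jordan_Normal_Form.Char_Poly"
begin

text \<open>
  The norm of an ideal \<open>A\<close> of \<open>K\<close>, extended back to \<open>K\<close>, is the product of the conjugates of \<open>A\<close>. For a prime
  this is a comparison of two ideals with proportional valuations and equal absolute norms; hence the norm is
  multiplicative, Galois invariant, and compatible with norms of elements. If \<open>K/k\<close> is cyclic, an ideal prime to
  the modulus of norm one is of the form \<open>B\<^bsup>1-\<sigma>\<^esup>\<close> with \<open>B\<close> prime to the modulus: this is Hilbert 90 for the
  permutation action of the Galois group on the primes. So if \<open>A \<in> \<I>\<close> has norm \<open>(x)\<close>, the class of \<open>A\<close> lies in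
  the image of \<open>1 - \<sigma>\<close> if and only if \<open>(x)\<close> is the norm of a principal ideal of the ray group of \<open>K\<close>, that is,
  if \<open>x\<close> is a unit times the norm of an element. This gives both the well-definedness and the kernel of the map.
\<close>

section \<open>Additive subgroups and their spans\<close>

definition add_subgroup :: "'a::ab_group_add set \<Rightarrow> bool" where
  "add_subgroup A \<longleftrightarrow> 0 \<in> A \<and> (\<forall>x\<in>A. \<forall>y\<in>A. x - y \<in> A)"

lemma add_subgroupI:
  assumes "0 \<in> A" "\<And>x y. x \<in> A \<Longrightarrow> y \<in> A \<Longrightarrow> x - y \<in> A"
  shows "add_subgroup A"
  using assms by (simp add: add_subgroup_def)

lemma add_subgroup_zero: "add_subgroup A \<Longrightarrow> 0 \<in> A"
  and add_subgroup_diff: "add_subgroup A \<Longrightarrow> x \<in> A \<Longrightarrow> y \<in> A \<Longrightarrow> x - y \<in> A"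
  by (auto simp: add_subgroup_def)

lemma add_subgroup_uminus: "add_subgroup A \<Longrightarrow> x \<in> A \<Longrightarrow> - x \<in> A"
  using add_subgroup_diff[of A 0 x] add_subgroup_zero[of A] by simp

lemma add_subgroup_add: "add_subgroup A \<Longrightarrow> x \<in> A \<Longrightarrow> y \<in> A \<Longrightarrow> x + y \<in> A"
  using add_subgroup_diff[of A x "- y"] add_subgroup_uminus[of A y] by simp

lemma add_subgroup_sum: "add_subgroup A \<Longrightarrow> (\<And>i. i \<in> I \<Longrightarrow> f i \<in> A) \<Longrightarrow> sum f I \<in> A"
  by (induction I rule: infinite_finite_induct) (auto simp: add_subgroup_zero add_subgroup_add)

lemma add_subgroup_Int: "add_subgroup A \<Longrightarrow> add_subgroup B \<Longrightarrow> add_subgroup (A \<inter> B)"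
  by (auto simp: add_subgroup_def)

lemma add_subgroup_image:
  assumes "add_subgroup A" "\<And>x y. x \<in> A \<Longrightarrow> y \<in> A \<Longrightarrow> f (x - y) = f x - f y"
  shows "add_subgroup (f ` A)"
proof (rule add_subgroupI)
  have "f 0 = 0" using assms(2)[of 0 0] add_subgroup_zero[OF assms(1)] by simp
  then show "0 \<in> f ` A" using add_subgroup_zero[OF assms(1)] by (metis image_eqI)
  fix u v assume "u \<in> f ` A" "v \<in> f ` A"
  then obtain x y where "x \<in> A" "y \<in> A" "u = f x" "v = f y" by blast
  then have "x - y \<in> A" "f (x - y) = u - v" using assms by (simp_all add: add_subgroup_diff)
  then show "u - v \<in> f ` A" by (metis image_eqI)
qed

lemma add_subgroup_of_int_mult:
  fixes x :: "'a::ring_1"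
  assumes A: "add_subgroup A" and x: "x \<in> A"
  shows "of_int n * x \<in> A"
proof (induction n rule: int_induct[where k = 0])
  case (step1 i) then show ?case using add_subgroup_add[OF A _ x] by (simp add: distrib_right)
next
  case (step2 i) then show ?case using add_subgroup_diff[OF A _ x] by (simp add: left_diff_distrib)
qed (simp add: add_subgroup_zero[OF A])

definition int_span :: "('b \<Rightarrow> 'a) \<Rightarrow> 'b set \<Rightarrow> 'a::comm_ring_1 set" where
  "int_span v J = {(\<Sum>i\<in>J. of_int (c i) * v i) | c. True}"

lemma int_spanI: "x = (\<Sum>i\<in>J. of_int (c i) * v i) \<Longrightarrow> x \<in> int_span v J"
  by (auto simp: int_span_def)

lemma int_spanE:
  assumes "x \<in> int_span v J"
  obtains c where "x = (\<Sum>i\<in>J. of_int (c i) * v i)"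
  using assms by (auto simp: int_span_def)

lemma add_subgroup_int_span: "add_subgroup (int_span v J)"
proof (rule add_subgroupI)
  show "0 \<in> int_span v J" by (rule int_spanI[where c = "\<lambda>_. 0"]) simp
  fix x y assume "x \<in> int_span v J" "y \<in> int_span v J"
  then obtain c d where "x = (\<Sum>i\<in>J. of_int (c i) * v i)" "y = (\<Sum>i\<in>J. of_int (d i) * v i)"
    by (auto elim!: int_spanE)
  then show "x - y \<in> int_span v J"
    by (intro int_spanI[where c = "\<lambda>i. c i - d i"]) (simp add: sum_subtractf left_diff_distrib)
qed

lemma int_span_base:
  assumes "finite J" "i \<in> J"
  shows "v i \<in> int_span v J"
proof (rule int_spanI[where c = "\<lambda>j. if j = i then 1 else 0"])
  have "(\<Sum>j\<in>J. of_int (if j = i then 1 else 0) * v j) = (\<Sum>j\<in>J. if j = i then v j else 0)"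
    by (intro sum.cong) auto
  then show "v i = (\<Sum>j\<in>J. of_int (if j = i then 1 else 0) * v j)" using assms by simp
qed

lemma int_span_least:
  assumes "add_subgroup S" "\<And>i. i \<in> J \<Longrightarrow> v i \<in> S"
  shows "int_span v J \<subseteq> S"
  using assms by (auto elim!: int_spanE intro!: add_subgroup_sum add_subgroup_of_int_mult)

lemma int_span_mult_stable:
  assumes "\<And>i. i \<in> J \<Longrightarrow> z * v i \<in> int_span v J" "x \<in> int_span v J"
  shows "z * x \<in> int_span v J"
proof -
  have "add_subgroup {x. z * x \<in> int_span v J}"
    using add_subgroup_int_span[of v J] by (auto simp: add_subgroup_def right_diff_distrib)
  then have "int_span v J \<subseteq> {x. z * x \<in> int_span v J}"
    by (rule int_span_least) (simp add: assms(1))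
  with assms(2) show ?thesis by blast
qed

section \<open>Algebraic integers\<close>

text \<open>
  An element that stabilises a nonzero finitely generated group is an eigenvalue of an integer
  matrix, hence a root of its characteristic polynomial.
\<close>

lemma algebraic_int_eigenvalue:
  fixes z :: "'a::field_char_0" and A :: "'b \<Rightarrow> 'b \<Rightarrow> int"
  assumes fin: "finite J" and nonzero: "i0 \<in> J" "v i0 \<noteq> 0"
    and eigen: "\<And>i. i \<in> J \<Longrightarrow> z * v i = (\<Sum>j\<in>J. of_int (A i j) * v j)"
  shows "algebraic_int z"
proof -
  define n where "n = card J"
  obtain e where e: "bij_betw e {0..<n} J"
    using ex_bij_betw_nat_finite[OF fin] by (auto simp: n_def)
  have e_mem: "e i \<in> J" if "i < n" for i using e that by (auto simp: bij_betw_def)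
  define M where "M = Matrix.mat n n (\<lambda>(i, j). A (e i) (e j))"
  define w where "w = Matrix.vec n (\<lambda>i. v (e i))"
  let ?M = "map_mat of_int M :: 'a mat"
  have M: "M \<in> carrier_mat n n" "?M \<in> carrier_mat n n" by (simp_all add: M_def)
  have "?M *\<^sub>v w = z \<cdot>\<^sub>v w"
  proof (rule eq_vecI)
    fix i assume "i < dim_vec (z \<cdot>\<^sub>v w)"
    then have i: "i < n" by (simp add: w_def)
    have "(?M *\<^sub>v w) $ i = (\<Sum>j = 0..<n. of_int (A (e i) (e j)) * v (e j))"
      using i by (simp add: M_def w_def scalar_prod_def)
    also have "\<dots> = (\<Sum>j\<in>J. of_int (A (e i) j) * v j)"
      by (rule sum.reindex_bij_betw[OF e])
    also have "\<dots> = z * v (e i)" by (rule eigen[OF e_mem[OF i], symmetric])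
    finally show "(?M *\<^sub>v w) $ i = (z \<cdot>\<^sub>v w) $ i" using i by (simp add: w_def)
  qed (simp add: M_def w_def)
  moreover have "w \<noteq> 0\<^sub>v n"
  proof -
    obtain i where "i < n" "e i = i0" using e nonzero(1) by (auto simp: bij_betw_def)
    then have "w $ i \<noteq> 0" "i < n" using nonzero(2) by (simp_all add: w_def)
    then show ?thesis by auto
  qed
  ultimately have "eigenvalue ?M z"
    unfolding eigenvalue_def eigenvector_def using M by (intro exI[of _ w]) (auto simp: w_def)
  then have "poly (map_poly of_int (char_poly M)) z = 0"
    by (simp add: eigenvalue_root_char_poly[OF M(2)] of_int_hom.char_poly_hom[OF M(1)])
  moreover have "lead_coeff (char_poly M) = 1" using degree_monic_char_poly[OF M(1)] by simp
  ultimately show ?thesis unfolding algebraic_int_altdef_ipoly by blast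
qed

lemma algebraic_int_stabilizer:
  fixes z :: "'a::field_char_0"
  assumes "finite J" "i0 \<in> J" "v i0 \<noteq> 0" "\<And>i. i \<in> J \<Longrightarrow> z * v i \<in> int_span v J"
  shows "algebraic_int z"
proof -
  have "\<forall>i\<in>J. \<exists>c. z * v i = (\<Sum>j\<in>J. of_int (c j) * v j)"
    using assms(4) by (auto simp: int_span_def)
  then obtain A where "\<forall>i\<in>J. z * v i = (\<Sum>j\<in>J. of_int (A i j) * v j)" by (rule bchoice[THEN exE])
  then show ?thesis by (intro algebraic_int_eigenvalue[where v = v and A = A, OF assms(1-3)]) simp
qed

lemma algebraic_int_powerI:
  fixes z :: "'a::field_char_0"
  assumes "z ^ n = (\<Sum>i<n. of_int (c i) * z ^ i)"
  shows "algebraic_int z"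
proof (rule algebraic_int.intros)
  define q :: "'a poly" where "q = (\<Sum>i<n. monom (of_int (c i)) i)"
  define p where "p = monom 1 n - q"
  have "Polynomial.coeff q j = (if j < n then of_int (c j) else 0)" for j
    unfolding q_def by (simp add: Polynomial.coeff_sum sum.delta' if_distrib cong: if_cong)
  then have coeff: "Polynomial.coeff p j = (if j = n then 1 else if j < n then - of_int (c j) else 0)" for j
    unfolding p_def by simp
  have "Polynomial.degree p = n"
    by (intro antisym degree_le le_degree) (auto simp: coeff)
  then show "lead_coeff p = 1" by (simp add: coeff)
  show "\<forall>i. Polynomial.coeff p i \<in> \<int>" by (simp add: coeff)
  show "poly p z = 0" using assms by (simp add: p_def q_def poly_monom poly_sum)
qed

lemma algebraic_int_powerE:
  fixes z :: "'a::field_char_0"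
  assumes "algebraic_int z"
  obtains n and c :: "nat \<Rightarrow> int" where "n > 0" "z ^ n = (\<Sum>i<n. of_int (c i) * z ^ i)"
proof -
  obtain p where p: "poly (map_poly of_int p) z = 0" "lead_coeff p = 1"
    using assms unfolding algebraic_int_altdef_ipoly by blast
  define n where "n = Polynomial.degree p"
  have "poly (map_poly of_int p) z = (\<Sum>i\<le>n. of_int (Polynomial.coeff p i) * z ^ i)"
    by (simp only: poly_altdef n_def of_int_hom.degree_map_poly_hom of_int_hom.coeff_map_poly_hom)
  also have "\<dots> = (\<Sum>i<n. of_int (Polynomial.coeff p i) * z ^ i) + z ^ n"
    using p(2) by (simp only: n_def lessThan_Suc_atMost[symmetric] sum.lessThan_Suc of_int_1 mult_1_left)
  finally have eq: "z ^ n = (\<Sum>i<n. of_int (- Polynomial.coeff p i) * z ^ i)"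
    using p(1) by (simp add: sum_negf eq_neg_iff_add_eq_0 add.commute)
  have "n \<noteq> 0"
  proof
    assume "n = 0"
    with eq show False by simp
  qed
  with eq that[of n "\<lambda>i. - Polynomial.coeff p i"] show ?thesis by simp
qed

lemma algebraic_int_monomials_stable:
  fixes x w :: "'a::field_char_0"
  assumes "x ^ n = (\<Sum>i<n. of_int (c i) * x ^ i)" "i < n"
  shows "x * (x ^ i * w) \<in> int_span (\<lambda>i. x ^ i * w) {..<n}"
proof (cases "Suc i = n")
  case True
  then have "x * (x ^ i * w) = x ^ n * w" by (auto simp: mult.assoc)
  also have "\<dots> = (\<Sum>i<n. of_int (c i) * (x ^ i * w))"
    by (simp add: assms(1) sum_distrib_right mult.assoc)
  finally show ?thesis by (rule int_spanI)
next
  case False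
  then have "Suc i < n" using assms(2) by simp
  then show ?thesis using int_span_base[of "{..<n}" "Suc i" "\<lambda>i. x ^ i * w"] by (simp add: mult.assoc)
qed

lemma
  fixes x y :: "'a::field_char_0"
  assumes "algebraic_int x" "algebraic_int y"
  shows algebraic_int_add: "algebraic_int (x + y)"
    and algebraic_int_mult: "algebraic_int (x * y)"
proof -
  obtain m and c :: "nat \<Rightarrow> int" where m: "m > 0" "x ^ m = (\<Sum>i<m. of_int (c i) * x ^ i)"
    by (rule algebraic_int_powerE[OF assms(1)])
  obtain n and d :: "nat \<Rightarrow> int" where n: "n > 0" "y ^ n = (\<Sum>i<n. of_int (d i) * y ^ i)"
    by (rule algebraic_int_powerE[OF assms(2)])
  define J where "J = {..<m} \<times> {..<n}"
  define v where "v = (\<lambda>(i, j). x ^ i * y ^ j)"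
  let ?M = "int_span v J"
  note M = add_subgroup_int_span[of v J]
  have J: "finite J" "(0, 0) \<in> J" "v (0, 0) \<noteq> 0" using m n by (auto simp: J_def v_def)
  have base: "x ^ i * y ^ j \<in> ?M" if "i < m" "j < n" for i j
    using int_span_base[OF J(1), of "(i, j)" v] that by (simp add: J_def v_def)
  have x: "x * v p \<in> ?M" if pJ: "p \<in> J" for p
  proof -
    obtain i j where p: "p = (i, j)" "i < m" "j < n" using pJ by (auto simp: J_def)
    have "int_span (\<lambda>i. x ^ i * y ^ j) {..<m} \<subseteq> ?M" using base[OF _ p(3)] by (intro int_span_least M) auto
    then show ?thesis using algebraic_int_monomials_stable[OF m(2) p(2)] by (auto simp: p(1) v_def)
  qed
  have y: "y * v p \<in> ?M" if pJ: "p \<in> J" for p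
  proof -
    obtain i j where p: "p = (i, j)" "i < m" "j < n" using pJ by (auto simp: J_def)
    have "int_span (\<lambda>j. y ^ j * x ^ i) {..<n} \<subseteq> ?M"
      using base[OF p(2)] by (intro int_span_least M) (auto simp: mult.commute)
    then show ?thesis using algebraic_int_monomials_stable[OF n(2) p(3)] by (auto simp: p(1) v_def mult.commute)
  qed
  show "algebraic_int (x + y)"
    by (rule algebraic_int_stabilizer[where v = v, OF J]) (simp add: distrib_right add_subgroup_add[OF M] x y)
  show "algebraic_int (x * y)"
    by (rule algebraic_int_stabilizer[where v = v, OF J]) (simp add: mult.assoc int_span_mult_stable x y)
qed

lemma algebraic_int_lead_coeff_mult:
  fixes x :: "'a::field_char_0"
  assumes "p \<noteq> 0" "poly (map_poly of_int p) x = 0"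
  shows "algebraic_int (of_int (lead_coeff p) * x)"
proof -
  define n where "n = Polynomial.degree p"
  define a where "a = lead_coeff p"
  define z where "z = of_int a * x"
  have "a \<noteq> 0" using assms(1) by (simp add: a_def)
  have "poly (map_poly of_int p) x = (\<Sum>i\<le>n. of_int (Polynomial.coeff p i) * x ^ i)"
    by (simp only: poly_altdef n_def of_int_hom.degree_map_poly_hom of_int_hom.coeff_map_poly_hom)
  also have "\<dots> = (\<Sum>i<n. of_int (Polynomial.coeff p i) * x ^ i) + of_int a * x ^ n"
    by (simp only: n_def a_def lessThan_Suc_atMost[symmetric] sum.lessThan_Suc)
  finally have relation: "of_int a * x ^ n = - (\<Sum>i<n. of_int (Polynomial.coeff p i) * x ^ i)"
    using assms(2) by (simp add: eq_neg_iff_add_eq_0 add.commute)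
  then have "n > 0" using \<open>a \<noteq> 0\<close> by (cases "n = 0") auto
  then obtain k where k: "n = Suc k" by (cases n) auto
  have "z ^ n = of_int a ^ k * (of_int a * x ^ n)" by (simp add: z_def k power_mult_distrib mult_ac)
  also have "\<dots> = (\<Sum>i<n. of_int (- (Polynomial.coeff p i * a ^ (k - i))) * z ^ i)"
    unfolding relation mult_minus_right sum_distrib_left sum_negf[symmetric]
  proof (intro sum.cong refl)
    fix i assume "i \<in> {..<n}"
    then have "of_int a ^ k = (of_int a ^ (k - i) * of_int a ^ i :: 'a)"
      using k by (simp add: power_add[symmetric])
    then show "- (of_int a ^ k * (of_int (Polynomial.coeff p i) * x ^ i)) =
        of_int (- (Polynomial.coeff p i * a ^ (k - i))) * z ^ i"
      by (simp add: z_def power_mult_distrib mult_ac)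
  qed
  finally show ?thesis unfolding z_def a_def by (rule algebraic_int_powerI)
qed

text \<open>Substituting into the equation of \<open>z ^ j - z ^ i\<close> keeps it monic.\<close>

lemma algebraic_int_power_diff:
  fixes z :: "'a::field_char_0"
  assumes "algebraic_int (z ^ j - z ^ i)" "i < j"
  shows "algebraic_int z"
proof -
  define q :: "'a poly" where "q = monom 1 j - monom 1 i"
  have coeff: "Polynomial.coeff q l = (if l = j then 1 else if l = i then -1 else 0)" for l
    using assms(2) by (auto simp: q_def)
  have degree: "Polynomial.degree q = j"
    by (rule antisym) (use assms(2) in \<open>auto intro!: degree_le le_degree simp: coeff\<close>)
  show ?thesis
    by (rule algebraic_int_root[OF assms(1), of q])
       (use assms(2) in \<open>auto simp: q_def[symmetric] degree coeff, auto simp: q_def poly_monom\<close>)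
qed

section \<open>Subfields\<close>

lemma ring_on_simps [simp]:
  "carrier (ring_on S) = S" "x \<otimes>\<^bsub>ring_on S\<^esub> y = x * y" "x \<oplus>\<^bsub>ring_on S\<^esub> y = x + y"
  "\<zero>\<^bsub>ring_on S\<^esub> = 0" "\<one>\<^bsub>ring_on S\<^esub> = 1"
  "x \<otimes>\<^bsub>ring_of_type_algebra\<^esub> y = x * y" "x \<oplus>\<^bsub>ring_of_type_algebra\<^esub> y = x + y"
  "\<zero>\<^bsub>ring_of_type_algebra\<^esub> = 0" "\<one>\<^bsub>ring_of_type_algebra\<^esub> = 1"
  "carrier ring_of_type_algebra = UNIV"
  by (auto simp: ring_of_type_algebra_def)

lemma ring_of_type_algebra_uminus:
  fixes x :: "'a::field_char_0"
  shows "\<ominus>\<^bsub>ring_of_type_algebra\<^esub> x = - x"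
proof -
  interpret Ring.field "ring_of_type_algebra :: 'a ring" by (rule field_from_type_algebra)
  show ?thesis using minus_equality[of "- x" x] by simp
qed

lemma ring_of_type_algebra_inverse:
  fixes x :: "'a::field_char_0"
  assumes "x \<noteq> 0"
  shows "inv\<^bsub>ring_of_type_algebra\<^esub> x = inverse x"
proof -
  interpret Ring.field "ring_of_type_algebra :: 'a ring" by (rule field_from_type_algebra)
  show ?thesis using assms by (intro comm_inv_char) auto
qed

locale subfield_set =
  fixes F :: "'a::field_char_0 set"
  assumes one_mem: "1 \<in> F"
    and diff_mem: "x \<in> F \<Longrightarrow> y \<in> F \<Longrightarrow> x - y \<in> F"
    and mult_mem: "x \<in> F \<Longrightarrow> y \<in> F \<Longrightarrow> x * y \<in> F"
    and inverse_mem: "x \<in> F \<Longrightarrow> inverse x \<in> F"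
begin

lemma zero_mem: "0 \<in> F"
  using diff_mem[OF one_mem one_mem] by simp

lemma add_subgroup: "add_subgroup F"
  by (simp add: add_subgroup_def zero_mem diff_mem)

lemmas add_mem = add_subgroup_add[OF add_subgroup]
lemmas uminus_mem = add_subgroup_uminus[OF add_subgroup]
lemmas sum_mem = add_subgroup_sum[OF add_subgroup]

lemma divide_mem: "x \<in> F \<Longrightarrow> y \<in> F \<Longrightarrow> x / y \<in> F"
  by (simp add: divide_inverse mult_mem inverse_mem)

lemma power_mem: "x \<in> F \<Longrightarrow> x ^ n \<in> F"
  by (induction n) (auto simp: one_mem mult_mem)

lemma prod_mem: "(\<And>i. i \<in> I \<Longrightarrow> f i \<in> F) \<Longrightarrow> prod f I \<in> F"
  by (induction I rule: infinite_finite_induct) (auto simp: one_mem mult_mem)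

lemma of_int_mem: "of_int n \<in> F"
  using add_subgroup_of_int_mult[OF add_subgroup one_mem, of n] by simp

lemma of_nat_mem: "of_nat n \<in> F"
  using of_int_mem[of "int n"] by simp

end

lemma subfield_imp_subfield_set:
  assumes "subfield F (ring_of_type_algebra :: 'a::field_char_0 ring)"
  shows "subfield_set F"
proof -
  let ?R = "ring_of_type_algebra :: 'a ring"
  interpret R: Ring.field ?R by (rule field_from_type_algebra)
  note subring_props = subringE[OF subfieldE(1)[OF assms]]
  show ?thesis
  proof
    show "1 \<in> F" using subring_props(3) by simp
    fix x y assume xy: "x \<in> F" "y \<in> F"
    show "x - y \<in> F" using subring_props(7)[OF xy(1) subring_props(5)[OF xy(2)]] by (simp add: ring_of_type_algebra_uminus)
    show "x * y \<in> F" using subring_props(6)[OF xy] by simp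
    show "inverse x \<in> F"
      using R.subfield_m_inv(1)[OF assms, of x] xy by (cases "x = 0") (auto simp: ring_of_type_algebra_inverse)
  qed
qed

lemma subfield_Rats: "subfield \<rat> (ring_of_type_algebra :: 'a::field_char_0 ring)"
proof -
  interpret R: Ring.field "ring_of_type_algebra :: 'a ring" by (rule field_from_type_algebra)
  have "subring \<rat> (ring_of_type_algebra :: 'a ring)"
    by (rule R.subringI) (auto simp: ring_of_type_algebra_uminus)
  then show ?thesis by (rule R.subfieldI') (auto simp: ring_of_type_algebra_inverse)
qed

lemma homogeneous_system_pivot:
  fixes a :: "'b \<Rightarrow> 'c \<Rightarrow> 'a::field"
  assumes "finite J" "l \<in> J" "a r l \<noteq> 0"
    and reduced: "\<And>i. i \<in> I \<Longrightarrow> (\<Sum>j\<in>J - {l}. (a i j - a i l * a r j / a r l) * c j) = 0"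
    and d: "d = c(l := - (\<Sum>j\<in>J - {l}. a r j * c j) / a r l)"
    and i: "i \<in> insert r I"
  shows "(\<Sum>j\<in>J. a i j * d j) = 0"
proof -
  have sum_d: "(\<Sum>j\<in>J. a i j * d j) = a i l * d l + (\<Sum>j\<in>J - {l}. a i j * c j)"
    using assms(1,2) by (simp add: sum.remove[of J l] d)
  show ?thesis
  proof (cases "i = r")
    case True
    then show ?thesis unfolding sum_d using assms(3) by (simp add: d)
  next
    case False
    then have "0 = (\<Sum>j\<in>J - {l}. (a i j - a i l * a r j / a r l) * c j)" using reduced i by simp
    also have "\<dots> = (\<Sum>j\<in>J - {l}. a i j * c j) - a i l / a r l * (\<Sum>j\<in>J - {l}. a r j * c j)"
      by (simp add: left_diff_distrib sum_subtractf sum_distrib_left mult.assoc)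
    finally show ?thesis unfolding sum_d by (simp add: d)
  qed
qed

lemma (in subfield_set) homogeneous_system_solution:
  assumes "finite I" "finite J" "card I < card J"
    and "\<And>i j. i \<in> I \<Longrightarrow> j \<in> J \<Longrightarrow> a i j \<in> F"
  shows "\<exists>c. (\<forall>j\<in>J. c j \<in> F) \<and> (\<exists>j\<in>J. c j \<noteq> 0) \<and> (\<forall>i\<in>I. (\<Sum>j\<in>J. a i j * c j) = 0)"
  using assms
proof (induction I arbitrary: J a rule: finite_induct)
  case empty
  then have "J \<noteq> {}" by auto
  then show ?case using one_mem by (intro exI[of _ "\<lambda>_. 1"]) auto
next
  case (insert r I)
  show ?case
  proof (cases "\<forall>j\<in>J. a r j = 0")
    case True
    have "\<exists>c. (\<forall>j\<in>J. c j \<in> F) \<and> (\<exists>j\<in>J. c j \<noteq> 0) \<and> (\<forall>i\<in>I. (\<Sum>j\<in>J. a i j * c j) = 0)"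
      using insert.prems insert.hyps by (intro insert.IH) auto
    then show ?thesis using True by auto
  next
    case False
    then obtain l where l: "l \<in> J" "a r l \<noteq> 0" by blast
    define b where "b = (\<lambda>i j. a i j - a i l * a r j / a r l)"
    have "\<exists>c. (\<forall>j\<in>J - {l}. c j \<in> F) \<and> (\<exists>j\<in>J - {l}. c j \<noteq> 0) \<and>
        (\<forall>i\<in>I. (\<Sum>j\<in>J - {l}. b i j * c j) = 0)"
      using insert.prems insert.hyps l
      by (intro insert.IH) (auto simp: b_def intro!: diff_mem mult_mem divide_mem)
    then obtain c where c: "\<And>j. j \<in> J - {l} \<Longrightarrow> c j \<in> F" "\<exists>j\<in>J - {l}. c j \<noteq> 0"
      "\<And>i. i \<in> I \<Longrightarrow> (\<Sum>j\<in>J - {l}. b i j * c j) = 0" by blast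
    define t where "t = - (\<Sum>j\<in>J - {l}. a r j * c j) / a r l"
    define d where "d = c(l := t)"
    have "t \<in> F" using c(1) insert.prems(3) l
      unfolding t_def by (intro divide_mem uminus_mem sum_mem mult_mem) auto
    then have "\<forall>j\<in>J. d j \<in> F" using c(1) by (auto simp: d_def)
    moreover have "\<exists>j\<in>J. d j \<noteq> 0" using c(2) by (auto simp: d_def)
    moreover have "\<forall>i\<in>insert r I. (\<Sum>j\<in>J. a i j * d j) = 0"
      using homogeneous_system_pivot[where a = a and c = c and d = d and r = r and I = I,
          OF insert.prems(1) l c(3)[unfolded b_def] d_def[unfolded t_def]] by blast
    ultimately show ?thesis by blast
  qed
qed

section \<open>Number fields\<close>

locale number_field_set =
  fixes F :: "'a::field_char_0 set"
  assumes number_field: "number_field F"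

sublocale number_field_set \<subseteq> subfield_set F
  using number_field by (intro subfield_imp_subfield_set) (simp add: number_field_def)

lemma ring_of_type_algebra_combine:
  fixes us :: "'a::field_char_0 list"
  assumes "length cs = length us"
  shows "ring.combine ring_of_type_algebra cs us = (\<Sum>i<length us. cs ! i * us ! i)"
proof -
  interpret Ring.field "ring_of_type_algebra :: 'a ring" by (rule field_from_type_algebra)
  show ?thesis using assms
    by (induction cs us rule: list_induct2) (simp_all add: sum.lessThan_Suc_shift del: sum.lessThan_Suc)
qed

lemma common_multiplier:
  fixes c :: "'b \<Rightarrow> 'a::comm_semiring_1"
  assumes "finite I" "\<And>i. i \<in> I \<Longrightarrow> \<exists>m::nat. m > 0 \<and> of_nat m * c i \<in> S"
    and "\<And>(m::nat) x. x \<in> S \<Longrightarrow> of_nat m * x \<in> S"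
  obtains N :: nat where "N > 0" "\<And>i. i \<in> I \<Longrightarrow> of_nat N * c i \<in> S"
proof -
  obtain e :: "'b \<Rightarrow> nat" where e: "\<And>i. i \<in> I \<Longrightarrow> e i > 0 \<and> of_nat (e i) * c i \<in> S"
    using assms(2) by metis
  have "of_nat (\<Prod>i\<in>I. e i) * c i \<in> S" if i: "i \<in> I" for i
  proof -
    have "(\<Prod>i\<in>I. e i) = (\<Prod>j\<in>I - {i}. e j) * e i"
      using prod.remove[OF assms(1) i, of e] by (simp add: mult.commute)
    then have "of_nat (\<Prod>i\<in>I. e i) * c i = of_nat (\<Prod>j\<in>I - {i}. e j) * (of_nat (e i) * c i)"
      by (simp only: of_nat_mult mult.assoc)
    then show ?thesis using assms(3) e[OF i] by metis
  qed
  moreover have "(\<Prod>i\<in>I. e i) > 0" using e by (auto intro!: prod_pos)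
  ultimately show ?thesis using that by blast
qed

definition rat_degree :: "'a::field_char_0 set \<Rightarrow> nat" where
  "rat_degree F = (SOME n. ring.dimension (ring_of_type_algebra :: 'a ring) n \<rat> F)"

context number_field_set
begin

lemma rat_dependent:
  assumes x: "\<And>i. i \<le> rat_degree F \<Longrightarrow> x i \<in> F"
  obtains c where "\<forall>i\<le>rat_degree F. c i \<in> \<rat>" "\<exists>i\<le>rat_degree F. c i \<noteq> 0"
    "(\<Sum>i\<le>rat_degree F. c i * x i) = 0"
proof -
  let ?R = "ring_of_type_algebra :: 'a ring"
  interpret R: Ring.field ?R by (rule field_from_type_algebra)
  let ?d = "rat_degree F"
  define us where "us = map x [0..<Suc ?d]"
  have us: "length us = Suc ?d" "\<And>i. i < Suc ?d \<Longrightarrow> us ! i = x i"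
    by (simp_all add: us_def del: upt_Suc)
  have usF: "set us \<subseteq> F" using x by (auto simp: us_def simp del: upt_Suc)
  have "R.dimension ?d \<rat> F"
    using number_field someI_ex[of "\<lambda>n. R.dimension n \<rat> F"] by (simp add: number_field_def rat_degree_def)
  then have "\<not> R.independent \<rat> us"
    using R.independent_length_le_dimension[OF subfield_Rats, of ?d F us] usF us(1) by auto
  then obtain cs where cs: "length cs = length us" "R.combine cs us = 0" "set cs \<subseteq> \<rat>" "set cs \<noteq> {0}"
    by (rule R.dependent_imp_non_trivial_combine[OF subfield_Rats, rotated]) simp_all
  have "(\<Sum>i<Suc ?d. cs ! i * x i) = (\<Sum>i<length us. cs ! i * us ! i)" by (simp add: us)
  then have relation: "(\<Sum>i\<le>?d. cs ! i * x i) = 0"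
    using cs(1,2) by (simp only: ring_of_type_algebra_combine lessThan_Suc_atMost)
  have "\<exists>i\<le>?d. cs ! i \<noteq> 0"
  proof (rule ccontr)
    assume "\<not> (\<exists>i\<le>?d. cs ! i \<noteq> 0)"
    then have "set cs \<subseteq> {0}" using cs(1) us(1) by (auto simp: in_set_conv_nth less_Suc_eq_le)
    moreover have "set cs \<noteq> {}" using cs(1) us(1) by auto
    ultimately show False using cs(4) by (metis subset_singletonD)
  qed
  moreover have "cs ! i \<in> \<rat>" if "i \<le> ?d" for i using cs(1,3) us(1) that by (auto simp: subset_iff)
  ultimately show ?thesis using that[of "\<lambda>i. cs ! i"] relation by blast
qed

lemma int_dependent:
  assumes x: "\<And>i. i \<le> rat_degree F \<Longrightarrow> x i \<in> F"
  obtains c :: "nat \<Rightarrow> int"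
    where "\<exists>i\<le>rat_degree F. c i \<noteq> 0" "(\<Sum>i\<le>rat_degree F. of_int (c i) * x i) = 0"
proof -
  let ?d = "rat_degree F"
  obtain c where c: "\<forall>i\<le>?d. c i \<in> \<rat>" "\<exists>i\<le>?d. c i \<noteq> 0" "(\<Sum>i\<le>?d. c i * x i) = 0"
    by (rule rat_dependent[of x, OF x])
  have "\<exists>m::nat. m > 0 \<and> of_nat m * c i \<in> \<int>" if "i \<in> {..?d}" for i
  proof -
    have "c i \<in> \<rat>" using c(1) that by simp
    then obtain a b :: int where "b > 0" "c i = of_int a / of_int b" by (cases rule: Rats_cases') auto
    then show ?thesis by (intro exI[of _ "nat b"]) simp
  qed
  then obtain N :: nat where N: "N > 0" "\<And>i. i \<in> {..?d} \<Longrightarrow> of_nat N * c i \<in> \<int>"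
    by (rule common_multiplier[where I = "{..?d}" and c = c and S = \<int>, rotated])
       (auto intro: Ints_mult)
  then have "\<forall>i\<in>{..?d}. \<exists>e::int. of_nat N * c i = of_int e" by (metis Ints_cases)
  then obtain e :: "nat \<Rightarrow> int" where e: "\<forall>i\<in>{..?d}. of_nat N * c i = of_int (e i)"
    by (rule bchoice[THEN exE])
  show ?thesis
  proof (rule that[of e])
    obtain j where j: "j \<le> ?d" "c j \<noteq> 0" using c(2) by blast
    then have "(of_int (e j) :: 'a) = of_nat N * c j" using e by simp
    then have "e j \<noteq> 0" using j(2) N(1) by auto
    then show "\<exists>i\<le>?d. e i \<noteq> 0" using j(1) by blast
    have "(\<Sum>i\<le>?d. of_int (e i) * x i) = (\<Sum>i\<le>?d. of_nat N * (c i * x i))"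
      using e by (intro sum.cong refl) (simp add: mult.assoc[symmetric])
    also have "\<dots> = 0" using c(3) by (simp add: sum_distrib_left[symmetric])
    finally show "(\<Sum>i\<le>?d. of_int (e i) * x i) = 0" .
  qed
qed

lemma int_dependent_mod_prime:
  assumes x: "\<And>i. i \<le> rat_degree F \<Longrightarrow> x i \<in> F" and q: "Factorial_Ring.prime (q :: int)"
  obtains c :: "nat \<Rightarrow> int"
    where "\<exists>i\<le>rat_degree F. \<not> q dvd c i" "(\<Sum>i\<le>rat_degree F. of_int (c i) * x i) = 0"
proof -
  let ?d = "rat_degree F"
  obtain c :: "nat \<Rightarrow> int" where c: "\<exists>i\<le>?d. c i \<noteq> 0" "(\<Sum>i\<le>?d. of_int (c i) * x i) = 0"
    by (rule int_dependent[OF x])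
  define g where "g = Gcd (c ` {..?d})"
  have g: "g \<noteq> 0" using c(1) by (auto simp: g_def Gcd_0_iff)
  define e where "e = (\<lambda>i. c i div g)"
  have c_eq: "c i = g * e i" if "i \<le> ?d" for i
    using that by (simp add: e_def g_def Gcd_dvd)
  show ?thesis
  proof (rule that[of e])
    show "\<exists>i\<le>?d. \<not> q dvd e i"
    proof (rule ccontr)
      assume "\<not> (\<exists>i\<le>?d. \<not> q dvd e i)"
      then have "g * q dvd c i" if "i \<le> ?d" for i using that c_eq by simp
      then have "g * q dvd g" unfolding g_def by (intro Gcd_greatest) auto
      then have "g * q dvd g * 1" by simp
      then have "q dvd 1" using g by (simp only: dvd_mult_cancel_left) simp
      with q show False by (simp add: prime_int_iff)
    qed
    have "of_int g * (\<Sum>i\<le>?d. of_int (e i) * x i) = (\<Sum>i\<le>?d. of_int (c i) * x i)"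
      unfolding sum_distrib_left by (intro sum.cong refl) (simp add: c_eq mult.assoc)
    then show "(\<Sum>i\<le>?d. of_int (e i) * x i) = 0" using c(2) g by simp
  qed
qed

end

section \<open>The index of an additive subgroup\<close>

definition add_cosets :: "'a::ab_group_add set \<Rightarrow> 'a set \<Rightarrow> 'a set set" where
  "add_cosets A B = (\<lambda>x. (+) x ` B) ` A"

definition add_index :: "'a::ab_group_add set \<Rightarrow> 'a set \<Rightarrow> nat" where
  "add_index A B = card (add_cosets A B)"

lemma add_coset_eq_iff:
  assumes "add_subgroup B"
  shows "(+) x ` B = (+) y ` B \<longleftrightarrow> x - y \<in> B"
proof
  assume "(+) x ` B = (+) y ` B"
  then have "x \<in> (+) y ` B" using add_subgroup_zero[OF assms] by force
  then show "x - y \<in> B" by auto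
next
  assume diff: "x - y \<in> B"
  have coset_subset: "(+) a ` B \<subseteq> (+) b ` B" if "a - b \<in> B" for a b
  proof
    fix z assume "z \<in> (+) a ` B"
    then obtain c where "c \<in> B" "z = a + c" by blast
    then have "z = b + ((a - b) + c)" "(a - b) + c \<in> B" using add_subgroup_add[OF assms that] by auto
    then show "z \<in> (+) b ` B" by blast
  qed
  have "y - x \<in> B" using add_subgroup_uminus[OF assms diff] by simp
  with coset_subset diff show "(+) x ` B = (+) y ` B" by blast
qed

lemma add_index_eq_cardI:
  assumes "add_subgroup B" and "\<And>t. t \<in> S \<Longrightarrow> f t \<in> A"
    and "\<And>t u. t \<in> S \<Longrightarrow> u \<in> S \<Longrightarrow> f t - f u \<in> B \<Longrightarrow> t = u"
    and "\<And>x. x \<in> A \<Longrightarrow> \<exists>t\<in>S. x - f t \<in> B"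
  shows "add_index A B = card S"
proof -
  have "bij_betw (\<lambda>t. (+) (f t) ` B) S (add_cosets A B)"
    unfolding bij_betw_def
  proof (intro conjI inj_onI equalityI subsetI)
    fix t u assume "t \<in> S" "u \<in> S" "(+) (f t) ` B = (+) (f u) ` B"
    then show "t = u" using assms(3) add_coset_eq_iff[OF assms(1)] by blast
  next
    fix Z assume "Z \<in> (\<lambda>t. (+) (f t) ` B) ` S"
    then show "Z \<in> add_cosets A B" using assms(2) by (auto simp: add_cosets_def)
  next
    fix Z assume "Z \<in> add_cosets A B"
    then obtain x where x: "x \<in> A" "Z = (+) x ` B" by (auto simp: add_cosets_def)
    then obtain t where "t \<in> S" "x - f t \<in> B" using assms(4) by blast
    then show "Z \<in> (\<lambda>t. (+) (f t) ` B) ` S" using x add_coset_eq_iff[OF assms(1)] by blast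
  qed
  then show ?thesis by (simp add: add_index_def bij_betw_same_card)
qed

lemma add_cosets_transversal:
  assumes "add_subgroup B"
  obtains T where "T \<subseteq> A" "card T = add_index A B" "\<forall>x\<in>A. \<exists>t\<in>T. x - t \<in> B"
    "\<forall>t\<in>T. \<forall>u\<in>T. t - u \<in> B \<longrightarrow> t = u"
proof -
  obtain T where T: "T \<subseteq> A" "inj_on (\<lambda>x. (+) x ` B) T" "add_cosets A B = (\<lambda>x. (+) x ` B) ` T"
    using subset_image_inj[of "add_cosets A B" "\<lambda>x. (+) x ` B" A] by (force simp: add_cosets_def)
  have repr: "\<exists>t\<in>T. x - t \<in> B" if "x \<in> A" for x
  proof -
    have "(+) x ` B \<in> (\<lambda>x. (+) x ` B) ` T" using that T(3) by (auto simp: add_cosets_def)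
    then show ?thesis using add_coset_eq_iff[OF assms] by blast
  qed
  have uniq: "t = u" if "t \<in> T" "u \<in> T" "t - u \<in> B" for t u
    using that inj_onD[OF T(2), of t u] add_coset_eq_iff[OF assms, of t u] by blast
  have "add_index A B = card T"
    by (rule add_index_eq_cardI[OF assms, of _ "\<lambda>t. t"]) (use T(1) repr uniq in auto)
  then show ?thesis using T(1) repr uniq by (intro that[of T]) auto
qed

lemma add_index_mult:
  assumes A: "add_subgroup A" and B: "add_subgroup B" and C: "add_subgroup C" and sub: "C \<subseteq> B" "B \<subseteq> A"
  shows "add_index A C = add_index A B * add_index B C"
proof -
  obtain T where T: "T \<subseteq> A" "card T = add_index A B" "\<forall>x\<in>A. \<exists>t\<in>T. x - t \<in> B"
    "\<forall>t\<in>T. \<forall>u\<in>T. t - u \<in> B \<longrightarrow> t = u"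
    by (rule add_cosets_transversal[OF B, of A])
  obtain U where U: "U \<subseteq> B" "card U = add_index B C" "\<forall>x\<in>B. \<exists>t\<in>U. x - t \<in> C"
    "\<forall>t\<in>U. \<forall>u\<in>U. t - u \<in> C \<longrightarrow> t = u"
    by (rule add_cosets_transversal[OF C, of B])
  have "add_index A C = card (T \<times> U)"
  proof (rule add_index_eq_cardI[OF C, of _ "\<lambda>p. fst p + snd p"])
    fix p assume "p \<in> T \<times> U"
    then show "fst p + snd p \<in> A" using T(1) U(1) sub by (auto intro!: add_subgroup_add[OF A])
  next
    fix p q assume p: "p \<in> T \<times> U" and q: "q \<in> T \<times> U"
      and eq: "(fst p + snd p) - (fst q + snd q) \<in> C"
    have "snd q - snd p \<in> B" using p q U(1) by (auto intro!: add_subgroup_diff[OF B])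
    then have "(fst p + snd p - (fst q + snd q)) + (snd q - snd p) \<in> B"
      using eq sub(1) by (intro add_subgroup_add[OF B]) auto
    then have "fst p - fst q \<in> B" by (simp add: algebra_simps)
    then have fst: "fst p = fst q" using p q T(4) by auto
    then have "snd p - snd q \<in> C" using eq by simp
    then have "snd p = snd q" using p q U(4) by auto
    with fst show "p = q" by (simp add: prod_eq_iff)
  next
    fix x assume "x \<in> A"
    then obtain t where t: "t \<in> T" "x - t \<in> B" using T(3) by blast
    then obtain u where "u \<in> U" "(x - t) - u \<in> C" using U(3) by blast
    then show "\<exists>p\<in>T \<times> U. x - (fst p + snd p) \<in> C"
      using t by (intro bexI[of _ "(t, u)"]) (auto simp: algebra_simps)
  qed
  then show ?thesis by (simp add: card_cartesian_product T(2) U(2))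
qed

lemma add_index_cong:
  assumes B: "add_subgroup B" and D: "add_subgroup D"
    and f: "\<And>x. x \<in> A \<Longrightarrow> f x \<in> C"
    and diff: "\<And>x y. x \<in> A \<Longrightarrow> y \<in> A \<Longrightarrow> f x - f y \<in> D \<longleftrightarrow> x - y \<in> B"
    and surj: "\<And>z. z \<in> C \<Longrightarrow> \<exists>x\<in>A. z - f x \<in> D"
  shows "add_index A B = add_index C D"
proof -
  obtain T where T: "T \<subseteq> A" "card T = add_index A B" "\<forall>x\<in>A. \<exists>t\<in>T. x - t \<in> B"
    "\<forall>t\<in>T. \<forall>u\<in>T. t - u \<in> B \<longrightarrow> t = u"
    by (rule add_cosets_transversal[OF B, of A])
  have "add_index C D = card T"
  proof (rule add_index_eq_cardI[OF D, of _ f])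
    fix z assume "z \<in> C"
    then obtain x where x: "x \<in> A" "z - f x \<in> D" using surj by blast
    then obtain t where t: "t \<in> T" "x - t \<in> B" using T(3) by blast
    then have "f x - f t \<in> D" using diff x T(1) by blast
    then have "(z - f x) + (f x - f t) \<in> D" by (intro add_subgroup_add[OF D] x)
    then show "\<exists>t\<in>T. z - f t \<in> D" using t by auto
  qed (use f diff T in blast)+
  then show ?thesis by (simp add: T(2))
qed

lemma add_index_self: "add_subgroup A \<Longrightarrow> add_index A A = 1"
  by (subst add_index_eq_cardI[of A "{0}" "\<lambda>_. 0"]) (auto simp: add_subgroup_zero)

lemma add_index_pos_iff: "add_subgroup A \<Longrightarrow> add_index A B > 0 \<longleftrightarrow> finite (add_cosets A B)"
  using add_subgroup_zero[of A] by (auto simp: add_index_def card_gt_0_iff add_cosets_def)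

lemma add_index_eq_1_imp_eq:
  assumes A: "add_subgroup A" and B: "add_subgroup B" and sub: "B \<subseteq> A" and index: "add_index A B = 1"
  shows "A = B"
proof -
  obtain Z where Z: "add_cosets A B = {Z}" using index by (auto simp: add_index_def card_1_singleton_iff)
  have "x \<in> B" if "x \<in> A" for x
  proof -
    have "(+) x ` B \<in> add_cosets A B" "(+) 0 ` B \<in> add_cosets A B"
      using that add_subgroup_zero[OF A] unfolding add_cosets_def by blast+
    then have "(+) x ` B = (+) 0 ` B" unfolding Z by simp
    then show ?thesis using add_coset_eq_iff[OF B, of x 0] by simp
  qed
  with sub show ?thesis by blast
qed

lemma add_index_pigeonhole:
  fixes f :: "nat \<Rightarrow> 'a::ab_group_add"
  assumes "add_subgroup B" "add_index A B > 0" "\<And>n. f n \<in> A"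
  obtains i j where "i < j" "f j - f i \<in> B"
proof -
  define g where "g = (\<lambda>n. (+) (f n) ` B)"
  have "range g \<subseteq> add_cosets A B" using assms(3) by (auto simp: add_cosets_def g_def)
  moreover have "finite (add_cosets A B)" using assms(2) by (simp add: add_index_def card_gt_0_iff)
  ultimately have "\<not> inj g" using finite_subset finite_imageD[of g UNIV] by blast
  then obtain i j where ij: "i < j" "g i = g j" by (metis injI linorder_neqE_nat)
  then have "f j - f i \<in> B" using add_coset_eq_iff[OF assms(1), of "f j" "f i"] by (simp add: g_def)
  with ij(1) show ?thesis by (rule that)
qed

section \<open>Counting in vector spaces over a residue field\<close>

definition add_submodule :: "'a::ring set \<Rightarrow> 'a set \<Rightarrow> bool" where
  "add_submodule R M \<longleftrightarrow> add_subgroup M \<and> (\<forall>r\<in>R. \<forall>x\<in>M. r * x \<in> M)"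

lemma add_submoduleI:
  assumes "add_subgroup M" "\<And>r x. r \<in> R \<Longrightarrow> x \<in> M \<Longrightarrow> r * x \<in> M"
  shows "add_submodule R M"
  using assms by (simp add: add_submodule_def)

lemma add_submodule_subgroup: "add_submodule R M \<Longrightarrow> add_subgroup M"
  and add_submodule_mult: "add_submodule R M \<Longrightarrow> r \<in> R \<Longrightarrow> x \<in> M \<Longrightarrow> r * x \<in> M"
  by (simp_all add: add_submodule_def)

text \<open>
  \<open>R\<close> is a ring with a maximal ideal \<open>p\<close>, and \<open>M / I\<close> is a vector space of dimension at
  most \<open>n\<close> over the residue field \<open>R / p\<close>.
\<close>

locale residue_space =
  fixes R p M I :: "'a::comm_ring_1 set" and n :: nat
  assumes ring: "add_submodule R R"
    and ideal: "add_submodule R p" "p \<subseteq> R"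
    and inverse_mod: "c \<in> R \<Longrightarrow> c \<notin> p \<Longrightarrow> \<exists>c'\<in>R. c' * c - 1 \<in> p"
    and space: "add_submodule R M"
    and subspace: "add_submodule R I" "I \<subseteq> M"
    and annihilates: "r \<in> p \<Longrightarrow> x \<in> M \<Longrightarrow> r * x \<in> I"
    and dependent: "(\<And>i. i \<le> n \<Longrightarrow> v i \<in> M) \<Longrightarrow>
      \<exists>e. (\<forall>i\<le>n. e i \<in> R) \<and> (\<exists>i\<le>n. e i \<notin> p) \<and> (\<Sum>i\<le>n. e i * v i) \<in> I"
begin

lemmas R = add_submodule_subgroup[OF ring]
lemmas M = add_submodule_subgroup[OF space]
lemmas I = add_submodule_subgroup[OF subspace(1)]

definition independent :: "nat \<Rightarrow> (nat \<Rightarrow> 'a) \<Rightarrow> bool" where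
  "independent m x \<longleftrightarrow> (\<forall>i<m. x i \<in> M) \<and>
     (\<forall>c. (\<forall>i<m. c i \<in> R) \<longrightarrow> (\<Sum>i<m. c i * x i) \<in> I \<longrightarrow> (\<forall>i<m. c i \<in> p))"

definition spanning :: "nat \<Rightarrow> (nat \<Rightarrow> 'a) \<Rightarrow> bool" where
  "spanning m x \<longleftrightarrow> (\<forall>y\<in>M. \<exists>c. (\<forall>i<m. c i \<in> R) \<and> y - (\<Sum>i<m. c i * x i) \<in> I)"

lemma independent_length_le:
  assumes "independent m x"
  shows "m \<le> n"
proof (rule ccontr)
  assume "\<not> m \<le> n"
  then have m: "{..n} \<subseteq> {..<m}" by auto
  then have "\<And>i. i \<le> n \<Longrightarrow> x i \<in> M" using assms by (auto simp: independent_def)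
  then obtain c where c: "\<forall>i\<le>n. c i \<in> R" "\<exists>i\<le>n. c i \<notin> p" "(\<Sum>i\<le>n. c i * x i) \<in> I"
    using dependent[of x] by blast
  define e where "e = (\<lambda>i. if i \<le> n then c i else 0)"
  have "(\<Sum>i<m. e i * x i) = (\<Sum>i\<le>n. c i * x i)"
    using m by (intro sum.mono_neutral_cong_right) (auto simp: e_def)
  moreover have "\<forall>i<m. e i \<in> R" using c(1) add_subgroup_zero[OF R] by (simp add: e_def)
  ultimately have "\<forall>i<m. e i \<in> p"
    using assms[unfolded independent_def, THEN conjunct2, THEN spec, of e] c(3) by simp
  then have "\<forall>i\<le>n. c i \<in> p" using m by (auto simp: e_def subset_iff)
  with c(2) show False by blast
qed

lemma maximal_independent:
  obtains m x where "independent m x" "\<forall>y. \<not> independent (Suc m) y"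
proof -
  let ?P = "\<lambda>m. \<exists>x. independent m x"
  define m where "m = (GREATEST m. ?P m)"
  have "?P 0" by (simp add: independent_def)
  then have "?P m" unfolding m_def
    using GreatestI_nat[of ?P 0 n] independent_length_le by blast
  then obtain x where "independent m x" by blast
  moreover have "\<forall>y. \<not> independent (Suc m) y"
    using Greatest_le_nat[of ?P "Suc m" n] independent_length_le unfolding m_def[symmetric]
    by (metis Suc_n_not_le_n)
  ultimately show ?thesis by (rule that)
qed

lemma maximal_independent_spanning:
  assumes x: "independent m x" and maximal: "\<forall>y. \<not> independent (Suc m) y"
  shows "spanning m x"
  unfolding spanning_def
proof
  fix y assume y: "y \<in> M"
  define z where "z = x(m := y)"
  have "\<forall>i<Suc m. z i \<in> M" using x y by (auto simp: z_def less_Suc_eq independent_def)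
  with maximal obtain c where c: "\<forall>i<Suc m. c i \<in> R" "(\<Sum>i<Suc m. c i * z i) \<in> I"
    "\<not> (\<forall>i<Suc m. c i \<in> p)" unfolding independent_def by blast
  have sum: "(\<Sum>i<Suc m. c i * z i) = (\<Sum>i<m. c i * x i) + c m * y" by (simp add: z_def)
  have "c m \<notin> p"
  proof
    assume last_mem: "c m \<in> p"
    have "(\<Sum>i<m. c i * x i) = (\<Sum>i<Suc m. c i * z i) - c m * y" unfolding sum by simp
    also have "\<dots> \<in> I" by (intro add_subgroup_diff[OF I] c(2) annihilates last_mem y)
    finally have "\<forall>i<m. c i \<in> p" using x c(1) unfolding independent_def by auto
    with last_mem c(3) show False by (auto simp: less_Suc_eq)
  qed
  then obtain c' where c': "c' \<in> R" "c' * c m - 1 \<in> p" using inverse_mod c(1) by blast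
  define e where "e = (\<lambda>i. - (c' * c i))"
  have "y - (\<Sum>i<m. e i * x i) = c' * (\<Sum>i<Suc m. c i * z i) - (c' * c m - 1) * y"
    unfolding sum e_def by (simp add: algebra_simps sum_distrib_left sum_negf)
  also have "\<dots> \<in> I"
    by (intro add_subgroup_diff[OF I] add_submodule_mult[OF subspace(1)] c' c annihilates y)
  finally have "y - (\<Sum>i<m. e i * x i) \<in> I" .
  moreover have "\<forall>i<m. e i \<in> R"
    using add_submodule_mult[OF ring c'(1)] c(1) add_subgroup_uminus[OF R] by (auto simp: e_def)
  ultimately show "\<exists>c. (\<forall>i<m. c i \<in> R) \<and> y - (\<Sum>i<m. c i * x i) \<in> I" by blast
qed

lemma add_index_eq_power:
  assumes indep: "independent m x" and span: "spanning m x"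
  shows "add_index M I = add_index R p ^ m"
proof -
  have xM: "x i \<in> M" if "i < m" for i using indep that by (auto simp: independent_def)
  obtain T where T: "T \<subseteq> R" "card T = add_index R p" "\<forall>x\<in>R. \<exists>t\<in>T. x - t \<in> p"
    "\<forall>t\<in>T. \<forall>u\<in>T. t - u \<in> p \<longrightarrow> t = u"
    by (rule add_cosets_transversal[OF add_submodule_subgroup[OF ideal(1)], of R])
  have "add_index M I = card ({..<m} \<rightarrow>\<^sub>E T)"
  proof (rule add_index_eq_cardI[OF I, of _ "\<lambda>c. \<Sum>i<m. c i * x i"])
    fix c assume "c \<in> {..<m} \<rightarrow>\<^sub>E T"
    then show "(\<Sum>i<m. c i * x i) \<in> M"
      using T(1) xM by (intro add_subgroup_sum[OF M] add_submodule_mult[OF space]) auto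
  next
    fix c e assume tuples: "c \<in> {..<m} \<rightarrow>\<^sub>E T" "e \<in> {..<m} \<rightarrow>\<^sub>E T"
      and "(\<Sum>i<m. c i * x i) - (\<Sum>i<m. e i * x i) \<in> I"
    then have "(\<Sum>i<m. (c i - e i) * x i) \<in> I" by (simp add: left_diff_distrib sum_subtractf)
    moreover have "\<forall>i<m. c i - e i \<in> R" using tuples T(1) by (auto intro!: add_subgroup_diff[OF R])
    ultimately have "\<forall>i<m. c i - e i \<in> p"
      using indep[unfolded independent_def, THEN conjunct2, THEN spec, of "\<lambda>i. c i - e i"] by blast
    then have "c i = e i" if "i < m" for i using tuples that T(4) by (auto simp: PiE_iff)
    then show "c = e" using tuples by (intro PiE_ext[of c "{..<m}" "\<lambda>_. T" e]) auto
  next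
    fix y assume "y \<in> M"
    then obtain c where c: "\<forall>i<m. c i \<in> R" "y - (\<Sum>i<m. c i * x i) \<in> I"
      using span by (auto simp: spanning_def)
    then have "\<forall>i<m. \<exists>t\<in>T. c i - t \<in> p" using T(3) by blast
    then obtain t where t: "\<forall>i<m. t i \<in> T \<and> c i - t i \<in> p" by metis
    define u where "u = restrict t {..<m}"
    have "(\<Sum>i<m. (c i - u i) * x i) \<in> I"
      using t xM by (intro add_subgroup_sum[OF I] annihilates) (auto simp: u_def)
    then have "(y - (\<Sum>i<m. c i * x i)) + (\<Sum>i<m. (c i - u i) * x i) \<in> I"
      by (intro add_subgroup_add[OF I] c(2))
    then have "y - (\<Sum>i<m. u i * x i) \<in> I" by (simp add: left_diff_distrib sum_subtractf)
    moreover have "u \<in> {..<m} \<rightarrow>\<^sub>E T" using t by (auto simp: u_def)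
    ultimately show "\<exists>t\<in>{..<m} \<rightarrow>\<^sub>E T. y - (\<Sum>i<m. t i * x i) \<in> I" by blast
  qed
  then show ?thesis by (simp add: card_PiE T(2))
qed

lemma spanning_family:
  obtains m x where "m \<le> n" "\<forall>i<m. x i \<in> M" "spanning m x"
    "add_index M I = add_index R p ^ m"
proof -
  obtain m x where x: "independent m x" "\<forall>y. \<not> independent (Suc m) y"
    by (rule maximal_independent)
  note span = maximal_independent_spanning[OF x]
  show ?thesis
    by (rule that[OF independent_length_le[OF x(1)] _ span add_index_eq_power[OF x(1) span]])
       (use x(1) in \<open>simp add: independent_def\<close>)
qed

end

section \<open>Rings of integers\<close>

context number_field_set
begin

abbreviation (input) ints ("\<O>") where "\<O> \<equiv> ints_of F"

lemma ints_subset: "x \<in> \<O> \<Longrightarrow> x \<in> F"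
  and ints_one: "1 \<in> \<O>"
  and ints_of_int: "of_int n \<in> \<O>"
  and ints_of_nat: "of_nat m \<in> \<O>"
  by (auto simp: ints_of_def one_mem of_int_mem of_nat_mem)

lemma ints_subgroup: "add_subgroup \<O>"
proof (rule add_subgroupI)
  fix x y assume "x \<in> \<O>" "y \<in> \<O>"
  then show "x - y \<in> \<O>" using algebraic_int_add[of x "- y"] by (auto simp: ints_of_def diff_mem)
qed (simp add: ints_of_def zero_mem)

lemmas ints_zero = add_subgroup_zero[OF ints_subgroup]
  and ints_diff = add_subgroup_diff[OF ints_subgroup]
  and ints_add = add_subgroup_add[OF ints_subgroup]
  and ints_uminus = add_subgroup_uminus[OF ints_subgroup]
  and ints_sum = add_subgroup_sum[OF ints_subgroup]

lemma ints_mult: "x \<in> \<O> \<Longrightarrow> y \<in> \<O> \<Longrightarrow> x * y \<in> \<O>"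
  by (auto simp: ints_of_def mult_mem algebraic_int_mult)

lemma ints_submodule: "add_submodule \<O> \<O>"
  by (rule add_submoduleI[OF ints_subgroup ints_mult])

lemma ints_power: "x \<in> \<O> \<Longrightarrow> x ^ n \<in> \<O>"
  by (induction n) (auto simp: ints_one ints_mult)

lemma ints_prod: "(\<And>i. i \<in> I \<Longrightarrow> f i \<in> \<O>) \<Longrightarrow> prod f I \<in> \<O>"
  by (induction I rule: infinite_finite_induct) (auto simp: ints_one ints_mult)

lemma ex_int_poly_root:
  assumes "x \<in> F"
  obtains p where "p \<noteq> 0" "Polynomial.degree p \<le> rat_degree F" "\<forall>i. Polynomial.coeff p i \<in> \<int>" "poly p x = 0"
proof -
  let ?d = "rat_degree F"
  obtain c :: "nat \<Rightarrow> int" where c: "\<exists>i\<le>?d. c i \<noteq> 0" "(\<Sum>i\<le>?d. of_int (c i) * x ^ i) = 0"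
    by (rule int_dependent[of "\<lambda>i. x ^ i", OF power_mem[OF assms]])
  define p :: "'a poly" where "p = (\<Sum>i\<le>?d. monom (of_int (c i)) i)"
  have coeff: "Polynomial.coeff p j = (if j \<le> ?d then of_int (c j) else 0)" for j
    by (simp add: p_def Polynomial.coeff_sum if_distrib cong: if_cong)
  show ?thesis
  proof (rule that[of p])
    show "\<forall>i. Polynomial.coeff p i \<in> \<int>" by (simp add: coeff)
    show "Polynomial.degree p \<le> ?d" by (rule degree_le) (simp add: coeff)
    obtain i where "i \<le> ?d" "c i \<noteq> 0" using c(1) by blast
    then have "Polynomial.coeff p i \<noteq> 0" by (simp add: coeff)
    then show "p \<noteq> 0" by auto
    show "poly p x = 0" using c(2) by (simp add: p_def poly_sum poly_monom)
  qed
qed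

lemma ints_denominator:
  assumes x: "x \<in> F"
  obtains m :: nat where "m > 0" "of_nat m * x \<in> \<O>"
proof -
  have "algebraic x" by (rule ex_int_poly_root[OF x]) (rule algebraicI, auto)
  then obtain p where p: "p \<noteq> 0" "poly (map_poly of_int p) x = 0" by (rule algebraicE')
  define a where "a = lead_coeff p"
  have a: "of_int a * x \<in> \<O>"
    using algebraic_int_lead_coeff_mult[OF p] by (simp add: ints_of_def a_def mult_mem of_int_mem x)
  have "of_nat (nat \<bar>a\<bar>) * x \<in> \<O>"
    using a ints_uminus[OF a] by (cases "a \<ge> 0") auto
  then show ?thesis using p(1) that[of "nat \<bar>a\<bar>"] by (simp add: a_def)
qed

lemma principal_iff: "y \<in> principal F x \<longleftrightarrow> (\<exists>r\<in>\<O>. y = x * r)"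
  by (auto simp: principal_def)

lemma principal_submodule: "add_submodule \<O> (principal F x)"
proof (rule add_submoduleI)
  show "add_subgroup (principal F x)"
    unfolding principal_def by (rule add_subgroup_image[OF ints_subgroup]) (simp add: right_diff_distrib)
  fix r y assume "r \<in> \<O>" "y \<in> principal F x"
  then show "r * y \<in> principal F x" using ints_mult mult.left_commute[of r x] by (auto simp: principal_iff)
qed

lemmas principal_subgroup = add_submodule_subgroup[OF principal_submodule]

lemma principal_one: "principal F 1 = \<O>"
  by (auto simp: principal_iff)

lemma principal_subset_ints: "x \<in> \<O> \<Longrightarrow> principal F x \<subseteq> \<O>"
  by (auto simp: principal_iff ints_mult)

end

section \<open>Finiteness of residue rings\<close>

definition int_multiples :: "int \<Rightarrow> 'a::ring_char_0 set" where
  "int_multiples q = range (\<lambda>z. of_int (q * z))"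

lemma of_int_mem_int_multiples_iff: "of_int c \<in> int_multiples q \<longleftrightarrow> q dvd c"
  by (auto simp: int_multiples_def dvd_def simp del: of_int_mult)

lemma Ints_submodule: "add_submodule \<int> \<int>"
  by (auto simp: add_submodule_def add_subgroup_def)

lemma int_multiples_submodule: "add_submodule \<int> (int_multiples q)"
proof (rule add_submoduleI)
  show "add_subgroup (int_multiples q :: 'a set)" unfolding int_multiples_def
  proof (rule add_subgroupI)
    show "0 \<in> range (\<lambda>z. of_int (q * z) :: 'a)" by (rule range_eqI[of _ _ 0]) simp
    fix x y :: 'a assume "x \<in> range (\<lambda>z. of_int (q * z))" "y \<in> range (\<lambda>z. of_int (q * z))"
    then obtain u v where "x = of_int (q * u)" "y = of_int (q * v)" by blast
    then show "x - y \<in> range (\<lambda>z. of_int (q * z))"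
      by (intro range_eqI[of _ _ "u - v"]) (simp add: right_diff_distrib)
  qed
  fix r x :: 'a assume "r \<in> \<int>" "x \<in> int_multiples q"
  then obtain a z where "r = of_int a" "x = of_int (q * z)" by (auto simp: Ints_def int_multiples_def)
  then have "r * x = of_int (q * (a * z))" by (simp add: mult.left_commute)
  then show "r * x \<in> int_multiples q" unfolding int_multiples_def by (rule range_eqI)
qed

lemma add_index_int_multiples_pos:
  assumes "q > 0"
  shows "add_index \<int> (int_multiples q :: 'a::ring_char_0 set) > 0"
proof -
  let ?coset = "\<lambda>x::'a. (+) x ` int_multiples q"
  note p = add_submodule_subgroup[OF int_multiples_submodule[where 'a = 'a]]
  have "add_cosets \<int> (int_multiples q) \<subseteq> (\<lambda>z. ?coset (of_int z)) ` {0..<q}"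
  proof
    fix Z :: "'a set" assume "Z \<in> add_cosets \<int> (int_multiples q)"
    then obtain z where z: "Z = ?coset (of_int z)" by (auto simp: add_cosets_def Ints_def)
    have "q dvd z - z mod q" by (simp add: minus_mod_eq_mult_div)
    then have "(of_int (z - z mod q) :: 'a) \<in> int_multiples q" by (simp only: of_int_mem_int_multiples_iff)
    then have "Z = ?coset (of_int (z mod q))" by (simp add: z add_coset_eq_iff[OF p])
    then show "Z \<in> (\<lambda>z. ?coset (of_int z)) ` {0..<q}" using assms by (intro image_eqI[of _ _ "z mod q"]) auto
  qed
  then have "finite (add_cosets \<int> (int_multiples q :: 'a set))" using finite_subset by blast
  then show ?thesis by (simp add: add_index_pos_iff[OF add_submodule_subgroup[OF Ints_submodule]])
qed

lemma ex_inverse_mod_prime_int_multiples: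
  assumes q: "Factorial_Ring.prime q" and c: "(c :: 'a::ring_char_0) \<in> \<int>" "c \<notin> int_multiples q"
  shows "\<exists>c'\<in>\<int>. c' * c - 1 \<in> int_multiples q"
proof -
  obtain z where z: "c = of_int z" "\<not> q dvd z" using c by (auto simp: Ints_def of_int_mem_int_multiples_iff)
  then have "coprime q z" using q by (simp add: prime_imp_coprime)
  then obtain u v where "u * q + v * z = 1" by (metis bezout_int coprime_imp_gcd_eq_1)
  then have "v * z - 1 = q * (- u)" by (simp add: algebra_simps)
  then have "of_int (v * z - 1) \<in> (int_multiples q :: 'a set)" by (simp only: of_int_mem_int_multiples_iff) simp
  then have "of_int v * c - 1 \<in> int_multiples q" by (simp add: z)
  then show ?thesis by (intro bexI[of _ "of_int v"]) auto
qed

lemma add_index_times_image: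
  fixes x :: "'a::field"
  assumes "add_subgroup B" "x \<noteq> 0"
  shows "add_index ((*) x ` A) ((*) x ` B) = add_index A B"
proof -
  have img: "add_subgroup ((*) x ` B)" using assms(1) by (rule add_subgroup_image) (simp add: right_diff_distrib)
  show ?thesis
  proof (rule add_index_cong[OF assms(1) img, of _ "(*) x", symmetric])
    show "x * a - x * b \<in> (*) x ` B \<longleftrightarrow> a - b \<in> B" for a b
      using assms(2) by (auto simp: right_diff_distrib[symmetric])
    fix z assume "z \<in> (*) x ` A"
    then obtain a where "a \<in> A" "z - x * a = 0" by auto
    then show "\<exists>a\<in>A. z - x * a \<in> (*) x ` B" using add_subgroup_zero[OF img] by (intro bexI[of _ a]) simp_all
  qed blast
qed

context number_field_set
begin

lemma residue_space_ints_mod_prime: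
  assumes "Factorial_Ring.prime q"
  shows "residue_space \<int> (int_multiples q) \<O> (principal F (of_int q)) (rat_degree F)"
proof
  fix r x :: 'a assume "r \<in> int_multiples q" "x \<in> \<O>"
  then show "r * x \<in> principal F (of_int q)"
    by (auto simp: int_multiples_def principal_iff mult.assoc
        intro!: bexI[of _ "of_int _ * x"] ints_mult ints_of_int)
next
  fix v :: "nat \<Rightarrow> 'a" assume "\<And>i. i \<le> rat_degree F \<Longrightarrow> v i \<in> \<O>"
  then have "\<And>i. i \<le> rat_degree F \<Longrightarrow> v i \<in> F" by (simp add: ints_subset)
  then obtain c :: "nat \<Rightarrow> int"
    where c: "\<exists>i\<le>rat_degree F. \<not> q dvd c i" "(\<Sum>i\<le>rat_degree F. of_int (c i) * v i) = 0"
    by (rule int_dependent_mod_prime[OF _ assms])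
  then show "\<exists>e. (\<forall>i\<le>rat_degree F. e i \<in> \<int>) \<and> (\<exists>i\<le>rat_degree F. e i \<notin> int_multiples q) \<and>
      (\<Sum>i\<le>rat_degree F. e i * v i) \<in> principal F (of_int q)"
    using add_subgroup_zero[OF principal_subgroup]
    by (intro exI[of _ "\<lambda>i. of_int (c i)"]) (simp add: of_int_mem_int_multiples_iff)
next
  show "\<exists>c'\<in>\<int>. c' * c - 1 \<in> int_multiples q" if "c \<in> \<int>" "c \<notin> int_multiples q" for c :: 'a
    using assms that by (rule ex_inverse_mod_prime_int_multiples)
  have "add_submodule \<int> M" if "add_submodule \<O> M" for M
    using that by (auto simp: add_submodule_def Ints_def ints_of_int)
  then show "add_submodule \<int> \<O>" "add_submodule \<int> (principal F (of_int q))"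
    using ints_submodule principal_submodule by blast+
  show "int_multiples q \<subseteq> (\<int> :: 'a set)" by (auto simp: int_multiples_def)
  show "principal F (of_int q) \<subseteq> \<O>" by (rule principal_subset_ints[OF ints_of_int])
qed (simp_all add: Ints_submodule int_multiples_submodule)

lemma add_index_ints_principal_prime_pos:
  assumes "Factorial_Ring.prime (q :: nat)"
  shows "add_index \<O> (principal F (of_nat q)) > 0"
proof -
  interpret residue_space \<int> "int_multiples (int q)" \<O> "principal F (of_nat q)" "rat_degree F"
    using residue_space_ints_mod_prime[of "int q"] assms by simp
  obtain m where "add_index \<O> (principal F (of_nat q)) = add_index \<int> (int_multiples (int q) :: 'a set) ^ m"
    by (rule spanning_family)
  then show ?thesis
    using add_index_int_multiples_pos[of "int q", where 'a = 'a] prime_gt_0_nat[OF assms] by simp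
qed

lemma add_index_ints_principal_pos:
  assumes "m > 0"
  shows "add_index \<O> (principal F (of_nat m)) > 0"
  using assms
proof (induction m rule: less_induct)
  case (less m)
  show ?case
  proof (cases "m = 1")
    case True
    then show ?thesis by (simp add: principal_one add_index_self ints_subgroup)
  next
    case False
    then obtain q where q: "Factorial_Ring.prime q" "q dvd m" using prime_factor_nat by blast
    then obtain n where n: "m = q * n" by auto
    have "n < m" "n > 0" using less.prems n prime_gt_1_nat[OF q(1)] by auto
    then have IH: "add_index \<O> (principal F (of_nat n)) > 0" by (rule less.IH)
    have img: "principal F (of_nat q) = (*) (of_nat q) ` \<O>"
      "principal F (of_nat m) = (*) (of_nat q) ` principal F (of_nat n)"
      by (simp_all add: principal_def image_image n mult.assoc)
    have "add_index (principal F (of_nat q)) (principal F (of_nat m)) = add_index \<O> (principal F (of_nat n))"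
      unfolding img using prime_gt_0_nat[OF q(1)] by (intro add_index_times_image principal_subgroup) simp
    moreover have "principal F (of_nat m) \<subseteq> principal F (of_nat q)"
      using principal_subset_ints[OF ints_of_nat, of n] unfolding img by blast
    ultimately have "add_index \<O> (principal F (of_nat m)) =
        add_index \<O> (principal F (of_nat q)) * add_index \<O> (principal F (of_nat n))"
      using add_index_mult[OF ints_subgroup principal_subgroup principal_subgroup _
          principal_subset_ints[OF ints_of_nat]] by metis
    then show ?thesis using IH add_index_ints_principal_prime_pos[OF q(1)] by simp
  qed
qed

lemma almost_integral_imp_integral:
  assumes x: "x \<in> F" and m: "m > 0" "\<And>j. of_nat m * x ^ j \<in> \<O>"
  shows "x \<in> \<O>"
proof -
  obtain i j where ij: "i < j" "of_nat m * x ^ j - of_nat m * x ^ i \<in> principal F (of_nat m)"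
    by (rule add_index_pigeonhole[OF principal_subgroup add_index_ints_principal_pos[OF m(1)], OF m(2)])
  then obtain r where "r \<in> \<O>" "of_nat m * (x ^ j - x ^ i) = of_nat m * r"
    by (auto simp: principal_iff right_diff_distrib)
  then have "x ^ j - x ^ i \<in> \<O>" using m(1) by simp
  then have "algebraic_int (x ^ j - x ^ i)" by (simp add: ints_of_def)
  then show ?thesis using algebraic_int_power_diff[OF _ ij(1)] x by (simp add: ints_of_def)
qed

end

section \<open>Products of ideals\<close>

lemma ideal_mult_memI: "a \<in> A \<Longrightarrow> b \<in> B \<Longrightarrow> a * b \<in> ideal_mult A B"
  unfolding ideal_mult_def
  by (intro CollectI exI[of _ 1] exI[of _ "\<lambda>_. a"] exI[of _ "\<lambda>_. b"]) auto

lemma ideal_mult_zero: "0 \<in> ideal_mult A B"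
  unfolding ideal_mult_def by (intro CollectI exI[of _ 0]) auto

lemma ideal_mult_add:
  assumes "x \<in> ideal_mult A B" "y \<in> ideal_mult A B"
  shows "x + y \<in> ideal_mult A B"
proof -
  obtain m :: nat and f g where m: "x = (\<Sum>i<m. f i * g i)" "\<forall>i<m. f i \<in> A" "\<forall>i<m. g i \<in> B"
    using assms(1) by (auto simp: ideal_mult_def)
  obtain n :: nat and h k where n: "y = (\<Sum>i<n. h i * k i)" "\<forall>i<n. h i \<in> A" "\<forall>i<n. k i \<in> B"
    using assms(2) by (auto simp: ideal_mult_def)
  define u where "u = (\<lambda>i. if i < m then f i else h (i - m))"
  define v where "v = (\<lambda>i. if i < m then g i else k (i - m))"
  have "(\<Sum>i<m + n. u i * v i) = (\<Sum>i<m. u i * v i) + (\<Sum>i=m..<m + n. u i * v i)"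
    by (simp add: lessThan_atLeast0 sum.atLeastLessThan_concat)
  also have "(\<Sum>i=m..<m + n. u i * v i) = (\<Sum>i<n. h i * k i)"
    using sum.shift_bounds_nat_ivl[of "\<lambda>i. u i * v i" 0 m n]
    by (simp add: u_def v_def lessThan_atLeast0 add.commute)
  also have "(\<Sum>i<m. u i * v i) = (\<Sum>i<m. f i * g i)" by (simp add: u_def v_def)
  finally have "x + y = (\<Sum>i<m + n. u i * v i)" by (simp add: m n)
  moreover have "\<forall>i<m + n. u i \<in> A" "\<forall>i<m + n. v i \<in> B" using m n by (auto simp: u_def v_def)
  ultimately show ?thesis unfolding ideal_mult_def by blast
qed

lemma ideal_mult_induct [consumes 1, case_names zero add mult]:
  assumes x: "x \<in> ideal_mult A B"
    and "P 0" "\<And>x y. P x \<Longrightarrow> P y \<Longrightarrow> P (x + y)" "\<And>a b. a \<in> A \<Longrightarrow> b \<in> B \<Longrightarrow> P (a * b)"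
  shows "P x"
proof -
  obtain n :: nat and f g where n: "x = (\<Sum>i<n. f i * g i)" "\<forall>i<n. f i \<in> A" "\<forall>i<n. g i \<in> B"
    using x by (auto simp: ideal_mult_def)
  have "P (\<Sum>i<k. f i * g i)" if "k \<le> n" for k
    using that by (induction k) (use assms n in auto)
  then show ?thesis using n(1) by simp
qed

lemma ideal_mult_least:
  assumes "add_subgroup C" "\<And>a b. a \<in> A \<Longrightarrow> b \<in> B \<Longrightarrow> a * b \<in> C"
  shows "ideal_mult A B \<subseteq> C"
proof
  fix x assume "x \<in> ideal_mult A B"
  then show "x \<in> C"
    by (induction rule: ideal_mult_induct) (simp_all add: assms add_subgroup_zero add_subgroup_add)
qed

lemma ideal_mult_mono:
  assumes "A \<subseteq> A'" "B \<subseteq> B'"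
  shows "ideal_mult A B \<subseteq> ideal_mult A' B'"
proof
  fix x assume "x \<in> ideal_mult A B"
  then show "x \<in> ideal_mult A' B'"
    by (induction rule: ideal_mult_induct) (use assms in \<open>auto intro: ideal_mult_zero ideal_mult_add ideal_mult_memI\<close>)
qed

lemma ideal_mult_commute: "ideal_mult A B = ideal_mult B A"
proof -
  have "x \<in> ideal_mult B A" if "x \<in> ideal_mult A B" for A B :: "'a set" and x
    using that
  proof (induction rule: ideal_mult_induct)
    case (mult a b)
    then show ?case using ideal_mult_memI[of b B a A] by (simp add: mult.commute)
  qed (simp_all add: ideal_mult_zero ideal_mult_add)
  then show ?thesis by blast
qed

lemma ideal_mult_assoc: "ideal_mult (ideal_mult A B) C = ideal_mult A (ideal_mult B C)"
proof -
  have sub: "ideal_mult (ideal_mult A B) C \<subseteq> ideal_mult A (ideal_mult B C)" for A B C :: "'a set"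
  proof
    fix x assume "x \<in> ideal_mult (ideal_mult A B) C"
    then show "x \<in> ideal_mult A (ideal_mult B C)"
    proof (induction rule: ideal_mult_induct)
      case (mult z c)
      from mult(1) show ?case
      proof (induction rule: ideal_mult_induct)
        case (mult a b)
        then show ?case using \<open>c \<in> C\<close> by (simp add: mult.assoc ideal_mult_memI)
      qed (simp_all add: distrib_right ideal_mult_zero ideal_mult_add)
    qed (simp_all add: ideal_mult_zero ideal_mult_add)
  qed
  show ?thesis
    using sub[of A B C] sub[of C B A] by (simp add: ideal_mult_commute)
qed

lemma ideal_mult_left_commute: "ideal_mult A (ideal_mult B C) = ideal_mult B (ideal_mult A C)"
  by (metis ideal_mult_assoc ideal_mult_commute)

lemmas ideal_mult_ac = ideal_mult_assoc ideal_mult_commute ideal_mult_left_commute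

lemma ideal_mult_subgroup:
  assumes A: "add_subgroup A"
  shows "add_subgroup (ideal_mult A B)"
proof (rule add_subgroupI[OF ideal_mult_zero])
  fix x y assume x: "x \<in> ideal_mult A B" and "y \<in> ideal_mult A B"
  from this(2) have "- y \<in> ideal_mult A B"
  proof (induction rule: ideal_mult_induct)
    case (mult a b)
    then show ?case using ideal_mult_memI[OF add_subgroup_uminus[OF A], of a b B] by simp
  next
    case (add x y)
    then have "- x + - y \<in> ideal_mult A B" by (intro ideal_mult_add)
    then show ?case by simp
  qed (simp add: ideal_mult_zero)
  with x have "x + - y \<in> ideal_mult A B" by (rule ideal_mult_add)
  then show "x - y \<in> ideal_mult A B" by simp
qed

lemma ideal_mult_submodule:
  assumes A: "add_submodule R A"
  shows "add_submodule R (ideal_mult A B)"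
proof (rule add_submoduleI[OF ideal_mult_subgroup[OF add_submodule_subgroup[OF A]]])
  fix r x assume r: "r \<in> R" and "x \<in> ideal_mult A B"
  from this(2) show "r * x \<in> ideal_mult A B"
  proof (induction rule: ideal_mult_induct)
    case (mult a b)
    then show ?case
      using ideal_mult_memI[OF add_submodule_mult[OF A r], of a b B] by (simp add: mult.assoc)
  qed (simp_all add: distrib_left ideal_mult_zero ideal_mult_add)
qed

section \<open>Fractional and integral ideals\<close>

context number_field_set
begin

lemma frac_submodule:
  assumes A: "A \<in> frac_ideals F"
  shows "add_submodule \<O> A"
proof -
  have mult: "r * a \<in> A" if "r \<in> \<O>" "a \<in> A" for r a using A that by (simp add: frac_ideals_def)
  show ?thesis
  proof (intro add_submoduleI add_subgroupI mult)
    show "0 \<in> A" using A by (simp add: frac_ideals_def)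
    fix x y assume xy: "x \<in> A" "y \<in> A"
    have "\<forall>a\<in>A. \<forall>b\<in>A. a + b \<in> A" using A by (simp add: frac_ideals_def)
    moreover have "(-1) * y \<in> A" by (rule mult[OF ints_uminus[OF ints_one] xy(2)])
    ultimately have "x + (-1) * y \<in> A" using xy(1) by blast
    then show "x - y \<in> A" by simp
  qed
qed

lemmas frac_subgroup = add_submodule_subgroup[OF frac_submodule]
lemmas frac_mult = add_submodule_mult[OF frac_submodule]

lemma frac_subset: "A \<in> frac_ideals F \<Longrightarrow> A \<subseteq> F"
  by (auto simp: frac_ideals_def)

lemma frac_nonzero: "A \<in> frac_ideals F \<Longrightarrow> \<exists>a\<in>A. a \<noteq> 0"
  by (auto simp: frac_ideals_def)

lemma frac_denominator:
  assumes "A \<in> frac_ideals F"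
  obtains e where "e \<in> \<O>" "e \<noteq> 0" "\<forall>a\<in>A. e * a \<in> \<O>"
  using assms unfolding frac_ideals_def by blast

lemma frac_idealI:
  assumes "A \<subseteq> F" "add_submodule \<O> A" "a \<in> A" "a \<noteq> 0"
    and "e \<in> F" "e \<noteq> 0" "\<And>a. a \<in> A \<Longrightarrow> e * a \<in> \<O>"
  shows "A \<in> frac_ideals F"
proof -
  note subgroup_A = add_submodule_subgroup[OF assms(2)]
  obtain m :: nat where m: "m > 0" "of_nat m * e \<in> \<O>" by (rule ints_denominator[OF assms(5)])
  have "(of_nat m * e) * a \<in> \<O>" if "a \<in> A" for a
    using ints_mult[OF ints_of_nat assms(7)[OF that], of m] by (simp add: mult.assoc)
  then show ?thesis
    using assms m unfolding frac_ideals_def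
    by (auto simp: add_subgroup_zero[OF subgroup_A] add_subgroup_add[OF subgroup_A] add_submodule_mult
        intro!: bexI[of _ "of_nat m * e"])
qed

lemma integral_iff:
  "A \<in> integral_ideals F \<longleftrightarrow> A \<subseteq> \<O> \<and> add_submodule \<O> A \<and> A \<noteq> {0}"
proof
  assume "A \<in> integral_ideals F"
  then show "A \<subseteq> \<O> \<and> add_submodule \<O> A \<and> A \<noteq> {0}"
    using frac_submodule by (auto simp: integral_ideals_def frac_ideals_def)
next
  assume A: "A \<subseteq> \<O> \<and> add_submodule \<O> A \<and> A \<noteq> {0}"
  then obtain a where "a \<in> A" "a \<noteq> 0" using add_subgroup_zero[OF add_submodule_subgroup] by blast
  then have "A \<in> frac_ideals F"
    using A ints_subset by (intro frac_idealI[of A a 1]) (auto simp: one_mem)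
  with A show "A \<in> integral_ideals F" by (simp add: integral_ideals_def)
qed

lemma integral_frac: "A \<in> integral_ideals F \<Longrightarrow> A \<in> frac_ideals F"
  and integral_subset: "A \<in> integral_ideals F \<Longrightarrow> A \<subseteq> \<O>"
  by (simp_all add: integral_ideals_def)

lemmas integral_subgroup = frac_subgroup[OF integral_frac]
lemmas integral_mult = frac_mult[OF integral_frac]

lemma ints_integral: "\<O> \<in> integral_ideals F"
  using ints_one by (auto simp: integral_iff ints_submodule)

lemma integral_eq_ints: "A \<in> integral_ideals F \<Longrightarrow> 1 \<in> A \<Longrightarrow> A = \<O>"
  using integral_mult[of A _ 1] integral_subset[of A] by auto

lemma integral_contains_nat:
  assumes A: "A \<in> integral_ideals F"
  obtains m :: nat where "m > 0" "of_nat m \<in> A"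
proof -
  obtain a where a: "a \<in> A" "a \<noteq> 0" using frac_nonzero[OF integral_frac[OF A]] by blast
  then have "a \<in> F" using A frac_subset[OF integral_frac] by blast
  obtain m :: nat where m: "m > 0" "of_nat m * inverse a \<in> \<O>"
    by (rule ints_denominator[OF inverse_mem[OF \<open>a \<in> F\<close>]])
  have "(of_nat m * inverse a) * a \<in> A" by (rule integral_mult[OF A m(2) a(1)])
  then show ?thesis using a m that[of m] by (simp add: mult.assoc)
qed

lemma principal_frac:
  assumes "x \<in> F" "x \<noteq> 0"
  shows "principal F x \<in> frac_ideals F"
proof (rule frac_idealI[of _ x "inverse x"])
  show "principal F x \<subseteq> F" using assms(1) mult_mem ints_subset by (auto simp: principal_iff)
  show "x \<in> principal F x" using ints_one by (force simp: principal_iff)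
  show "inverse x * a \<in> \<O>" if "a \<in> principal F x" for a
    using that assms(2) by (auto simp: principal_iff mult.assoc[symmetric])
qed (use assms inverse_mem principal_submodule in auto)

lemma principal_integral: "x \<in> \<O> \<Longrightarrow> x \<noteq> 0 \<Longrightarrow> principal F x \<in> integral_ideals F"
  by (simp add: integral_ideals_def principal_frac ints_subset principal_subset_ints)

lemma principal_subset_iff: "A \<in> frac_ideals F \<Longrightarrow> principal F x \<subseteq> A \<longleftrightarrow> x \<in> A"
  using frac_mult[of A _ x] ints_one by (force simp: principal_iff mult.commute)

lemma ideal_mult_ints:
  assumes "A \<in> frac_ideals F"
  shows "ideal_mult A \<O> = A"
proof
  show "ideal_mult A \<O> \<subseteq> A"
    by (rule ideal_mult_least[OF frac_subgroup[OF assms]]) (metis frac_mult[OF assms] mult.commute)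
  show "A \<subseteq> ideal_mult A \<O>" using ideal_mult_memI[OF _ ints_one, of _ A] by auto
qed

lemma ideal_mult_ints_left: "A \<in> frac_ideals F \<Longrightarrow> ideal_mult \<O> A = A"
  using ideal_mult_ints ideal_mult_commute by metis

lemma ints_mult_ints: "ideal_mult \<O> \<O> = \<O>"
  by (rule ideal_mult_ints[OF integral_frac[OF ints_integral]])

lemma ideal_mult_subset: "A \<subseteq> F \<Longrightarrow> B \<subseteq> F \<Longrightarrow> ideal_mult A B \<subseteq> F"
  by (rule ideal_mult_least[OF add_subgroup]) (auto intro: mult_mem)

lemma ideal_mult_frac:
  assumes A: "A \<in> frac_ideals F" and B: "B \<in> frac_ideals F"
  shows "ideal_mult A B \<in> frac_ideals F"
proof -
  obtain a where a: "a \<in> A" "a \<noteq> 0" using frac_nonzero[OF A] by blast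
  obtain b where b: "b \<in> B" "b \<noteq> 0" using frac_nonzero[OF B] by blast
  obtain e where e: "e \<in> \<O>" "e \<noteq> 0" "\<forall>a\<in>A. e * a \<in> \<O>" by (rule frac_denominator[OF A])
  obtain f where f: "f \<in> \<O>" "f \<noteq> 0" "\<forall>b\<in>B. f * b \<in> \<O>" by (rule frac_denominator[OF B])
  have "(e * f) * x \<in> \<O>" if "x \<in> ideal_mult A B" for x
    using that
  proof (induction rule: ideal_mult_induct)
    case (mult a b)
    then have "(e * a) * (f * b) \<in> \<O>" using ints_mult[of "e * a" "f * b"] e(3) f(3) by blast
    then show ?case by (simp add: ac_simps)
  qed (simp_all add: ints_zero ints_add distrib_left)
  moreover have "ideal_mult A B \<subseteq> F" by (rule ideal_mult_subset[OF frac_subset[OF A] frac_subset[OF B]])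
  ultimately show ?thesis
    using a b e f by (intro frac_idealI[of _ "a * b" "e * f"] ideal_mult_submodule frac_submodule[OF A])
      (auto intro: ideal_mult_memI mult_mem ints_subset)
qed

lemma ideal_mult_integral:
  assumes "A \<in> integral_ideals F" "B \<in> integral_ideals F"
  shows "ideal_mult A B \<in> integral_ideals F"
proof -
  have "ideal_mult A B \<subseteq> \<O>"
    using assms by (intro ideal_mult_least ints_subgroup ints_mult) (auto dest: integral_subset)
  then show ?thesis using assms by (simp add: integral_ideals_def ideal_mult_frac)
qed

lemma ideal_mult_subset_left:
  assumes "A \<in> integral_ideals F" "B \<in> integral_ideals F"
  shows "ideal_mult A B \<subseteq> A"
  using ideal_mult_mono[of A A B \<O>] ideal_mult_ints[of A] assms
  by (simp add: integral_ideals_def)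

lemma principal_mult: "principal F (x * y) = ideal_mult (principal F x) (principal F y)"
proof
  show "principal F (x * y) \<subseteq> ideal_mult (principal F x) (principal F y)"
  proof
    fix z assume "z \<in> principal F (x * y)"
    then obtain r where "r \<in> \<O>" "z = (x * 1) * (y * r)" by (auto simp: principal_iff mult.assoc)
    then show "z \<in> ideal_mult (principal F x) (principal F y)"
      using ints_one by (auto simp: principal_iff simp del: mult_1_right intro!: ideal_mult_memI)
  qed
  show "ideal_mult (principal F x) (principal F y) \<subseteq> principal F (x * y)"
  proof (rule ideal_mult_least[OF principal_subgroup])
    fix a b assume "a \<in> principal F x" "b \<in> principal F y"
    then obtain r s where "r \<in> \<O>" "s \<in> \<O>" "a * b = (x * y) * (r * s)"
      by (auto simp: principal_iff ac_simps)
    then show "a * b \<in> principal F (x * y)" using ints_mult by (auto simp: principal_iff)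
  qed
qed

end

section \<open>The absolute norm of an ideal\<close>

context number_field_set
begin

definition abs_norm :: "'a set \<Rightarrow> nat" where "abs_norm A = add_index \<O> A"

lemma abs_norm_tower:
  assumes "A \<in> integral_ideals F" "B \<in> integral_ideals F" "A \<subseteq> B"
  shows "abs_norm A = abs_norm B * add_index B A"
  unfolding abs_norm_def
  using assms by (intro add_index_mult ints_subgroup integral_subgroup) (auto dest: integral_subset)

lemma abs_norm_pos:
  assumes A: "A \<in> integral_ideals F"
  shows "abs_norm A > 0"
proof -
  obtain m :: nat where m: "m > 0" "of_nat m \<in> A" by (rule integral_contains_nat[OF A])
  have "principal F (of_nat m) \<subseteq> A" using m(2) by (simp add: principal_subset_iff integral_frac[OF A])
  then have "abs_norm (principal F (of_nat m)) = abs_norm A * add_index A (principal F (of_nat m))"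
    using m(1) by (intro abs_norm_tower A principal_integral ints_of_nat) auto
  then show ?thesis using add_index_ints_principal_pos[OF m(1)] by (auto simp: abs_norm_def intro!: Nat.gr0I)
qed

lemma abs_norm_ints: "abs_norm \<O> = 1"
  by (simp add: abs_norm_def add_index_self ints_subgroup)

lemma abs_norm_eq_imp_eq:
  assumes "A \<in> integral_ideals F" "B \<in> integral_ideals F" "A \<subseteq> B" "abs_norm A = abs_norm B"
  shows "A = B"
proof -
  have "add_index B A = 1" using abs_norm_tower[OF assms(1-3)] assms(4) abs_norm_pos[OF assms(2)] by simp
  then show ?thesis
    using add_index_eq_1_imp_eq[of B A] assms(1-3) integral_subgroup by blast
qed

lemma abs_norm_less:
  assumes "A \<in> integral_ideals F" "B \<in> integral_ideals F" "A \<subset> B"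
  shows "abs_norm B < abs_norm A"
proof -
  have tower: "abs_norm A = abs_norm B * add_index B A" using assms by (intro abs_norm_tower) auto
  have "abs_norm A \<noteq> abs_norm B" using abs_norm_eq_imp_eq[OF assms(1,2)] assms(3) by auto
  moreover have "abs_norm B \<le> abs_norm A"
    using tower abs_norm_pos[OF assms(1)] by (cases "add_index B A") auto
  ultimately show ?thesis by simp
qed

end

section \<open>Prime ideals\<close>

context number_field_set
begin

lemma cring_ints: "cring (ring_on \<O>)"
proof (rule cringI)
  show "abelian_group (ring_on \<O>)"
  proof (rule abelian_groupI)
    fix x assume "x \<in> carrier (ring_on \<O>)"
    then show "\<exists>y\<in>carrier (ring_on \<O>). y \<oplus>\<^bsub>ring_on \<O>\<^esub> x = \<zero>\<^bsub>ring_on \<O>\<^esub>"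
      using ints_uminus by (auto intro!: bexI[of _ "-x"])
  qed (auto simp: ints_add ints_zero)
  show "Group.comm_monoid (ring_on \<O>)"
    by (rule comm_monoidI) (auto simp: ints_mult ints_one)
qed (auto simp: algebra_simps)

lemma ring_on_ints_uminus:
  assumes "x \<in> \<O>"
  shows "\<ominus>\<^bsub>ring_on \<O>\<^esub> x = - x"
proof -
  interpret cring "ring_on \<O>" by (rule cring_ints)
  show ?thesis using minus_equality[of "- x" x] assms ints_uminus by simp
qed

lemma ideal_ring_on_ints_iff: "ideal P (ring_on \<O>) \<longleftrightarrow> P \<subseteq> \<O> \<and> add_submodule \<O> P"
proof
  assume "ideal P (ring_on \<O>)"
  then interpret ideal P "ring_on \<O>" .
  have mult: "r * a \<in> P" if "r \<in> \<O>" "a \<in> P" for r a using I_l_closed[OF that(2), of r] that(1) by simp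
  have "a - b \<in> P" if "a \<in> P" "b \<in> P" for a b
    using additive_subgroup.a_closed[OF additive_subgroup_axioms that(1)
        mult[OF ints_uminus[OF ints_one] that(2)]] by simp
  moreover have "0 \<in> P" using additive_subgroup.zero_closed[OF additive_subgroup_axioms] by simp
  ultimately show "P \<subseteq> \<O> \<and> add_submodule \<O> P"
    using a_subset mult by (auto intro!: add_submoduleI add_subgroupI)
next
  assume P: "P \<subseteq> \<O> \<and> add_submodule \<O> P"
  then have subgroup_A: "add_subgroup P" by (blast intro: add_submodule_subgroup)
  interpret R: cring "ring_on \<O>" by (rule cring_ints)
  show "ideal P (ring_on \<O>)"
  proof (rule idealI[OF R.ring_axioms])
    show "subgroup P (add_monoid (ring_on \<O>))"
    proof (rule R.add.subgroupI)
      fix a assume "a \<in> P"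
      then show "\<ominus>\<^bsub>ring_on \<O>\<^esub> a \<in> P"
        using ring_on_ints_uminus[of a] P add_subgroup_uminus[OF subgroup_A, of a] by auto
    qed (use P add_subgroup_zero[OF subgroup_A] add_subgroup_add[OF subgroup_A] in auto)
  next
    fix a x assume "a \<in> P" "x \<in> carrier (ring_on \<O>)"
    then show "x \<otimes>\<^bsub>ring_on \<O>\<^esub> a \<in> P" "a \<otimes>\<^bsub>ring_on \<O>\<^esub> x \<in> P"
      using add_submodule_mult[of \<O> P x a] P by (simp_all add: mult.commute)
  qed
qed

lemma primes_iff:
  "P \<in> primes_of F \<longleftrightarrow> P \<in> integral_ideals F \<and> 1 \<notin> P \<and>
     (\<forall>x\<in>\<O>. \<forall>y\<in>\<O>. x * y \<in> P \<longrightarrow> x \<in> P \<or> y \<in> P)"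
proof
  assume "P \<in> primes_of F"
  then have P: "primeideal P (ring_on \<O>)" "P \<noteq> {0}" by (auto simp: primes_of_def)
  interpret primeideal P "ring_on \<O>" by (rule P(1))
  have "P \<in> integral_ideals F" using ideal_axioms P(2) by (simp add: ideal_ring_on_ints_iff integral_iff)
  moreover have "1 \<notin> P" using integral_eq_ints[OF calculation] I_notcarr by auto
  ultimately show "P \<in> integral_ideals F \<and> 1 \<notin> P \<and>
     (\<forall>x\<in>\<O>. \<forall>y\<in>\<O>. x * y \<in> P \<longrightarrow> x \<in> P \<or> y \<in> P)"
    using I_prime by auto
next
  assume P: "P \<in> integral_ideals F \<and> 1 \<notin> P \<and>
     (\<forall>x\<in>\<O>. \<forall>y\<in>\<O>. x * y \<in> P \<longrightarrow> x \<in> P \<or> y \<in> P)"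
  then have "ideal P (ring_on \<O>)" by (simp add: ideal_ring_on_ints_iff integral_iff)
  then have "primeideal P (ring_on \<O>)"
    using P ints_one by (intro primeidealI cring_ints) auto
  then show "P \<in> primes_of F" using P by (auto simp: primes_of_def integral_iff)
qed

lemma prime_integral: "P \<in> primes_of F \<Longrightarrow> P \<in> integral_ideals F"
  and prime_not_one: "P \<in> primes_of F \<Longrightarrow> 1 \<notin> P"
  and prime_mult: "P \<in> primes_of F \<Longrightarrow> x \<in> \<O> \<Longrightarrow> y \<in> \<O> \<Longrightarrow> x * y \<in> P \<Longrightarrow> x \<in> P \<or> y \<in> P"
  by (simp_all add: primes_iff)

lemmas prime_frac = integral_frac[OF prime_integral]
lemmas prime_subgroup = frac_subgroup[OF prime_frac]

lemma prime_prod: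
  assumes P: "P \<in> primes_of F" and "finite S" "\<And>i. i \<in> S \<Longrightarrow> f i \<in> \<O>" "prod f S \<in> P"
  shows "\<exists>i\<in>S. f i \<in> P"
  using assms(2-)
proof (induction S rule: finite_induct)
  case empty
  then show ?case using prime_not_one[OF P] by simp
next
  case (insert i S)
  have "prod f S \<in> \<O>" using insert.prems(1) by (intro ints_prod) auto
  moreover have "f i * prod f S \<in> P" using insert by simp
  ultimately have "f i \<in> P \<or> prod f S \<in> P" using prime_mult[OF P] insert.prems(1) by blast
  then show ?case using insert by blast
qed

text \<open>The powers of \<open>x\<close> cannot all be distinct modulo \<open>P\<close>.\<close>

lemma prime_inverse_mod:
  assumes P: "P \<in> primes_of F" and x: "x \<in> \<O>" "x \<notin> P"
  shows "\<exists>y\<in>\<O>. y * x - 1 \<in> P"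
proof -
  have "add_index \<O> P > 0" using abs_norm_pos[OF prime_integral[OF P]] by (simp add: abs_norm_def)
  then obtain i j where ij: "i < j" "x ^ j - x ^ i \<in> P"
    by (rule add_index_pigeonhole[OF prime_subgroup[OF P], of _ "\<lambda>j. x ^ j"]) (rule ints_power[OF x(1)])
  obtain k where k: "j = i + Suc k" using ij(1) less_iff_Suc_add by auto
  have pow: "x ^ n \<notin> P" for n
    by (induction n) (use prime_not_one[OF P] prime_mult[OF P x(1) ints_power[OF x(1)]] x(2) in auto)
  have "x ^ i * (x ^ Suc k - 1) \<in> P" using ij(2) by (simp add: k power_add algebra_simps)
  then have "x ^ Suc k - 1 \<in> P"
    using prime_mult[OF P ints_power[OF x(1)] ints_diff[OF ints_power[OF x(1)] ints_one]] pow by blast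
  then show ?thesis using ints_power[OF x(1), of k] by (intro bexI[of _ "x ^ k"]) (simp_all add: mult.commute)
qed

lemma prime_maximal:
  assumes P: "P \<in> primes_of F" and A: "A \<in> integral_ideals F" and sub: "P \<subseteq> A" and one: "1 \<notin> A"
  shows "A = P"
proof (rule ccontr)
  assume "A \<noteq> P"
  then obtain x where x: "x \<in> A" "x \<notin> P" using sub by blast
  moreover have "x \<in> \<O>" using integral_subset[OF A] x by blast
  ultimately obtain y where y: "y \<in> \<O>" "y * x - 1 \<in> P" using prime_inverse_mod[OF P] by blast
  have "y * x - (y * x - 1) \<in> A"
    by (rule add_subgroup_diff[OF integral_subgroup[OF A] integral_mult[OF A y(1) x(1)] subsetD[OF sub y(2)]])
  with one show False by simp
qed

definition adjoin :: "'a set \<Rightarrow> 'a \<Rightarrow> 'a set" where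
  "adjoin A x = {a + r * x | a r. a \<in> A \<and> r \<in> \<O>}"

lemma adjoinE:
  assumes "u \<in> adjoin A x"
  obtains a r where "u = a + r * x" "a \<in> A" "r \<in> \<O>"
  using assms by (auto simp: adjoin_def)

lemma adjoin_submodule:
  assumes A: "add_submodule \<O> A"
  shows "add_submodule \<O> (adjoin A x)"
proof (intro add_submoduleI add_subgroupI)
  note subgroup_A = add_submodule_subgroup[OF A]
  show "0 \<in> adjoin A x" unfolding adjoin_def
    using add_subgroup_zero[OF subgroup_A] ints_zero by (intro CollectI exI[of _ 0]) simp
  fix u assume "u \<in> adjoin A x"
  then obtain a r where u: "u = a + r * x" "a \<in> A" "r \<in> \<O>" by (rule adjoinE)
  show "s * u \<in> adjoin A x" if "s \<in> \<O>" for s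
    unfolding adjoin_def u(1) using u(2,3) that A
    by (intro CollectI exI[of _ "s * a"] exI[of _ "s * r"])
       (simp add: distrib_left mult.assoc add_submodule_mult ints_mult)
  fix v assume "v \<in> adjoin A x"
  then obtain b s where v: "v = b + s * x" "b \<in> A" "s \<in> \<O>" by (rule adjoinE)
  show "u - v \<in> adjoin A x" unfolding adjoin_def u(1) v(1) using u(2,3) v(2,3) subgroup_A
    by (intro CollectI exI[of _ "a - b"] exI[of _ "r - s"])
       (simp add: left_diff_distrib add_subgroup_diff ints_diff)
qed

lemma subset_adjoin: "A \<subseteq> adjoin A x"
proof
  fix a assume "a \<in> A"
  then show "a \<in> adjoin A x" unfolding adjoin_def
    using ints_zero by (intro CollectI exI[of _ a] exI[of _ 0]) auto
qed

lemma mem_adjoin: "0 \<in> A \<Longrightarrow> x \<in> adjoin A x"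
  unfolding adjoin_def using ints_one by (intro CollectI exI[of _ 0] exI[of _ 1]) auto

lemma adjoin_subset:
  assumes "add_submodule \<O> C" "A \<subseteq> C" "x \<in> C"
  shows "adjoin A x \<subseteq> C"
  using assms by (auto elim!: adjoinE intro!: add_subgroup_add add_submodule_subgroup add_submodule_mult)

lemma adjoin_integral:
  assumes A: "A \<in> integral_ideals F" and x: "x \<in> \<O>"
  shows "adjoin A x \<in> integral_ideals F"
proof -
  have "adjoin A x \<noteq> {0}"
    using frac_nonzero[OF integral_frac[OF A]] subset_adjoin[of A x] by blast
  then show ?thesis
    using adjoin_subset[OF ints_submodule integral_subset[OF A] x]
      adjoin_submodule[OF frac_submodule[OF integral_frac[OF A]]] by (simp add: integral_iff)
qed

lemma abs_norm_adjoin_less: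
  assumes A: "A \<in> integral_ideals F" and x: "x \<in> \<O>" "x \<notin> A"
  shows "abs_norm (adjoin A x) < abs_norm A"
proof (rule abs_norm_less[OF A adjoin_integral[OF A x(1)]])
  show "A \<subset> adjoin A x"
    using subset_adjoin[of A x] mem_adjoin[OF add_subgroup_zero[OF integral_subgroup[OF A]], of x] x(2) by blast
qed

text \<open>An ideal of least absolute norm among the proper ideals containing \<open>A\<close> is prime.\<close>

lemma ex_prime_above:
  assumes A: "A \<in> integral_ideals F" "1 \<notin> A"
  obtains P where "P \<in> primes_of F" "A \<subseteq> P"
proof -
  define S where "S = (\<lambda>B. B \<in> integral_ideals F \<and> 1 \<notin> B \<and> A \<subseteq> B)"
  define P where "P = arg_min abs_norm S"
  have "S A" using A by (simp add: S_def)
  then have "S P" and min: "\<And>B. S B \<Longrightarrow> abs_norm P \<le> abs_norm B"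
    unfolding P_def using arg_min_natI[of S A abs_norm] arg_min_nat_le[of S _ abs_norm] by auto
  then have P: "P \<in> integral_ideals F" "1 \<notin> P" "A \<subseteq> P" by (auto simp: S_def)
  have full: "1 \<in> adjoin P x" if x: "x \<in> \<O>" "x \<notin> P" for x
  proof -
    have "\<not> S (adjoin P x)" using abs_norm_adjoin_less[OF P(1) x] min by (metis leD)
    then show ?thesis using adjoin_integral[OF P(1) x(1)] subset_adjoin[of P x] P(3) by (auto simp: S_def)
  qed
  have "x \<in> P \<or> y \<in> P" if xy: "x \<in> \<O>" "y \<in> \<O>" "x * y \<in> P" for x y
  proof (rule ccontr)
    assume neg: "\<not> (x \<in> P \<or> y \<in> P)"
    then obtain a r where split_one: "1 = a + r * x" "a \<in> P" "r \<in> \<O>" using full[OF xy(1)] by (auto elim: adjoinE)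
    have "y = (a + r * x) * y" using split_one(1) by simp
    also have "\<dots> = y * a + r * (x * y)" by (simp add: algebra_simps)
    also have "\<dots> \<in> P" by (intro add_subgroup_add[OF integral_subgroup] integral_mult P split_one xy)
    finally show False using neg by blast
  qed
  then have "P \<in> primes_of F" using P by (simp add: primes_iff)
  then show ?thesis using P(3) by (rule that)
qed

lemma prime_ideal_mult:
  assumes P: "P \<in> primes_of F" and A: "A \<in> integral_ideals F" and B: "B \<in> integral_ideals F"
    and sub: "ideal_mult A B \<subseteq> P"
  shows "A \<subseteq> P \<or> B \<subseteq> P"
proof (rule ccontr)
  assume "\<not> (A \<subseteq> P \<or> B \<subseteq> P)"
  then obtain a b where "a \<in> A" "a \<notin> P" "b \<in> B" "b \<notin> P" by blast
  then show False
    using prime_mult[OF P, of a b] integral_subset[OF A] integral_subset[OF B] ideal_mult_memI[of a A b B] sub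
    by blast
qed

end

section \<open>Unique factorization of ideals\<close>

context number_field_set
begin

definition ideal_prod :: "'a set list \<Rightarrow> 'a set" where
  "ideal_prod Ps = foldr ideal_mult Ps \<O>"

lemma ideal_prod_simps [simp]: "ideal_prod [] = \<O>" "ideal_prod (P # Ps) = ideal_mult P (ideal_prod Ps)"
  by (simp_all add: ideal_prod_def)

lemma ideal_prod_integral: "set Ps \<subseteq> primes_of F \<Longrightarrow> ideal_prod Ps \<in> integral_ideals F"
  by (induction Ps) (auto simp: ints_integral ideal_mult_integral prime_integral)

lemma ideal_prod_append:
  "set Ps \<subseteq> primes_of F \<Longrightarrow> set Qs \<subseteq> primes_of F \<Longrightarrow>
    ideal_prod (Ps @ Qs) = ideal_mult (ideal_prod Ps) (ideal_prod Qs)"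
proof (induction Ps)
  case Nil
  then show ?case using ideal_mult_ints_left[OF integral_frac[OF ideal_prod_integral[of Qs]]] by simp
qed (simp add: ideal_mult_assoc)

lemma ideal_prod_remove1: "P \<in> set Ps \<Longrightarrow> ideal_prod Ps = ideal_mult P (ideal_prod (remove1 P Ps))"
  by (induction Ps) (auto simp: ideal_mult_left_commute)

lemma ideal_prod_subset_prime:
  assumes P: "P \<in> primes_of F"
  shows "set Ps \<subseteq> primes_of F \<Longrightarrow> ideal_prod Ps \<subseteq> P \<Longrightarrow> P \<in> set Ps"
proof (induction Ps)
  case Nil
  then show ?case using prime_not_one[OF P] ints_one by auto
next
  case (Cons Q Ps)
  then have "Q \<subseteq> P \<or> ideal_prod Ps \<subseteq> P"
    using prime_ideal_mult[OF P, of Q "ideal_prod Ps"] ideal_prod_integral[of Ps] by (auto simp: prime_integral)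
  moreover have "P = Q" if "Q \<subseteq> P"
    using prime_maximal[of Q P] Cons.prems that P by (auto simp: prime_integral prime_not_one)
  ultimately show ?case using Cons by auto
qed

lemma ideal_prod_subset_member:
  assumes "set Ps \<subseteq> primes_of F" "P \<in> set Ps"
  shows "ideal_prod Ps \<subseteq> P"
  unfolding ideal_prod_remove1[OF assms(2)] using assms set_remove1_subset[of P Ps]
  by (intro ideal_mult_subset_left prime_integral ideal_prod_integral) auto

lemma adjoin_mult_subset:
  assumes A: "A \<in> integral_ideals F" and xy: "x \<in> \<O>" "y \<in> \<O>" "x * y \<in> A"
  shows "ideal_mult (adjoin A x) (adjoin A y) \<subseteq> A"
proof (rule ideal_mult_least[OF integral_subgroup[OF A]])
  note add = add_subgroup_add[OF integral_subgroup[OF A]] and mult = integral_mult[OF A]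
  fix u v assume uv: "u \<in> adjoin A x" "v \<in> adjoin A y"
  obtain a r where a: "u = a + r * x" "a \<in> A" "r \<in> \<O>" using uv(1) by (rule adjoinE)
  obtain b s where b: "v = b + s * y" "b \<in> A" "s \<in> \<O>" using uv(2) by (rule adjoinE)
  have "v \<in> \<O>" using integral_subset[OF adjoin_integral[OF A xy(2)]] uv by blast
  have "u * v = v * a + ((r * x) * b + (r * s) * (x * y))" by (simp add: a b algebra_simps)
  also have "\<dots> \<in> A" by (intro add mult a b xy ints_mult \<open>v \<in> \<O>\<close>)
  finally show "u * v \<in> A" .
qed

lemma contains_ideal_prod:
  "A \<in> integral_ideals F \<Longrightarrow> \<exists>Ps. set Ps \<subseteq> primes_of F \<and> ideal_prod Ps \<subseteq> A"
proof (induction "abs_norm A" arbitrary: A rule: less_induct)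
  case less
  note A = less.prems
  consider (unit) "1 \<in> A" | (prime) "A \<in> primes_of F"
    | (composite) x y where "x \<in> \<O>" "y \<in> \<O>" "x * y \<in> A" "x \<notin> A" "y \<notin> A"
    using A by (auto simp: primes_iff)
  then show ?case
  proof cases
    case unit
    then show ?thesis using integral_eq_ints[OF A] by (intro exI[of _ "[]"]) auto
  next
    case prime
    then show ?thesis
      using ideal_mult_ints[OF integral_frac[OF A]] by (intro exI[of _ "[A]"]) auto
  next
    case (composite x y)
    obtain Ps where Ps: "set Ps \<subseteq> primes_of F" "ideal_prod Ps \<subseteq> adjoin A x"
      using less.hyps[OF abs_norm_adjoin_less adjoin_integral] A composite by blast
    obtain Qs where Qs: "set Qs \<subseteq> primes_of F" "ideal_prod Qs \<subseteq> adjoin A y"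
      using less.hyps[OF abs_norm_adjoin_less adjoin_integral] A composite by blast
    have "ideal_prod (Ps @ Qs) \<subseteq> A"
      using ideal_mult_mono[OF Ps(2) Qs(2)] ideal_prod_append[OF Ps(1) Qs(1)] adjoin_mult_subset[OF A composite(1-3)]
      by blast
    then show ?thesis using Ps(1) Qs(1) by (intro exI[of _ "Ps @ Qs"]) auto
  qed
qed

lemma shortest_contained_ideal_prod:
  assumes "A \<in> integral_ideals F"
  obtains Ps where "set Ps \<subseteq> primes_of F" "ideal_prod Ps \<subseteq> A"
    "\<forall>Qs. set Qs \<subseteq> primes_of F \<and> ideal_prod Qs \<subseteq> A \<longrightarrow> length Ps \<le> length Qs"
proof -
  define S where "S = (\<lambda>Ps. set Ps \<subseteq> primes_of F \<and> ideal_prod Ps \<subseteq> A)"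
  obtain Qs where "S Qs" using contains_ideal_prod[OF assms] by (auto simp: S_def)
  then have "S (arg_min length S)" "\<forall>Qs. S Qs \<longrightarrow> length (arg_min length S) \<le> length Qs"
    using arg_min_natI[of S Qs length] arg_min_nat_le[of S _ length] by auto
  then show ?thesis using that[of "arg_min length S"] unfolding S_def by blast
qed

lemma stable_imp_integral:
  assumes A: "A \<in> integral_ideals F" and x: "x \<in> F" "\<And>a. a \<in> A \<Longrightarrow> x * a \<in> A"
  shows "x \<in> \<O>"
proof -
  obtain m :: nat where m: "m > 0" "of_nat m \<in> A" by (rule integral_contains_nat[OF A])
  have "of_nat m * x ^ j \<in> A" for j
    by (induction j) (use m x(2) in \<open>auto simp: mult.left_commute\<close>)
  then show ?thesis using almost_integral_imp_integral[OF x(1) m(1)] integral_subset[OF A] by blast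
qed

definition dual :: "'a set \<Rightarrow> 'a set" where
  "dual A = {x \<in> F. \<forall>a\<in>A. x * a \<in> \<O>}"

lemma one_mem_dual: "A \<subseteq> \<O> \<Longrightarrow> 1 \<in> dual A"
  by (auto simp: dual_def one_mem)

lemma dual_frac:
  assumes A: "A \<in> integral_ideals F"
  shows "dual A \<in> frac_ideals F"
proof -
  obtain a where a: "a \<in> A" "a \<noteq> 0" using frac_nonzero[OF integral_frac[OF A]] by blast
  show ?thesis
  proof (rule frac_idealI[of _ 1 a])
    show "add_submodule \<O> (dual A)"
      using zero_mem ints_zero
      by (intro add_submoduleI add_subgroupI)
         (auto simp: dual_def diff_mem ints_diff mult_mem ints_mult ints_subset left_diff_distrib mult.assoc)
    show "a * x \<in> \<O>" if "x \<in> dual A" for x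
      using that a(1) by (auto simp: dual_def mult.commute[of a])
    show "a \<in> F" using a frac_subset[OF integral_frac[OF A]] by blast
  qed (use a one_mem_dual[OF integral_subset[OF A]] in \<open>auto simp: dual_def\<close>)
qed

lemma ideal_mult_dual_subset: "ideal_mult A (dual A) \<subseteq> \<O>"
  by (rule ideal_mult_least[OF ints_subgroup]) (auto simp: dual_def mult.commute)

text \<open>
  If \<open>P\<close> is one of the factors of a shortest product of primes inside \<open>(a)\<close>, where \<open>a \<in> P\<close>, then the
  other factors have a product that is not inside \<open>(a)\<close>.
\<close>

lemma prime_dual_not_integral:
  assumes P: "P \<in> primes_of F"
  shows "\<not> dual P \<subseteq> \<O>"
proof -
  obtain a where a: "a \<in> P" "a \<noteq> 0" using frac_nonzero[OF prime_frac[OF P]] by blast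
  have aO: "a \<in> \<O>" using integral_subset[OF prime_integral[OF P]] a by blast
  obtain Ps where Ps: "set Ps \<subseteq> primes_of F" "ideal_prod Ps \<subseteq> principal F a"
    "\<forall>Qs. set Qs \<subseteq> primes_of F \<and> ideal_prod Qs \<subseteq> principal F a \<longrightarrow> length Ps \<le> length Qs"
    by (rule shortest_contained_ideal_prod[OF principal_integral[OF aO a(2)]])
  have "principal F a \<subseteq> P" using a(1) by (simp add: principal_subset_iff prime_frac[OF P])
  then have P_Ps: "P \<in> set Ps" using ideal_prod_subset_prime[OF P Ps(1)] Ps(2) by blast
  define Rs where "Rs = remove1 P Ps"
  have Rs: "set Rs \<subseteq> primes_of F" using Ps(1) set_remove1_subset[of P Ps] by (auto simp: Rs_def)
  have "length Rs < length Ps" using length_pos_if_in_set[OF P_Ps] P_Ps by (simp add: Rs_def length_remove1)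
  then have "\<not> ideal_prod Rs \<subseteq> principal F a" using Ps(3) Rs by (meson not_less)
  then obtain b where b: "b \<in> ideal_prod Rs" "b \<notin> principal F a" by blast
  have bO: "b \<in> \<O>" using integral_subset[OF ideal_prod_integral[OF Rs]] b by blast
  have "b / a * p \<in> \<O>" if "p \<in> P" for p
  proof -
    have "p * b \<in> ideal_prod Ps"
      unfolding ideal_prod_remove1[OF P_Ps] Rs_def[symmetric] by (rule ideal_mult_memI[OF that b(1)])
    then have "p * b \<in> principal F a" using Ps(2) by blast
    then obtain r where "r \<in> \<O>" "p * b = a * r" by (auto simp: principal_iff)
    then show ?thesis using a(2) by (simp add: field_simps)
  qed
  then have "b / a \<in> dual P" using divide_mem[OF ints_subset[OF bO] ints_subset[OF aO]] by (simp add: dual_def)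
  moreover have "b / a \<notin> \<O>"
  proof
    assume "b / a \<in> \<O>"
    then have "b \<in> principal F a" using a(2) by (auto simp: principal_iff intro!: bexI[of _ "b / a"])
    with b show False by simp
  qed
  ultimately show ?thesis by blast
qed

lemma ideal_mult_prime_dual_not_subset:
  assumes A: "A \<in> integral_ideals F" and P: "P \<in> primes_of F"
  shows "\<not> ideal_mult A (dual P) \<subseteq> A"
proof
  assume sub: "ideal_mult A (dual P) \<subseteq> A"
  have "dual P \<subseteq> \<O>"
  proof
    fix x assume x: "x \<in> dual P"
    have "x * a \<in> A" if "a \<in> A" for a
      using ideal_mult_memI[OF that x] sub by (auto simp: mult.commute)
    then show "x \<in> \<O>" using x by (intro stable_imp_integral[OF A]) (auto simp: dual_def)
  qed
  with prime_dual_not_integral[OF P] show False by blast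
qed

lemma prime_mult_dual:
  assumes P: "P \<in> primes_of F"
  shows "ideal_mult P (dual P) = \<O>"
proof (rule ccontr)
  let ?M = "ideal_mult P (dual P)"
  note P_integral = prime_integral[OF P]
  assume not_ints: "?M \<noteq> \<O>"
  have M: "?M \<in> integral_ideals F"
    using ideal_mult_dual_subset ideal_mult_frac[OF prime_frac[OF P] dual_frac[OF P_integral]]
    by (simp add: integral_ideals_def)
  have "P \<subseteq> ?M" using ideal_mult_memI[OF _ one_mem_dual[OF integral_subset[OF P_integral]], of _ P] by auto
  moreover have "1 \<notin> ?M" using integral_eq_ints[OF M] not_ints by blast
  ultimately have "?M = P" by (rule prime_maximal[OF P M])
  then show False using ideal_mult_prime_dual_not_subset[OF P_integral P] by simp
qed

lemma factorization:
  "A \<in> integral_ideals F \<Longrightarrow> \<exists>Ps. set Ps \<subseteq> primes_of F \<and> A = ideal_prod Ps"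
proof (induction "abs_norm A" arbitrary: A rule: less_induct)
  case less
  note A = less.prems and A_frac = integral_frac[OF less.prems]
  show ?case
  proof (cases "1 \<in> A")
    case True
    then show ?thesis using integral_eq_ints[OF A] by (intro exI[of _ "[]"]) auto
  next
    case False
    then obtain P where P: "P \<in> primes_of F" "A \<subseteq> P" by (rule ex_prime_above[OF A])
    note P_integral = prime_integral[OF P(1)]
    define B where "B = ideal_mult A (dual P)"
    have "B \<subseteq> \<O>"
      unfolding B_def using ideal_mult_mono[OF P(2) order_refl] prime_mult_dual[OF P(1)] by metis
    then have B: "B \<in> integral_ideals F"
      unfolding B_def using ideal_mult_frac[OF A_frac dual_frac[OF P_integral]] by (simp add: integral_ideals_def)
    have "A \<subseteq> B"
      using ideal_mult_memI[OF _ one_mem_dual[OF integral_subset[OF P_integral]], of _ A] by (auto simp: B_def)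
    then have "A \<subset> B" using ideal_mult_prime_dual_not_subset[OF A P(1)] by (auto simp: B_def)
    then have "abs_norm B < abs_norm A" by (rule abs_norm_less[OF A B])
    then obtain Ps where Ps: "set Ps \<subseteq> primes_of F" "B = ideal_prod Ps" using less.hyps B by blast
    have "A = ideal_mult A (ideal_mult P (dual P))"
      by (simp add: prime_mult_dual[OF P(1)] ideal_mult_ints[OF A_frac])
    also have "\<dots> = ideal_mult P B" by (simp add: B_def ideal_mult_left_commute)
    finally show ?thesis using Ps P(1) by (intro exI[of _ "P # Ps"]) simp
  qed
qed

lemma ideal_prod_inverse:
  "set Ps \<subseteq> primes_of F \<Longrightarrow> \<exists>C\<in>frac_ideals F. ideal_mult C (ideal_prod Ps) = \<O>"
proof (induction Ps)
  case Nil
  then show ?case using ints_integral integral_frac ints_mult_ints by (intro bexI[of _ \<O>]) auto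
next
  case (Cons P Ps)
  then obtain C where C: "C \<in> frac_ideals F" "ideal_mult C (ideal_prod Ps) = \<O>" by auto
  have P: "P \<in> primes_of F" using Cons.prems by simp
  have "ideal_mult (ideal_mult C (dual P)) (ideal_prod (P # Ps)) =
      ideal_mult (ideal_mult P (dual P)) (ideal_mult C (ideal_prod Ps))"
    by (simp add: ideal_mult_ac)
  also have "\<dots> = \<O>" using C prime_mult_dual[OF P] ints_mult_ints by simp
  finally show ?case
    using ideal_mult_frac[OF C(1) dual_frac[OF prime_integral[OF P]]] by blast
qed

lemma frac_integral_multiple:
  assumes A: "A \<in> frac_ideals F"
  obtains e where "e \<in> \<O>" "e \<noteq> 0" "ideal_mult (principal F e) A \<in> integral_ideals F"
proof -
  obtain e where e: "e \<in> \<O>" "e \<noteq> 0" "\<forall>a\<in>A. e * a \<in> \<O>" by (rule frac_denominator[OF A])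
  have "ideal_mult (principal F e) A \<subseteq> \<O>"
  proof (rule ideal_mult_least[OF ints_subgroup])
    fix x a assume xa: "x \<in> principal F e" "a \<in> A"
    then obtain r where r: "r \<in> \<O>" "x = e * r" by (auto simp: principal_iff)
    have "r * (e * a) \<in> \<O>" using ints_mult[OF r(1)] e(3) xa(2) by blast
    then show "x * a \<in> \<O>" by (simp add: r(2) ac_simps)
  qed
  then show ?thesis
    using that[OF e(1,2)] ideal_mult_frac[OF principal_frac[OF ints_subset[OF e(1)] e(2)] A]
    by (simp add: integral_ideals_def)
qed

lemma frac_group_simps [simp]:
  "carrier (frac_group F) = frac_ideals F" "A \<otimes>\<^bsub>frac_group F\<^esub> B = ideal_mult A B"
  "\<one>\<^bsub>frac_group F\<^esub> = \<O>"
  by (simp_all add: frac_group_def)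

lemma comm_group_frac: "comm_group (frac_group F)"
proof (rule comm_groupI)
  fix A assume "A \<in> carrier (frac_group F)"
  then have A: "A \<in> frac_ideals F" by simp
  obtain e where e: "e \<in> \<O>" "e \<noteq> 0" "ideal_mult (principal F e) A \<in> integral_ideals F"
    by (rule frac_integral_multiple[OF A])
  obtain Ps where "set Ps \<subseteq> primes_of F" "ideal_mult (principal F e) A = ideal_prod Ps"
    using factorization[OF e(3)] by blast
  then obtain C where C: "C \<in> frac_ideals F" "ideal_mult C (ideal_mult (principal F e) A) = \<O>"
    using ideal_prod_inverse by metis
  show "\<exists>B\<in>carrier (frac_group F). B \<otimes>\<^bsub>frac_group F\<^esub> A = \<one>\<^bsub>frac_group F\<^esub>"
    using ideal_mult_frac[OF C(1) principal_frac[OF ints_subset[OF e(1)] e(2)]] C(2)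
    by (intro bexI[of _ "ideal_mult C (principal F e)"]) (auto simp: ideal_mult_assoc)
  show "A \<otimes>\<^bsub>frac_group F\<^esub> B = B \<otimes>\<^bsub>frac_group F\<^esub> A" for B
    by (simp only: frac_group_simps ideal_mult_commute)
qed (simp_all add: ideal_mult_frac ideal_mult_assoc ideal_mult_ints_left integral_frac[OF ints_integral])

lemma frac_inv_closed: "A \<in> frac_ideals F \<Longrightarrow> inv\<^bsub>frac_group F\<^esub> A \<in> frac_ideals F"
  using Group.group.inv_closed[OF comm_group.axioms(2)[OF comm_group_frac], of A] by simp

lemma frac_inv: "A \<in> frac_ideals F \<Longrightarrow> ideal_mult A (inv\<^bsub>frac_group F\<^esub> A) = \<O>"
  using Group.group.r_inv[OF comm_group.axioms(2)[OF comm_group_frac], of A] by simp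

lemma principal_inverse:
  assumes "x \<in> F" "x \<noteq> 0"
  shows "inv\<^bsub>frac_group F\<^esub> (principal F x) = principal F (inverse x)"
proof -
  have "ideal_mult (principal F (inverse x)) (principal F x) = \<O>"
    using principal_mult[of "inverse x" x] assms(2) by (simp add: principal_one)
  then show ?thesis
    using Group.group.inv_equality[OF comm_group.axioms(2)[OF comm_group_frac],
        of "principal F (inverse x)" "principal F x"]
      principal_frac[OF assms] principal_frac[OF inverse_mem[OF assms(1)]] assms(2) by simp
qed

end

section \<open>Finitely supported products of integer powers\<close>

definition pow_prod :: "('g, 'm) monoid_scheme \<Rightarrow> ('b \<Rightarrow> 'g) \<Rightarrow> ('b \<Rightarrow> int) \<Rightarrow> 'g" where
  "pow_prod G u e = finprod G (\<lambda>P. u P [^]\<^bsub>G\<^esub> e P) {P. e P \<noteq> 0}"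

context comm_group
begin

lemma pow_prod_superset:
  assumes "finite S" "{P. e P \<noteq> 0} \<subseteq> S" "\<And>P. P \<in> S \<Longrightarrow> u P \<in> carrier G"
  shows "pow_prod G u e = finprod G (\<lambda>P. u P [^] e P) S"
  unfolding pow_prod_def using assms
  by (intro finprod_mono_neutral_cong_left) (auto intro: int_pow_closed)

lemma pow_prod_closed:
  assumes "\<And>P. e P \<noteq> 0 \<Longrightarrow> u P \<in> carrier G"
  shows "pow_prod G u e \<in> carrier G"
  unfolding pow_prod_def using assms by (intro finprod_closed) auto

lemma pow_prod_zero: "pow_prod G u (\<lambda>_. 0) = \<one>"
  by (simp add: pow_prod_def)

lemma pow_prod_add:
  assumes "finite {P. e P \<noteq> 0}" "finite {P. f P \<noteq> 0}"
    and "\<And>P. e P \<noteq> 0 \<or> f P \<noteq> 0 \<Longrightarrow> u P \<in> carrier G"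
  shows "pow_prod G u (\<lambda>P. e P + f P) = pow_prod G u e \<otimes> pow_prod G u f"
proof -
  let ?S = "{P. e P \<noteq> 0} \<union> {P. f P \<noteq> 0}"
  have u: "u P \<in> carrier G" if "P \<in> ?S" for P using assms(3) that by auto
  have S: "finite ?S" using assms by simp
  have "pow_prod G u (\<lambda>P. e P + f P) = finprod G (\<lambda>P. u P [^] (e P + f P)) ?S"
    using S u by (intro pow_prod_superset) auto
  also have "\<dots> = finprod G (\<lambda>P. u P [^] e P \<otimes> u P [^] f P) ?S"
    using u by (intro finprod_cong') (auto simp: int_pow_mult)
  also have "\<dots> = finprod G (\<lambda>P. u P [^] e P) ?S \<otimes> finprod G (\<lambda>P. u P [^] f P) ?S"
    using u by (intro finprod_multf) auto
  also have "finprod G (\<lambda>P. u P [^] e P) ?S = pow_prod G u e"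
    using S u by (intro pow_prod_superset[symmetric]) auto
  also have "finprod G (\<lambda>P. u P [^] f P) ?S = pow_prod G u f"
    using S u by (intro pow_prod_superset[symmetric]) auto
  finally show ?thesis .
qed

lemma pow_prod_uminus:
  assumes "finite {P. e P \<noteq> 0}" "\<And>P. e P \<noteq> 0 \<Longrightarrow> u P \<in> carrier G"
  shows "pow_prod G u (\<lambda>P. - e P) = inv (pow_prod G u e)"
proof -
  have "pow_prod G u (\<lambda>P. - e P) \<otimes> pow_prod G u e = pow_prod G u (\<lambda>P. - e P + e P)"
    using assms by (intro pow_prod_add[symmetric]) auto
  also have "\<dots> = \<one>" by (simp add: pow_prod_zero)
  finally show ?thesis
    using assms by (intro inv_equality[symmetric] pow_prod_closed) auto
qed

lemma pow_prod_single:
  assumes "u P \<in> carrier G"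
  shows "pow_prod G u (\<lambda>Q. if Q = P then n else 0) = u P [^] n"
proof -
  have "pow_prod G u (\<lambda>Q. if Q = P then n else 0) =
      finprod G (\<lambda>Q. u Q [^] (if Q = P then n else 0)) {P}"
    using assms by (intro pow_prod_superset) (auto split: if_splits)
  then show ?thesis using assms by simp
qed

lemma pow_prod_cong:
  assumes "\<And>P. e P \<noteq> 0 \<Longrightarrow> u P = w P" "\<And>P. e P \<noteq> 0 \<Longrightarrow> w P \<in> carrier G"
  shows "pow_prod G u e = pow_prod G w e"
  unfolding pow_prod_def using assms by (intro finprod_cong') auto

lemma hom_finprod:
  assumes H: "comm_group H" and h: "h \<in> hom G H" and fin: "finite S"
    and u: "\<And>P. P \<in> S \<Longrightarrow> u P \<in> carrier G"
  shows "h (finprod G u S) = finprod H (\<lambda>P. h (u P)) S"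
proof -
  interpret H: comm_group H by (rule H)
  have h_closed: "h x \<in> carrier H" if "x \<in> carrier G" for x using h that by (auto simp: hom_def)
  from fin u show ?thesis
  proof (induction S rule: finite_induct)
    case empty
    then show ?case using hom_one[OF h group_axioms H.is_group] by simp
  next
    case (insert P S)
    have "h (finprod G u (insert P S)) = h (u P \<otimes> finprod G u S)"
      using insert by (subst finprod_insert) auto
    also have "\<dots> = h (u P) \<otimes>\<^bsub>H\<^esub> h (finprod G u S)"
      using insert.prems by (intro hom_mult[OF h]) auto
    also have "\<dots> = finprod H (\<lambda>P. h (u P)) (insert P S)"
      using insert h_closed by (subst H.finprod_insert) auto
    finally show ?case .
  qed
qed

lemma hom_pow_prod:
  assumes H: "comm_group H" and h: "h \<in> hom G H" and fin: "finite {P. e P \<noteq> 0}"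
    and u: "\<And>P. e P \<noteq> 0 \<Longrightarrow> u P \<in> carrier G"
  shows "h (pow_prod G u e) = pow_prod H (\<lambda>P. h (u P)) e"
proof -
  interpret H: comm_group H by (rule H)
  have h_closed: "h x \<in> carrier H" if "x \<in> carrier G" for x using h that by (auto simp: hom_def)
  have "h (pow_prod G u e) = finprod H (\<lambda>P. h (u P [^] e P)) {P. e P \<noteq> 0}"
    unfolding pow_prod_def using u by (intro hom_finprod[OF H h fin]) auto
  also have "\<dots> = pow_prod H (\<lambda>P. h (u P)) e"
    unfolding pow_prod_def using u h_closed
    by (intro H.finprod_cong') (auto simp: hom_int_pow[OF h _ group_axioms H.is_group])
  finally show ?thesis .
qed

end

section \<open>Divisors and valuations\<close>

context number_field_set
begin

interpretation I: comm_group "frac_group F" by (rule comm_group_frac)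

definition divisor :: "('a set \<Rightarrow> int) \<Rightarrow> bool" where
  "divisor e \<longleftrightarrow> finite {P. e P \<noteq> 0} \<and> {P. e P \<noteq> 0} \<subseteq> primes_of F"

lemma divisor_prime: "divisor e \<Longrightarrow> e P \<noteq> 0 \<Longrightarrow> P \<in> primes_of F"
  and divisor_finite: "divisor e \<Longrightarrow> finite {P. e P \<noteq> 0}"
  by (auto simp: divisor_def)

lemma divisor_subset_Un:
  assumes "divisor e" "divisor f" "\<And>P. g P \<noteq> 0 \<Longrightarrow> e P \<noteq> 0 \<or> f P \<noteq> 0"
  shows "divisor g"
proof -
  have sub: "{P. g P \<noteq> 0} \<subseteq> {P. e P \<noteq> 0} \<union> {P. f P \<noteq> 0}" using assms(3) by auto
  then show ?thesis using assms(1,2) finite_subset[OF sub] unfolding divisor_def by auto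
qed

lemma divisor_add: "divisor e \<Longrightarrow> divisor f \<Longrightarrow> divisor (\<lambda>P. e P + f P)"
  by (rule divisor_subset_Un[of e f]) auto

lemma divisor_uminus: "divisor e \<Longrightarrow> divisor (\<lambda>P. - e P)"
  by (simp add: divisor_def)

lemma divisor_zero: "divisor (\<lambda>_. 0)"
  by (simp add: divisor_def)

lemma divisor_single: "P \<in> primes_of F \<Longrightarrow> divisor (\<lambda>Q. if Q = P then n else 0)"
  by (auto simp: divisor_def)

abbreviation ideal_of :: "('a set \<Rightarrow> int) \<Rightarrow> 'a set" where
  "ideal_of e \<equiv> pow_prod (frac_group F) (\<lambda>P. P) e"

lemma ideal_of_frac: "divisor e \<Longrightarrow> ideal_of e \<in> frac_ideals F"
  using I.pow_prod_closed[of e "\<lambda>P. P"] divisor_prime[of e] prime_frac by auto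

lemma ideal_of_zero: "ideal_of (\<lambda>_. 0) = \<O>"
  using I.pow_prod_zero by simp

lemma ideal_of_single: "P \<in> primes_of F \<Longrightarrow> ideal_of (\<lambda>Q. if Q = P then 1 else 0) = P"
  using I.pow_prod_single[of "\<lambda>P. P" P 1] prime_frac[of P] by simp

lemma ideal_of_add:
  assumes "divisor e" "divisor f"
  shows "ideal_of (\<lambda>P. e P + f P) = ideal_mult (ideal_of e) (ideal_of f)"
proof -
  have "P \<in> carrier (frac_group F)" if "e P \<noteq> 0 \<or> f P \<noteq> 0" for P
    using that divisor_prime[OF assms(1)] divisor_prime[OF assms(2)] prime_frac by auto
  then show ?thesis using I.pow_prod_add[of e f "\<lambda>P. P"] assms by (simp add: divisor_finite)
qed

lemma ideal_of_uminus:
  assumes "divisor e"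
  shows "ideal_of (\<lambda>P. - e P) = inv\<^bsub>frac_group F\<^esub> (ideal_of e)"
  using I.pow_prod_uminus[of e "\<lambda>P. P"] divisor_prime[OF assms] assms by (simp add: divisor_finite prime_frac)

lemma ideal_prod_replicate: "ideal_prod (replicate n P) = P [^]\<^bsub>frac_group F\<^esub> n"
  by (induction n) (simp_all add: ideal_mult_commute)

lemma ideal_of_nonneg_eq_ideal_prod:
  assumes e: "divisor e" "\<And>P. e P \<ge> 0"
  obtains Ps where "set Ps = {P. e P \<noteq> 0}" "ideal_of e = ideal_prod Ps"
proof -
  have "\<exists>Ps. set Ps = S \<and> finprod (frac_group F) (\<lambda>P. P [^]\<^bsub>frac_group F\<^esub> e P) S = ideal_prod Ps"
    if "finite S" "S \<subseteq> {P. e P \<noteq> 0}" for S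
    using that
  proof (induction S rule: finite_induct)
    case empty
    then show ?case by (intro exI[of _ "[]"]) simp
  next
    case (insert P S)
    then obtain Ps where Ps: "set Ps = S" "finprod (frac_group F) (\<lambda>P. P [^]\<^bsub>frac_group F\<^esub> e P) S = ideal_prod Ps"
      by auto
    have pr: "insert P S \<subseteq> primes_of F" using insert.prems e(1) by (auto simp: divisor_def)
    have cl: "Q [^]\<^bsub>frac_group F\<^esub> e Q \<in> frac_ideals F" if "Q \<in> insert P S" for Q
      using I.int_pow_closed[of Q "e Q"] pr prime_frac that by auto
    have eP: "e P = int (nat (e P))" "nat (e P) > 0" using e(2)[of P] insert.prems by auto
    have "finprod (frac_group F) (\<lambda>P. P [^]\<^bsub>frac_group F\<^esub> e P) (insert P S) =
        ideal_mult (P [^]\<^bsub>frac_group F\<^esub> e P) (ideal_prod Ps)"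
      using insert cl Ps(2) by (subst I.finprod_insert) auto
    also have "P [^]\<^bsub>frac_group F\<^esub> e P = ideal_prod (replicate (nat (e P)) P)"
      unfolding ideal_prod_replicate by (metis eP(1) int_pow_int)
    also have "ideal_mult (ideal_prod (replicate (nat (e P)) P)) (ideal_prod Ps) =
        ideal_prod (replicate (nat (e P)) P @ Ps)"
      using pr Ps(1) by (intro ideal_prod_append[symmetric]) auto
    finally show ?case using eP(2) Ps(1) by (intro exI[of _ "replicate (nat (e P)) P @ Ps"]) auto
  qed
  from this[OF divisor_finite[OF e(1)] order_refl] that show ?thesis by (auto simp: pow_prod_def)
qed

lemma ideal_prod_eq_imp_set_eq:
  assumes "set Ps \<subseteq> primes_of F" "set Qs \<subseteq> primes_of F" "ideal_prod Ps = ideal_prod Qs"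
  shows "set Ps = set Qs"
proof -
  have "set Xs \<subseteq> set Ys"
    if "set Xs \<subseteq> primes_of F" "set Ys \<subseteq> primes_of F" "ideal_prod Xs = ideal_prod Ys" for Xs Ys
    using ideal_prod_subset_member[OF that(1)] ideal_prod_subset_prime[OF _ that(2)] that(1,3) by auto
  then show ?thesis using assms by blast
qed

lemma ideal_of_eq_ints_imp_zero:
  assumes e: "divisor e" "ideal_of e = \<O>"
  shows "e P = 0"
proof -
  define p where "p = (\<lambda>P. max (e P) 0)"
  define n where "n = (\<lambda>P. max (- e P) 0)"
  have p: "divisor p" by (rule divisor_subset_Un[OF e(1) e(1)]) (auto simp: p_def max_def split: if_splits)
  have n: "divisor n" by (rule divisor_subset_Un[OF e(1) e(1)]) (auto simp: n_def max_def split: if_splits)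
  have pos: "p P \<ge> 0" "n P \<ge> 0" for P by (simp_all add: p_def n_def)
  have "p = (\<lambda>P. e P + n P)" by (auto simp: p_def n_def)
  then have eq: "ideal_of p = ideal_of n"
    using ideal_of_add[OF e(1) n] e(2) ideal_mult_ints_left[OF ideal_of_frac[OF n]] by simp
  obtain Ps where Ps: "set Ps = {P. p P \<noteq> 0}" "ideal_of p = ideal_prod Ps"
    by (rule ideal_of_nonneg_eq_ideal_prod[OF p pos(1)])
  obtain Qs where Qs: "set Qs = {P. n P \<noteq> 0}" "ideal_of n = ideal_prod Qs"
    by (rule ideal_of_nonneg_eq_ideal_prod[OF n pos(2)])
  have "set Ps = set Qs"
    using ideal_prod_eq_imp_set_eq[of Ps Qs] p n Ps Qs eq by (simp add: divisor_def)
  then have "p P \<noteq> 0 \<longleftrightarrow> n P \<noteq> 0" using Ps(1) Qs(1) by auto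
  then show ?thesis by (auto simp: p_def n_def max_def split: if_splits)
qed

lemma ideal_of_inject:
  assumes "divisor e" "divisor f" "ideal_of e = ideal_of f"
  shows "e = f"
proof
  fix P
  have "ideal_of (\<lambda>P. e P + - f P) = ideal_mult (ideal_of f) (inv\<^bsub>frac_group F\<^esub> (ideal_of f))"
    using ideal_of_add[OF assms(1) divisor_uminus[OF assms(2)]] ideal_of_uminus[OF assms(2)] assms(3) by simp
  also have "\<dots> = \<O>" by (rule frac_inv[OF ideal_of_frac[OF assms(2)]])
  finally show "e P = f P"
    using ideal_of_eq_ints_imp_zero[OF divisor_add[OF assms(1) divisor_uminus[OF assms(2)]], of P] by simp
qed

lemma ideal_prod_eq_ideal_of:
  "set Ps \<subseteq> primes_of F \<Longrightarrow> \<exists>e. divisor e \<and> (\<forall>P. e P \<ge> 0) \<and> ideal_of e = ideal_prod Ps"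
proof (induction Ps)
  case Nil
  then show ?case using ideal_of_zero divisor_zero by (intro exI[of _ "\<lambda>_. 0"]) simp
next
  case (Cons P Ps)
  then obtain e where e: "divisor e" "\<forall>P. e P \<ge> 0" "ideal_of e = ideal_prod Ps" by auto
  have P: "P \<in> primes_of F" using Cons.prems by simp
  let ?s = "\<lambda>Q. if Q = P then 1 else 0 :: int"
  have "ideal_of (\<lambda>Q. ?s Q + e Q) = ideal_prod (P # Ps)"
    using ideal_of_add[OF divisor_single[OF P, of 1] e(1)] e(3) ideal_of_single[OF P] by simp
  then show ?case using divisor_add[OF divisor_single[OF P, of 1] e(1)] e(2)
    by (intro exI[of _ "\<lambda>Q. ?s Q + e Q"]) auto
qed

lemma integral_eq_ideal_of:
  assumes "A \<in> integral_ideals F"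
  obtains e where "divisor e" "\<forall>P. e P \<ge> 0" "ideal_of e = A"
proof -
  obtain Ps where "set Ps \<subseteq> primes_of F" "A = ideal_prod Ps" using factorization[OF assms] by blast
  with ideal_prod_eq_ideal_of[of Ps] that show ?thesis by blast
qed

lemma frac_eq_ideal_of:
  assumes A: "A \<in> frac_ideals F"
  obtains e where "divisor e" "ideal_of e = A"
proof -
  obtain x where x: "x \<in> \<O>" "x \<noteq> 0" "ideal_mult (principal F x) A \<in> integral_ideals F"
    by (rule frac_integral_multiple[OF A])
  note x_integral = principal_integral[OF x(1,2)]
  obtain e where e: "divisor e" "\<forall>P. e P \<ge> 0" "ideal_of e = ideal_mult (principal F x) A"
    by (rule integral_eq_ideal_of[OF x(3)])
  obtain f where f: "divisor f" "\<forall>P. f P \<ge> 0" "ideal_of f = principal F x" by (rule integral_eq_ideal_of[OF x_integral])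
  have "ideal_of (\<lambda>P. e P + - f P) =
      ideal_mult (ideal_mult (principal F x) A) (inv\<^bsub>frac_group F\<^esub> (principal F x))"
    using ideal_of_add[OF e(1) divisor_uminus[OF f(1)]] ideal_of_uminus[OF f(1)] e(3) f(3) by simp
  also have "\<dots> = ideal_mult A (ideal_mult (principal F x) (inv\<^bsub>frac_group F\<^esub> (principal F x)))"
    by (metis ideal_mult_assoc ideal_mult_commute)
  also have "\<dots> = A" using frac_inv[OF integral_frac[OF x_integral]] ideal_mult_ints[OF A] by simp
  finally show ?thesis by (rule that[OF divisor_add[OF e(1) divisor_uminus[OF f(1)]]])
qed

abbreviation "val \<equiv> ideal_val F"

lemma val_ideal_of:
  assumes "divisor e"
  shows "val (ideal_of e) = e"
  unfolding ideal_val_def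
proof (rule the_equality)
  show "finite {P. e P \<noteq> 0} \<and> {P. e P \<noteq> 0} \<subseteq> primes_of F \<and>
      ideal_of e = finprod (frac_group F) (\<lambda>P. P [^]\<^bsub>frac_group F\<^esub> e P) {P. e P \<noteq> 0}"
    using assms by (simp add: divisor_def pow_prod_def)
  fix f :: "'a set \<Rightarrow> int"
  assume "finite {P. f P \<noteq> 0} \<and> {P. f P \<noteq> 0} \<subseteq> primes_of F \<and>
      ideal_of e = finprod (frac_group F) (\<lambda>P. P [^]\<^bsub>frac_group F\<^esub> f P) {P. f P \<noteq> 0}"
  then have "divisor f" "ideal_of f = ideal_of e" by (auto simp: divisor_def pow_prod_def)
  then show "f = e" using ideal_of_inject[OF _ assms] by blast
qed

lemma val_divisor: "A \<in> frac_ideals F \<Longrightarrow> divisor (val A)"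
  and ideal_of_val: "A \<in> frac_ideals F \<Longrightarrow> ideal_of (val A) = A"
proof -
  assume "A \<in> frac_ideals F"
  then obtain e where e: "divisor e" "ideal_of e = A" by (rule frac_eq_ideal_of)
  then have "val A = e" using val_ideal_of by blast
  with e show "divisor (val A)" "ideal_of (val A) = A" by simp_all
qed

lemmas val_nonzero_prime = divisor_prime[OF val_divisor]
lemmas val_finite = divisor_finite[OF val_divisor]

lemma val_inject:
  assumes "A \<in> frac_ideals F" "B \<in> frac_ideals F" "val A = val B"
  shows "A = B"
  using ideal_of_val[OF assms(1)] ideal_of_val[OF assms(2)] assms(3) by metis

lemma val_mult:
  assumes "A \<in> frac_ideals F" "B \<in> frac_ideals F"
  shows "val (ideal_mult A B) P = val A P + val B P"
proof -
  note d = val_divisor[OF assms(1)] val_divisor[OF assms(2)]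
  have "ideal_mult A B = ideal_of (\<lambda>P. val A P + val B P)"
    using ideal_of_add[OF d] ideal_of_val assms by simp
  then show ?thesis using val_ideal_of[OF divisor_add[OF d]] by simp
qed

lemma val_ints: "val \<O> P = 0"
  using val_ideal_of[OF divisor_zero] ideal_of_zero by simp

lemma val_inv:
  assumes "A \<in> frac_ideals F"
  shows "val (inv\<^bsub>frac_group F\<^esub> A) P = - val A P"
  using val_mult[OF assms frac_inv_closed[OF assms], of P] frac_inv[OF assms] val_ints[of P] by simp

lemma val_prime: "P \<in> primes_of F \<Longrightarrow> val P = (\<lambda>Q. if Q = P then 1 else 0)"
  using val_ideal_of[OF divisor_single[of P 1]] ideal_of_single by simp

lemma val_nat_pow: "A \<in> frac_ideals F \<Longrightarrow> val (A [^]\<^bsub>frac_group F\<^esub> (n::nat)) P = int n * val A P"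
  using I.nat_pow_closed[of A] by (induction n) (simp_all add: val_ints val_mult distrib_right)

lemma frac_int_pow_closed: "A \<in> frac_ideals F \<Longrightarrow> A [^]\<^bsub>frac_group F\<^esub> (i::int) \<in> frac_ideals F"
  using I.int_pow_closed[of A i] by simp

lemma val_int_pow:
  assumes A: "A \<in> frac_ideals F"
  shows "val (A [^]\<^bsub>frac_group F\<^esub> (i::int)) P = i * val A P"
proof (cases i rule: int_cases2)
  case (nonneg m)
  then show ?thesis using val_nat_pow[OF A, of m P] by (simp add: int_pow_int)
next
  case (nonpos m)
  have "A [^]\<^bsub>frac_group F\<^esub> m \<in> frac_ideals F" using I.nat_pow_closed[of A m] A by simp
  then show ?thesis
    using I.int_pow_neg_int[of A m] val_nat_pow[OF A, of m P] A nonpos by (simp add: val_inv)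
qed

lemma val_finprod:
  assumes "finite S" "\<And>i. i \<in> S \<Longrightarrow> u i \<in> frac_ideals F"
  shows "val (finprod (frac_group F) u S) P = (\<Sum>i\<in>S. val (u i) P)"
  using assms
proof (induction S rule: finite_induct)
  case (insert i S)
  have "finprod (frac_group F) u S \<in> carrier (frac_group F)" using insert.prems by (intro I.finprod_closed) auto
  then show ?case using insert by (subst I.finprod_insert) (auto simp: val_mult)
qed (simp add: val_ints)

lemma val_pow_prod:
  assumes fin: "finite {R. e R \<noteq> 0}" and u: "\<And>R. e R \<noteq> 0 \<Longrightarrow> u R \<in> frac_ideals F"
  shows "val (pow_prod (frac_group F) u e) P = (\<Sum>R | e R \<noteq> 0. e R * val (u R) P)"
proof -
  have "val (pow_prod (frac_group F) u e) P = (\<Sum>R | e R \<noteq> 0. val (u R [^]\<^bsub>frac_group F\<^esub> e R) P)"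
    unfolding pow_prod_def by (rule val_finprod[OF fin]) (auto intro: frac_int_pow_closed u)
  also have "\<dots> = (\<Sum>R | e R \<noteq> 0. e R * val (u R) P)"
    by (rule sum.cong[OF refl]) (simp add: val_int_pow u)
  finally show ?thesis .
qed

lemma subset_ints_iff_val:
  assumes A: "A \<in> frac_ideals F"
  shows "A \<subseteq> \<O> \<longleftrightarrow> (\<forall>P. val A P \<ge> 0)"
proof
  assume "A \<subseteq> \<O>"
  then have "A \<in> integral_ideals F" using A by (simp add: integral_ideals_def)
  then obtain e where e: "divisor e" "\<forall>P. e P \<ge> 0" "ideal_of e = A" by (rule integral_eq_ideal_of)
  show "\<forall>P. val A P \<ge> 0" unfolding e(3)[symmetric] val_ideal_of[OF e(1)] by (rule e(2))
next
  assume "\<forall>P. val A P \<ge> 0"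
  then have nonneg: "\<And>P. val A P \<ge> 0" by blast
  obtain Ps where Ps: "set Ps = {P. val A P \<noteq> 0}" "ideal_of (val A) = ideal_prod Ps"
    by (rule ideal_of_nonneg_eq_ideal_prod[OF val_divisor[OF A] nonneg])
  then have "set Ps \<subseteq> primes_of F" using val_nonzero_prime[OF A] by auto
  then show "A \<subseteq> \<O>" using integral_subset[OF ideal_prod_integral] Ps(2) ideal_of_val[OF A] by metis
qed

lemma val_integral_nonneg: "A \<in> integral_ideals F \<Longrightarrow> val A P \<ge> 0"
  using subset_ints_iff_val[OF integral_frac] integral_subset by blast

lemma subset_iff_mult_inv_integral:
  assumes A: "A \<in> frac_ideals F" and B: "B \<in> frac_ideals F"
  shows "A \<subseteq> B \<longleftrightarrow> ideal_mult A (inv\<^bsub>frac_group F\<^esub> B) \<subseteq> \<O>"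
proof
  assume "A \<subseteq> B"
  then show "ideal_mult A (inv\<^bsub>frac_group F\<^esub> B) \<subseteq> \<O>" using ideal_mult_mono[of A B] frac_inv[OF B] by blast
next
  assume "ideal_mult A (inv\<^bsub>frac_group F\<^esub> B) \<subseteq> \<O>"
  then have "ideal_mult (ideal_mult A (inv\<^bsub>frac_group F\<^esub> B)) B \<subseteq> ideal_mult \<O> B"
    by (intro ideal_mult_mono) auto
  moreover have "ideal_mult (ideal_mult A (inv\<^bsub>frac_group F\<^esub> B)) B =
      ideal_mult A (ideal_mult B (inv\<^bsub>frac_group F\<^esub> B))"
    by (metis ideal_mult_assoc ideal_mult_commute)
  ultimately show "A \<subseteq> B" using frac_inv[OF B] ideal_mult_ints[OF A] ideal_mult_ints_left[OF B] by simp
qed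

lemma subset_iff_val:
  assumes A: "A \<in> frac_ideals F" and B: "B \<in> frac_ideals F"
  shows "A \<subseteq> B \<longleftrightarrow> (\<forall>P. val B P \<le> val A P)"
  using subset_ints_iff_val[OF ideal_mult_frac[OF A frac_inv_closed[OF B]]]
  by (simp add: subset_iff_mult_inv_integral A B val_mult frac_inv_closed val_inv)

lemma subset_prime_iff_val:
  assumes A: "A \<in> integral_ideals F" and P: "P \<in> primes_of F"
  shows "A \<subseteq> P \<longleftrightarrow> val A P > 0"
  unfolding subset_iff_val[OF integral_frac[OF A] prime_frac[OF P]] val_prime[OF P]
  using val_integral_nonneg[OF A] by (auto split: if_splits)

lemma supp_iff_val:
  assumes A: "A \<in> integral_ideals F"
  shows "P \<in> supp F A \<longleftrightarrow> val A P \<noteq> 0"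
proof
  assume "P \<in> supp F A"
  then obtain C where "P \<in> primes_of F" "C \<in> integral_ideals F" "A = ideal_mult P C" by (auto simp: supp_def)
  then have "A \<subseteq> P" "P \<in> primes_of F" using ideal_mult_subset_left prime_integral by auto
  then show "val A P \<noteq> 0" using subset_prime_iff_val[OF A] by auto
next
  assume nonzero: "val A P \<noteq> 0"
  then have P: "P \<in> primes_of F" using val_nonzero_prime[OF integral_frac[OF A]] by blast
  let ?C = "ideal_mult A (inv\<^bsub>frac_group F\<^esub> P)"
  note fracs = integral_frac[OF A] frac_inv_closed[OF prime_frac[OF P]]
  have "A \<subseteq> P" using nonzero val_integral_nonneg[OF A, of P] by (simp add: subset_prime_iff_val[OF A P])
  then have "?C \<in> integral_ideals F"
    by (simp add: integral_ideals_def ideal_mult_frac fracs subset_iff_mult_inv_integral[symmetric] prime_frac[OF P])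
  moreover have "A = ideal_mult P ?C"
    using frac_inv[OF prime_frac[OF P]] ideal_mult_ints[OF fracs(1)] by (metis ideal_mult_left_commute)
  ultimately show "P \<in> supp F A" using P by (auto simp: supp_def)
qed

lemma mem_iff_val:
  assumes "x \<in> F" "x \<noteq> 0" "A \<in> frac_ideals F"
  shows "x \<in> A \<longleftrightarrow> (\<forall>P. val A P \<le> elem_val F x P)"
  using subset_iff_val[OF principal_frac[OF assms(1,2)] assms(3)] principal_subset_iff[OF assms(3)]
  by (simp add: elem_val_def)

lemma elem_val_divisor: "x \<in> F \<Longrightarrow> x \<noteq> 0 \<Longrightarrow> divisor (elem_val F x)"
  using val_divisor[OF principal_frac] by (simp add: elem_val_def[abs_def])

lemma elem_val_mult:
  assumes "x \<in> F" "x \<noteq> 0" "y \<in> F" "y \<noteq> 0"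
  shows "elem_val F (x * y) P = elem_val F x P + elem_val F y P"
  unfolding elem_val_def principal_mult using assms by (intro val_mult principal_frac)

lemma elem_val_one: "elem_val F 1 P = 0"
  by (simp add: elem_val_def principal_one val_ints)

lemma elem_val_inverse:
  assumes "x \<in> F" "x \<noteq> 0"
  shows "elem_val F (inverse x) P = - elem_val F x P"
  using elem_val_mult[OF assms inverse_mem[OF assms(1)], of P] assms(2) elem_val_one[of P] by simp

lemma elem_val_uminus: "elem_val F (- x) P = elem_val F x P"
proof -
  have "principal F (- x) = principal F x" using ints_uminus by (force simp: principal_iff)
  then show ?thesis by (simp add: elem_val_def)
qed

lemma elem_val_add:
  assumes x: "x \<in> F" "x \<noteq> 0" and y: "y \<in> F" "y \<noteq> 0" and z: "x + y \<noteq> 0"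
    and n: "n \<le> elem_val F x P" "n \<le> elem_val F y P"
  shows "n \<le> elem_val F (x + y) P"
proof -
  define e where "e = (\<lambda>P. min (elem_val F x P) (elem_val F y P))"
  have e: "divisor e"
    by (rule divisor_subset_Un[OF elem_val_divisor[OF x] elem_val_divisor[OF y]])
       (auto simp: e_def min_def split: if_splits)
  note eF = ideal_of_frac[OF e]
  have "x \<in> ideal_of e" "y \<in> ideal_of e"
    by (simp_all add: mem_iff_val x y eF val_ideal_of[OF e]) (simp_all add: e_def)
  then have "x + y \<in> ideal_of e" by (rule add_subgroup_add[OF frac_subgroup[OF eF]])
  then have "e P \<le> elem_val F (x + y) P"
    using mem_iff_val[OF add_mem[OF x(1) y(1)] z eF] val_ideal_of[OF e] by simp
  then show ?thesis using n by (simp add: e_def)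
qed

end

section \<open>Multiplicativity of the absolute norm\<close>

context number_field_set
begin

interpretation I: comm_group "frac_group F" by (rule comm_group_frac)

lemma mult_prime_intermediate:
  assumes A: "A \<in> integral_ideals F" and P: "P \<in> primes_of F"
    and C: "C \<in> frac_ideals F" "ideal_mult A P \<subseteq> C" "C \<subseteq> A" "C \<noteq> ideal_mult A P"
  shows "C = A"
proof -
  let ?D = "ideal_mult C (inv\<^bsub>frac_group F\<^esub> A)"
  note A_frac = integral_frac[OF A] and inv = frac_inv[OF integral_frac[OF A]]
  have cancel: "ideal_mult A (ideal_mult B (inv\<^bsub>frac_group F\<^esub> A)) = B" if "B \<in> frac_ideals F" for B
    using inv ideal_mult_ints[OF that] by (metis ideal_mult_left_commute)
  have "?D \<in> frac_ideals F" by (intro ideal_mult_frac C frac_inv_closed A_frac)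
  then have D: "?D \<in> integral_ideals F"
    using C(3) by (simp add: integral_ideals_def subset_iff_mult_inv_integral[OF C(1) A_frac])
  have "ideal_mult (ideal_mult A P) (inv\<^bsub>frac_group F\<^esub> A) \<subseteq> ?D" using C(2) by (intro ideal_mult_mono) auto
  moreover have "ideal_mult (ideal_mult A P) (inv\<^bsub>frac_group F\<^esub> A) = P"
    using cancel[OF prime_frac[OF P]] by (simp add: ideal_mult_assoc)
  ultimately have "P \<subseteq> ?D" by simp
  moreover have "?D \<noteq> P" using cancel[OF C(1)] C(4) by metis
  ultimately have "1 \<in> ?D" using prime_maximal[OF P D] by blast
  then have "?D = \<O>" by (rule integral_eq_ints[OF D])
  then show ?thesis using cancel[OF C(1)] ideal_mult_ints[OF A_frac] by simp
qed

lemma prime_eq_colon: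
  assumes A: "A \<in> integral_ideals F" and P: "P \<in> primes_of F"
    and a: "a \<in> A" "a \<notin> ideal_mult A P"
  shows "{r \<in> \<O>. r * a \<in> ideal_mult A P} = P"
proof -
  let ?Q = "{r \<in> \<O>. r * a \<in> ideal_mult A P}"
  have B: "add_submodule \<O> (ideal_mult A P)"
    by (rule ideal_mult_submodule[OF frac_submodule[OF integral_frac[OF A]]])
  have sub: "P \<subseteq> ?Q"
    using ideal_mult_memI[OF a(1), of _ P] integral_subset[OF prime_integral[OF P]] by (auto simp: mult.commute)
  have "add_submodule \<O> ?Q"
    using add_submodule_subgroup[OF B] B
    by (intro add_submoduleI add_subgroupI)
       (auto simp: ints_zero ints_diff ints_mult left_diff_distrib mult.assoc
         intro: add_subgroup_zero add_subgroup_diff add_submodule_mult)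
  moreover have "?Q \<noteq> {0}" using sub frac_nonzero[OF prime_frac[OF P]] by blast
  ultimately have "?Q \<in> integral_ideals F" by (auto simp: integral_iff)
  then show ?thesis by (rule prime_maximal[OF P _ sub]) (use a(2) in simp)
qed

lemma abs_norm_mult_prime:
  assumes A: "A \<in> integral_ideals F" and P: "P \<in> primes_of F"
  shows "abs_norm (ideal_mult A P) = abs_norm A * abs_norm P"
proof -
  let ?B = "ideal_mult A P"
  note A_frac = integral_frac[OF A] and P_frac = prime_frac[OF P]
  have B: "?B \<in> integral_ideals F" by (rule ideal_mult_integral[OF A prime_integral[OF P]])
  have BA: "?B \<subseteq> A" by (rule ideal_mult_subset_left[OF A prime_integral[OF P]])
  have "val ?B P = val A P + 1" by (simp add: val_mult A_frac P_frac val_prime[OF P])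
  then have "?B \<noteq> A" by auto
  then obtain a where a: "a \<in> A" "a \<notin> ?B" using BA by blast
  have aO: "a \<in> \<O>" using a(1) integral_subset[OF A] by blast
  have adjoin: "adjoin ?B a = A"
  proof (rule mult_prime_intermediate[OF A P integral_frac[OF adjoin_integral[OF B aO]] subset_adjoin])
    show "adjoin ?B a \<subseteq> A" by (rule adjoin_subset[OF frac_submodule[OF A_frac] BA a(1)])
    show "adjoin ?B a \<noteq> ?B"
      using mem_adjoin[OF add_subgroup_zero[OF integral_subgroup[OF B]], of a] a(2) by auto
  qed
  have "add_index \<O> P = add_index A ?B"
  proof (rule add_index_cong[OF prime_subgroup[OF P] integral_subgroup[OF B], of _ "\<lambda>r. r * a"])
    show "x * a \<in> A" if "x \<in> \<O>" for x using that by (rule frac_mult[OF A_frac _ a(1)])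
    show "x * a - y * a \<in> ?B \<longleftrightarrow> x - y \<in> P" if "x \<in> \<O>" "y \<in> \<O>" for x y
      using prime_eq_colon[OF A P a] ints_diff[OF that] by (auto simp: left_diff_distrib[symmetric])
    fix z assume "z \<in> A"
    then have "z \<in> adjoin ?B a" by (simp only: adjoin)
    then obtain b r where "z = b + r * a" "b \<in> ?B" "r \<in> \<O>" by (rule adjoinE)
    then show "\<exists>x\<in>\<O>. z - x * a \<in> ?B" by (intro bexI[of _ r]) simp_all
  qed
  then show ?thesis using abs_norm_tower[OF B A BA] by (simp add: abs_norm_def)
qed

lemma abs_norm_mult:
  assumes A: "A \<in> integral_ideals F" and B: "B \<in> integral_ideals F"
  shows "abs_norm (ideal_mult A B) = abs_norm A * abs_norm B"
proof -
  have "abs_norm (ideal_mult A (ideal_prod Ps)) = abs_norm A * abs_norm (ideal_prod Ps)"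
    if "set Ps \<subseteq> primes_of F" for Ps
    using that
  proof (induction Ps)
    case Nil
    then show ?case by (simp add: ideal_mult_ints integral_frac[OF A] abs_norm_ints)
  next
    case (Cons P Ps)
    have Ps: "ideal_prod Ps \<in> integral_ideals F" and P: "P \<in> primes_of F"
      using Cons.prems ideal_prod_integral by auto
    have eq: "ideal_prod (P # Ps) = ideal_mult (ideal_prod Ps) P" by (simp, rule ideal_mult_commute)
    have "abs_norm (ideal_mult A (ideal_prod Ps)) = abs_norm A * abs_norm (ideal_prod Ps)" using Cons by simp
    then show ?case
      unfolding eq ideal_mult_assoc[symmetric]
        abs_norm_mult_prime[OF ideal_mult_integral[OF A Ps] P] abs_norm_mult_prime[OF Ps P] by simp
  qed
  then show ?thesis using factorization[OF B] by metis
qed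

lemma abs_norm_finprod:
  assumes "finite S" "\<And>i. i \<in> S \<Longrightarrow> u i \<in> integral_ideals F"
  shows "finprod (frac_group F) u S \<in> integral_ideals F"
    and "abs_norm (finprod (frac_group F) u S) = (\<Prod>i\<in>S. abs_norm (u i))"
proof -
  have "finprod (frac_group F) u S \<in> integral_ideals F \<and>
      abs_norm (finprod (frac_group F) u S) = (\<Prod>i\<in>S. abs_norm (u i))"
    using assms
  proof (induction S rule: finite_induct)
    case empty
    then show ?case by (simp add: ints_integral abs_norm_ints)
  next
    case (insert i S)
    have "finprod (frac_group F) u (insert i S) = ideal_mult (u i) (finprod (frac_group F) u S)"
      using insert by (subst I.finprod_insert) (auto simp: integral_frac)
    then show ?case using insert by (simp add: ideal_mult_integral abs_norm_mult)
  qed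
  then show "finprod (frac_group F) u S \<in> integral_ideals F"
    and "abs_norm (finprod (frac_group F) u S) = (\<Prod>i\<in>S. abs_norm (u i))" by simp_all
qed

lemma integral_nat_pow:
  "A \<in> integral_ideals F \<Longrightarrow> A [^]\<^bsub>frac_group F\<^esub> (m::nat) \<in> integral_ideals F"
  by (induction m) (simp_all add: ints_integral ideal_mult_integral)

lemma abs_norm_nat_pow:
  "A \<in> integral_ideals F \<Longrightarrow> abs_norm (A [^]\<^bsub>frac_group F\<^esub> (m::nat)) = abs_norm A ^ m"
  by (induction m) (simp_all add: abs_norm_ints integral_nat_pow abs_norm_mult)

end

section \<open>Clearing denominators modulo a prime\<close>

context number_field_set
begin

definition ints_span :: "nat \<Rightarrow> (nat \<Rightarrow> 'a) \<Rightarrow> 'a set" where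
  "ints_span m c = {\<Sum>i<m. r i * c i | r. \<forall>i<m. r i \<in> \<O>}"

lemma ints_spanE:
  assumes "x \<in> ints_span m c"
  obtains r where "x = (\<Sum>i<m. r i * c i)" "\<forall>i<m. r i \<in> \<O>"
  using assms by (auto simp: ints_span_def)

lemma ints_span_submodule: "add_submodule \<O> (ints_span m c)"
proof (intro add_submoduleI add_subgroupI)
  show "0 \<in> ints_span m c" unfolding ints_span_def
    using ints_zero by (intro CollectI exI[of _ "\<lambda>_. 0"]) auto
  fix x assume "x \<in> ints_span m c"
  then obtain r where x: "x = (\<Sum>i<m. r i * c i)" "\<forall>i<m. r i \<in> \<O>" by (rule ints_spanE)
  show "s * x \<in> ints_span m c" if "s \<in> \<O>" for s
    unfolding ints_span_def x(1) using x(2) that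
    by (intro CollectI exI[of _ "\<lambda>i. s * r i"]) (simp add: sum_distrib_left mult.assoc ints_mult)
  fix y assume "y \<in> ints_span m c"
  then obtain s where y: "y = (\<Sum>i<m. s i * c i)" "\<forall>i<m. s i \<in> \<O>" by (rule ints_spanE)
  show "x - y \<in> ints_span m c"
    unfolding ints_span_def x(1) y(1) using x(2) y(2)
    by (intro CollectI exI[of _ "\<lambda>i. r i - s i"]) (simp add: sum_subtractf left_diff_distrib ints_diff)
qed

lemma ints_span_base:
  assumes "i < m"
  shows "c i \<in> ints_span m c"
proof -
  have "(\<Sum>j<m. (if j = i then 1 else 0) * c j) = (\<Sum>j<m. if j = i then c j else 0)"
    by (rule sum.cong) auto
  also have "\<dots> = c i" using assms by simp
  finally show ?thesis unfolding ints_span_def using ints_one ints_zero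
    by (intro CollectI exI[of _ "\<lambda>j. if j = i then 1 else 0"]) auto
qed

lemma ints_span_least:
  assumes "add_submodule \<O> C" "\<And>i. i < m \<Longrightarrow> c i \<in> C"
  shows "ints_span m c \<subseteq> C"
  using assms by (auto elim!: ints_spanE intro!: add_subgroup_sum add_submodule_subgroup add_submodule_mult)

lemma ints_span_frac:
  assumes c: "\<And>i. i < m \<Longrightarrow> c i \<in> F" and nonzero: "\<exists>i<m. c i \<noteq> 0"
  shows "ints_span m c \<in> frac_ideals F"
proof -
  have "\<exists>e::nat. e > 0 \<and> of_nat e * c i \<in> \<O>" if "i \<in> {..<m}" for i
    using ints_denominator[of "c i"] c that by (metis lessThan_iff)
  then obtain N :: nat where N: "N > 0" "\<And>i. i \<in> {..<m} \<Longrightarrow> of_nat N * c i \<in> \<O>"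
    by (rule common_multiplier[where I = "{..<m}" and c = c and S = \<O>, rotated])
       (auto intro: ints_mult ints_of_nat)
  obtain l where l: "l < m" "c l \<noteq> 0" using nonzero by blast
  have sub: "add_submodule \<O> {x. of_nat N * x \<in> \<O>}"
    by (intro add_submoduleI add_subgroupI)
       (simp_all add: ints_zero right_diff_distrib ints_diff mult.left_commute ints_mult)
  show ?thesis
  proof (rule frac_idealI[where a = "c l" and e = "of_nat N"])
    show "ints_span m c \<subseteq> F"
      using c by (intro ints_span_least add_submoduleI add_subgroup) (auto intro: mult_mem ints_subset)
    show "of_nat N * x \<in> \<O>" if "x \<in> ints_span m c" for x
      using ints_span_least[OF sub, of m c] N(2) that by auto
  qed (use N(1) l in \<open>simp_all add: ints_span_submodule ints_span_base of_nat_mem\<close>)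
qed

text \<open>If no element of the inverse of \<open>(c\<^sub>0, \<dots>, c\<^sub>m\<^sub>-\<^sub>1)\<close> worked, that inverse would send the ideal into \<open>p\<close>.\<close>

lemma clear_denominators:
  fixes m :: nat
  assumes p: "p \<in> primes_of F" and c: "\<And>i. i < m \<Longrightarrow> c i \<in> F" and nonzero: "\<exists>i<m. c i \<noteq> 0"
  obtains t where "t \<in> F" "\<forall>i<m. t * c i \<in> \<O>" "\<exists>i<m. t * c i \<notin> p"
proof -
  let ?b = "inv\<^bsub>frac_group F\<^esub> (ints_span m c)"
  have a: "ints_span m c \<in> frac_ideals F" using c nonzero by (rule ints_span_frac)
  have "\<exists>t\<in>?b. \<exists>i<m. t * c i \<notin> p"
  proof (rule ccontr)
    assume neg: "\<not> (\<exists>t\<in>?b. \<exists>i<m. t * c i \<notin> p)"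
    have "ideal_mult (ints_span m c) ?b \<subseteq> p"
    proof (rule ideal_mult_least[OF prime_subgroup[OF p]])
      fix x t assume x: "x \<in> ints_span m c" and t: "t \<in> ?b"
      have "add_submodule \<O> {x. x * t \<in> p}"
        using prime_subgroup[OF p] frac_submodule[OF prime_frac[OF p]]
        by (intro add_submoduleI add_subgroupI)
           (auto simp: left_diff_distrib mult.assoc intro: add_subgroup_zero add_subgroup_diff add_submodule_mult)
      then have "ints_span m c \<subseteq> {x. x * t \<in> p}"
        by (rule ints_span_least) (use neg t in \<open>auto simp: mult.commute\<close>)
      with x show "x * t \<in> p" by blast
    qed
    then show False using frac_inv[OF a] ints_one prime_not_one[OF p] by blast
  qed
  then obtain t where t: "t \<in> ?b" "\<exists>i<m. t * c i \<notin> p" by blast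
  have "t * c i \<in> \<O>" if "i < m" for i
    using ideal_mult_memI[OF ints_span_base[OF that, of c] t(1)] by (simp add: frac_inv[OF a] mult.commute)
  moreover have "t \<in> F" using t(1) frac_subset[OF frac_inv_closed[OF a]] by blast
  ultimately show ?thesis using that t(2) by blast
qed

end

section \<open>Polynomials over a subfield\<close>

definition poly_over :: "'a::zero set \<Rightarrow> 'a poly set" where
  "poly_over F = {p. \<forall>i. Polynomial.coeff p i \<in> F}"

lemma poly_overD: "p \<in> poly_over F \<Longrightarrow> Polynomial.coeff p i \<in> F"
  by (simp add: poly_over_def)

lemma poly_over_mono: "F \<subseteq> G \<Longrightarrow> poly_over F \<subseteq> poly_over G"
  by (auto simp: poly_over_def)

context subfield_set
begin

lemma poly_over_one: "1 \<in> poly_over F"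
  by (simp add: poly_over_def zero_mem one_mem)

lemma poly_over_add: "p \<in> poly_over F \<Longrightarrow> q \<in> poly_over F \<Longrightarrow> p + q \<in> poly_over F"
  and poly_over_diff: "p \<in> poly_over F \<Longrightarrow> q \<in> poly_over F \<Longrightarrow> p - q \<in> poly_over F"
  by (simp_all add: poly_over_def add_mem diff_mem)

lemma poly_over_mult: "p \<in> poly_over F \<Longrightarrow> q \<in> poly_over F \<Longrightarrow> p * q \<in> poly_over F"
  by (auto simp: poly_over_def Polynomial.coeff_mult intro!: sum_mem mult_mem)

lemma poly_over_smult: "a \<in> F \<Longrightarrow> p \<in> poly_over F \<Longrightarrow> Polynomial.smult a p \<in> poly_over F"
  by (auto simp: poly_over_def intro: mult_mem)

lemma poly_over_monom: "a \<in> F \<Longrightarrow> monom a i \<in> poly_over F"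
  by (simp add: poly_over_def zero_mem)

lemma poly_over_linear: "a \<in> F \<Longrightarrow> [:- a, 1:] \<in> poly_over F"
  by (simp add: poly_over_def coeff_pCons uminus_mem one_mem zero_mem split: nat.split)

lemma poly_over_sum: "(\<And>i. i \<in> I \<Longrightarrow> f i \<in> poly_over F) \<Longrightarrow> sum f I \<in> poly_over F"
  by (induction I rule: infinite_finite_induct) (auto simp: poly_over_add poly_over_def[of F] zero_mem add_mem)

lemma poly_over_prod: "(\<And>i. i \<in> I \<Longrightarrow> f i \<in> poly_over F) \<Longrightarrow> prod f I \<in> poly_over F"
  by (induction I rule: infinite_finite_induct) (auto simp: poly_over_one poly_over_mult)

lemma poly_mem: "p \<in> poly_over F \<Longrightarrow> x \<in> F \<Longrightarrow> poly p x \<in> F"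
  by (auto simp: poly_altdef poly_over_def intro!: sum_mem mult_mem power_mem)

lemma poly_over_cancel_lead:
  assumes p: "p \<in> poly_over F" "\<forall>i>n. Polynomial.coeff p i = 0"
    and q: "q \<in> poly_over F" "q \<noteq> 0" "Polynomial.degree q \<le> n"
  obtains m where "m \<in> poly_over F" "\<forall>i\<ge>n. Polynomial.coeff (p - m * q) i = 0"
proof
  let ?m = "monom (Polynomial.coeff p n / lead_coeff q) (n - Polynomial.degree q)"
  show "?m \<in> poly_over F"
    by (intro poly_over_monom divide_mem poly_overD[OF p(1)] poly_overD[OF q(1)])
  show "\<forall>i\<ge>n. Polynomial.coeff (p - ?m * q) i = 0"
  proof (intro allI impI)
    fix i assume i: "i \<ge> n"
    show "Polynomial.coeff (p - ?m * q) i = 0"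
    proof (cases "i = n")
      case True
      then show ?thesis using q(2,3) by (simp add: coeff_monom_mult)
    next
      case False
      then have "i - (n - Polynomial.degree q) > Polynomial.degree q" using i q(3) by linarith
      then show ?thesis using i False p(2) by (simp add: coeff_monom_mult coeff_eq_0)
    qed
  qed
qed

lemma poly_over_div_mod:
  assumes "p \<in> poly_over F" and q: "q \<in> poly_over F"
  shows "p div q \<in> poly_over F \<and> p mod q \<in> poly_over F"
proof -
  have zero_poly: "0 \<in> poly_over F" by (simp add: poly_over_def zero_mem)
  have "p div q \<in> poly_over F \<and> p mod q \<in> poly_over F"
    if "p \<in> poly_over F" "\<forall>i\<ge>n. Polynomial.coeff p i = 0" for n
    using that
  proof (induction n arbitrary: p)
    case 0
    then have "p = 0" by (intro poly_eqI) simp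
    then show ?case using zero_poly by simp
  next
    case (Suc n)
    have high: "\<forall>i>n. Polynomial.coeff p i = 0" using Suc.prems(2) by simp
    consider (zero) "q = 0" | (small) "n < Polynomial.degree q" | (large) "q \<noteq> 0" "Polynomial.degree q \<le> n" by linarith
    then show ?case
    proof cases
      case zero
      then show ?thesis using Suc.prems(1) zero_poly by simp
    next
      case small
      have "Polynomial.degree p \<le> n" by (rule degree_le[OF high])
      then have "Polynomial.degree p < Polynomial.degree q" using small by simp
      then show ?thesis using Suc.prems(1) zero_poly by (simp add: div_poly_less mod_poly_less)
    next
      case large
      obtain m where m: "m \<in> poly_over F" "\<forall>i\<ge>n. Polynomial.coeff (p - m * q) i = 0"
        by (rule poly_over_cancel_lead[OF Suc.prems(1) high q large])
      have "(p - m * q) div q \<in> poly_over F \<and> (p - m * q) mod q \<in> poly_over F"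
        using m by (intro Suc.IH poly_over_diff Suc.prems(1) poly_over_mult q)
      moreover have "p div q = (p - m * q) div q + m" "p mod q = (p - m * q) mod q"
        using div_mult_self1[OF large(1), of "p - m * q" m] mod_mult_self1[of "p - m * q" m q] by simp_all
      ultimately show ?thesis using m(1) poly_over_add by simp
    qed
  qed
  from this[of "Suc (Polynomial.degree p)"] show ?thesis using assms(1) by (simp add: coeff_eq_0)
qed

end

section \<open>Homomorphisms of fields\<close>

locale subfield_hom = subfield_set K for K :: "'a::field_char_0 set" +
  fixes h :: "'a \<Rightarrow> 'b::field_char_0"
  assumes hom_add: "x \<in> K \<Longrightarrow> y \<in> K \<Longrightarrow> h (x + y) = h x + h y"
    and hom_mult: "x \<in> K \<Longrightarrow> y \<in> K \<Longrightarrow> h (x * y) = h x * h y"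
    and hom_one: "h 1 = 1"
begin

lemma hom_zero: "h 0 = 0"
  using hom_add[OF zero_mem zero_mem] by simp

lemma hom_uminus: "x \<in> K \<Longrightarrow> h (- x) = - h x"
  using hom_add[OF _ uminus_mem, of x x] hom_zero by (simp add: eq_neg_iff_add_eq_0 add.commute)

lemma hom_diff: "x \<in> K \<Longrightarrow> y \<in> K \<Longrightarrow> h (x - y) = h x - h y"
  using hom_add[OF _ uminus_mem, of x y] hom_uminus[of y] by simp

lemma hom_sum: "(\<And>i. i \<in> I \<Longrightarrow> f i \<in> K) \<Longrightarrow> h (sum f I) = (\<Sum>i\<in>I. h (f i))"
  by (induction I rule: infinite_finite_induct) (auto simp: hom_zero hom_add sum_mem)

lemma hom_prod: "(\<And>i. i \<in> I \<Longrightarrow> f i \<in> K) \<Longrightarrow> h (prod f I) = (\<Prod>i\<in>I. h (f i))"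
  by (induction I rule: infinite_finite_induct) (auto simp: hom_one hom_mult prod_mem)

lemma hom_power: "x \<in> K \<Longrightarrow> h (x ^ n) = h x ^ n"
  by (induction n) (auto simp: hom_one hom_mult power_mem)

lemma hom_of_nat: "h (of_nat n) = of_nat n"
  by (induction n) (auto simp: hom_zero hom_one hom_add one_mem of_nat_mem)

lemma hom_of_int: "h (of_int n) = of_int n"
  by (cases n rule: int_cases2) (auto simp: hom_of_nat hom_uminus of_nat_mem)

lemma hom_nonzero: "x \<in> K \<Longrightarrow> x \<noteq> 0 \<Longrightarrow> h x \<noteq> 0"
  using hom_mult[OF _ inverse_mem, of x x] hom_one by auto

lemma hom_inverse: "x \<in> K \<Longrightarrow> h (inverse x) = inverse (h x)"
  using hom_mult[OF _ inverse_mem, of x x] hom_one hom_zero hom_nonzero[of x]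
  by (cases "x = 0") (auto simp: field_simps)

lemma hom_inj: "inj_on h K"
proof (rule inj_onI)
  fix x y assume "x \<in> K" "y \<in> K" "h x = h y"
  then show "x = y" using hom_nonzero[OF diff_mem, of x y] hom_diff[of x y] by auto
qed

lemma hom_comp:
  assumes "subfield_hom L g" "\<And>x. x \<in> K \<Longrightarrow> h x \<in> L"
  shows "subfield_hom K (\<lambda>x. g (h x))"
proof -
  interpret g: subfield_hom L g by (rule assms(1))
  show ?thesis
    by unfold_locales (simp_all add: assms(2) hom_add hom_mult hom_one g.hom_add g.hom_mult g.hom_one)
qed

lemma hom_algebraic_int:
  assumes "x \<in> K" "algebraic_int x"
  shows "algebraic_int (h x)"
proof -
  obtain n and c :: "nat \<Rightarrow> int" where c: "n > 0" "x ^ n = (\<Sum>i<n. of_int (c i) * x ^ i)"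
    by (rule algebraic_int_powerE[OF assms(2)])
  have "h x ^ n = h (\<Sum>i<n. of_int (c i) * x ^ i)" using assms(1) by (simp only: hom_power c(2)[symmetric])
  also have "\<dots> = (\<Sum>i<n. of_int (c i) * h x ^ i)"
    using assms(1) by (simp add: hom_sum hom_mult hom_power hom_of_int of_int_mem power_mem mult_mem)
  finally show ?thesis by (rule algebraic_int_powerI)
qed

lemma coeff_map_poly_hom: "Polynomial.coeff (map_poly h p) i = h (Polynomial.coeff p i)"
  by (rule coeff_map_poly) (rule hom_zero)

lemma degree_map_poly_hom_le: "Polynomial.degree (map_poly h p) \<le> Polynomial.degree p"
  by (rule degree_le) (simp add: coeff_map_poly_hom coeff_eq_0 hom_zero)

lemma map_poly_hom_one: "map_poly h 1 = 1"
  by (rule poly_eqI) (simp add: coeff_map_poly_hom hom_one hom_zero)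

lemma map_poly_hom_linear: "a \<in> K \<Longrightarrow> map_poly h [:- a, 1:] = [:- h a, 1:]"
  by (rule poly_eqI) (simp add: coeff_map_poly_hom coeff_pCons hom_uminus hom_one hom_zero split: nat.split)

lemma map_poly_hom_smult:
  "a \<in> K \<Longrightarrow> p \<in> poly_over K \<Longrightarrow> map_poly h (Polynomial.smult a p) = Polynomial.smult (h a) (map_poly h p)"
  by (rule poly_eqI) (simp add: coeff_map_poly_hom hom_mult poly_overD)

lemma map_poly_hom_add:
  "p \<in> poly_over K \<Longrightarrow> q \<in> poly_over K \<Longrightarrow> map_poly h (p + q) = map_poly h p + map_poly h q"
  by (rule poly_eqI) (simp add: coeff_map_poly_hom hom_add poly_overD)

lemma map_poly_hom_mult:
  "p \<in> poly_over K \<Longrightarrow> q \<in> poly_over K \<Longrightarrow> map_poly h (p * q) = map_poly h p * map_poly h q"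
  by (rule poly_eqI)
     (simp add: coeff_map_poly_hom Polynomial.coeff_mult hom_sum hom_mult mult_mem poly_overD)

lemma map_poly_hom_sum:
  "(\<And>i. i \<in> I \<Longrightarrow> f i \<in> poly_over K) \<Longrightarrow> map_poly h (sum f I) = (\<Sum>i\<in>I. map_poly h (f i))"
  by (induction I rule: infinite_finite_induct) (auto simp: map_poly_hom_add poly_over_sum)

lemma map_poly_hom_prod:
  "(\<And>i. i \<in> I \<Longrightarrow> f i \<in> poly_over K) \<Longrightarrow> map_poly h (prod f I) = (\<Prod>i\<in>I. map_poly h (f i))"
  by (induction I rule: infinite_finite_induct) (auto simp: map_poly_hom_one map_poly_hom_mult poly_over_prod)

lemma poly_map_poly_hom:
  assumes p: "p \<in> poly_over K" and x: "x \<in> K"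
  shows "poly (map_poly h p) (h x) = h (poly p x)"
proof -
  have "poly (map_poly h p) (h x) = (\<Sum>i\<le>Polynomial.degree p. h (Polynomial.coeff p i) * h x ^ i)"
    unfolding poly_altdef using degree_map_poly_hom_le[of p]
    by (intro sum.mono_neutral_cong_left) (auto simp: coeff_map_poly_hom[symmetric] coeff_eq_0)
  also have "\<dots> = h (poly p x)"
    unfolding poly_altdef using poly_overD[OF p] x
    by (simp add: hom_sum hom_mult hom_power mult_mem power_mem)
  finally show ?thesis .
qed

end

lemma map_poly_cong_poly_over:
  assumes "p \<in> poly_over F" "\<And>x. x \<in> F \<Longrightarrow> f x = g x"
  shows "map_poly f p = map_poly g p"
  using assms by (intro map_poly_cong) (auto simp: poly_over_def coeffs_def split: if_splits)

section \<open>Covering a field by subspaces\<close>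

lemma finite_progression_mem:
  fixes u w :: "'a::ring_1"
  assumes W: "add_subgroup W" and u: "u \<notin> W"
    and pure: "\<And>n::nat. n > 0 \<Longrightarrow> of_nat n * u \<in> W \<Longrightarrow> u \<in> W"
  shows "finite {n::nat. w + of_nat n * u \<in> W}"
proof (rule inj_on_finite[of "\<lambda>_. ()" _ UNIV])
  have not_less: "\<not> m < n" if "w + of_nat m * u \<in> W" "w + of_nat n * u \<in> W" for m n :: nat
  proof
    assume less: "m < n"
    have "(w + of_nat n * u) - (w + of_nat m * u) \<in> W" by (rule add_subgroup_diff[OF W that(2,1)])
    also have "(w + of_nat n * u) - (w + of_nat m * u) = of_nat (n - m) * u"
      using less by (simp add: of_nat_diff left_diff_distrib)
    finally show False using pure[of "n - m"] less u by simp
  qed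
  show "inj_on (\<lambda>_. ()) {n. w + of_nat n * u \<in> W}"
    using not_less by (intro inj_onI) (metis linorder_neqE_nat mem_Collect_eq)
qed auto

text \<open>
  If \<open>u\<close> lies in none of the sets \<open>W \<in> \<V>\<close> and \<open>w\<close> is not in \<open>V\<close>, which contains \<open>u\<close>, then \<open>w + n u\<close> is
  never in \<open>V\<close>, and it is in each \<open>W\<close> for at most one \<open>n\<close>.
\<close>

lemma not_covered_by_subspaces:
  fixes K :: "'a::ring_1 set"
  assumes "finite \<V>" and K: "add_subgroup K"
    and "\<And>V. V \<in> \<V> \<Longrightarrow> add_subgroup V \<and> \<not> K \<subseteq> V"
    and "\<And>V (n::nat) u. V \<in> \<V> \<Longrightarrow> n > 0 \<Longrightarrow> of_nat n * u \<in> V \<Longrightarrow> u \<in> V"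
  shows "\<exists>x\<in>K. \<forall>V\<in>\<V>. x \<notin> V"
  using assms(1,3,4)
proof (induction \<V> rule: finite_induct)
  case empty
  then show ?case using add_subgroup_zero[OF K] by blast
next
  case (insert V \<V>)
  have V: "add_subgroup V" using insert.prems(1) by blast
  obtain u where u: "u \<in> K" "\<forall>W\<in>\<V>. u \<notin> W" using insert.IH insert.prems by blast
  obtain w where w: "w \<in> K" "w \<notin> V" using insert.prems(1) by blast
  show ?case
  proof (cases "u \<in> V")
    case False
    then show ?thesis using u by blast
  next
    case True
    have multiple: "of_nat n * x \<in> A" if "add_subgroup A" "x \<in> A" for n :: nat and x and A :: "'a set"
      using add_subgroup_of_int_mult[OF that, of "int n"] by simp
    have notin_V: "w + of_nat n * u \<notin> V" for n :: nat
      using add_subgroup_diff[OF V _ multiple[OF V True], of "w + of_nat n * u" n] w(2) by auto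
    have "finite {n::nat. w + of_nat n * u \<in> W}" if "W \<in> \<V>" for W
      using that u(2) insert.prems by (intro finite_progression_mem) auto
    then have "finite (\<Union>W\<in>\<V>. {n::nat. w + of_nat n * u \<in> W})" using insert.hyps(1) by blast
    then obtain n :: nat where "n \<notin> (\<Union>W\<in>\<V>. {n. w + of_nat n * u \<in> W})"
      using ex_new_if_finite infinite_UNIV_nat by metis
    moreover have "w + of_nat n * u \<in> K" by (rule add_subgroup_add[OF K w(1) multiple[OF K u(1)]])
    ultimately show ?thesis using notin_V by blast
  qed
qed

section \<open>Galois groups\<close>

locale galois_extension = K: number_field_set K + k: number_field_set k
  for K k :: "'a::field_char_0 set" +
  assumes galois: "galois_ext K k"
begin

abbreviation "\<G> \<equiv> carrier (gal_group K k)"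
abbreviation gmul (infixl "\<star>" 70) where "s \<star> t \<equiv> s \<otimes>\<^bsub>gal_group K k\<^esub> t"
abbreviation ginv where "ginv s \<equiv> inv\<^bsub>gal_group K k\<^esub> s"

lemma base_subset: "k \<subseteq> K"
  using galois by (simp add: galois_ext_def)

lemmas base_mem = subsetD[OF base_subset]

lemma gal_iff: "s \<in> \<G> \<longleftrightarrow> s \<in> Bij K \<and>
    (\<forall>x\<in>K. \<forall>y\<in>K. s (x + y) = s x + s y \<and> s (x * y) = s x * s y) \<and> (\<forall>x\<in>k. s x = x)"
proof -
  have "s 1 = 1" if "\<forall>x\<in>k. s x = x" using that k.one_mem by blast
  then show ?thesis
    by (auto simp: gal_group_def Ring.ring_hom_def dest: Bij_imp_funcset)
qed

lemma gal_Bij: "s \<in> \<G> \<Longrightarrow> s \<in> Bij K"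
  and gal_fixes_base: "s \<in> \<G> \<Longrightarrow> x \<in> k \<Longrightarrow> s x = x"
  by (simp_all add: gal_iff)

lemma gal_bij_betw: "s \<in> \<G> \<Longrightarrow> bij_betw s K K"
  using gal_Bij by (simp add: Bij_def)

lemma gal_hom: "s \<in> \<G> \<Longrightarrow> subfield_hom K s"
  by unfold_locales (auto simp: gal_iff k.one_mem)

lemma gal_mem: "s \<in> \<G> \<Longrightarrow> x \<in> K \<Longrightarrow> s x \<in> K"
  using gal_bij_betw by (auto simp: bij_betw_def)

lemma gal_ext: "s \<in> \<G> \<Longrightarrow> t \<in> \<G> \<Longrightarrow> (\<And>x. x \<in> K \<Longrightarrow> s x = t x) \<Longrightarrow> s = t"
  using gal_Bij[of s] gal_Bij[of t] by (intro extensionalityI[of s K t]) (auto simp: Bij_def)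

lemma gal_id: "(\<lambda>x\<in>K. x) \<in> \<G>"
  using base_subset by (auto simp: gal_iff id_Bij K.add_mem K.mult_mem)

lemma gal_inverse:
  assumes s: "s \<in> \<G>"
  shows "(\<lambda>x\<in>K. inv_into K s x) \<in> \<G>"
proof -
  interpret s: subfield_hom K s by (rule gal_hom[OF s])
  note bij = gal_bij_betw[OF s]
  let ?t = "\<lambda>x\<in>K. inv_into K s x"
  have t: "?t (s y) = y" if "y \<in> K" for y
    using that bij gal_mem[OF s] by (auto simp: bij_betw_def inv_into_f_f)
  have ex: "\<exists>y\<in>K. x = s y" if "x \<in> K" for x using bij_betw_imp_surj_on[OF bij] that by (metis imageE)
  show ?thesis unfolding gal_iff
  proof (intro conjI ballI)
    show "?t \<in> Bij K" by (rule restrict_inv_into_Bij[OF gal_Bij[OF s]])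
    fix x y assume "x \<in> K" "y \<in> K"
    then obtain u v where uv: "u \<in> K" "x = s u" "v \<in> K" "y = s v" using ex by meson
    show "?t (x + y) = ?t x + ?t y"
      unfolding uv s.hom_add[OF uv(1,3), symmetric] t[OF uv(1)] t[OF uv(3)] by (rule t[OF K.add_mem[OF uv(1,3)]])
    show "?t (x * y) = ?t x * ?t y"
      unfolding uv s.hom_mult[OF uv(1,3), symmetric] t[OF uv(1)] t[OF uv(3)] by (rule t[OF K.mult_mem[OF uv(1,3)]])
  next
    fix x assume "x \<in> k"
    then show "?t x = x" using t[of x] gal_fixes_base[OF s] base_mem by simp
  qed
qed

lemma gal_compose:
  assumes s: "s \<in> \<G>" and t: "t \<in> \<G>"
  shows "compose K s t \<in> \<G>"
proof -
  interpret s: subfield_hom K s by (rule gal_hom[OF s])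
  interpret t: subfield_hom K t by (rule gal_hom[OF t])
  show ?thesis unfolding gal_iff
  proof (intro conjI ballI)
    show "compose K s t \<in> Bij K" by (rule compose_Bij[OF gal_Bij[OF s] gal_Bij[OF t]])
    fix x y assume xy: "x \<in> K" "y \<in> K"
    note m = gal_mem[OF t xy(1)] gal_mem[OF t xy(2)]
    show "compose K s t (x + y) = compose K s t x + compose K s t y"
      using s.hom_add[OF m] t.hom_add[OF xy] xy by (simp add: compose_eq K.add_mem)
    show "compose K s t (x * y) = compose K s t x * compose K s t y"
      using s.hom_mult[OF m] t.hom_mult[OF xy] xy by (simp add: compose_eq K.mult_mem)
  next
    fix x assume "x \<in> k"
    then show "compose K s t x = x"
      using gal_fixes_base[OF s] gal_fixes_base[OF t] base_mem by (simp add: compose_eq)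
  qed
qed

lemma gal_group: "group (gal_group K k)"
proof -
  interpret B: group "BijGroup K" by (rule group_BijGroup)
  have "subgroup \<G> (BijGroup K)"
  proof (rule B.subgroupI)
    show "\<G> \<subseteq> carrier (BijGroup K)" by (auto simp: BijGroup_def gal_Bij)
    show "\<G> \<noteq> {}" using gal_id by blast
    show "inv\<^bsub>BijGroup K\<^esub> s \<in> \<G>" if "s \<in> \<G>" for s
      using gal_inverse[OF that] inv_BijGroup[OF gal_Bij[OF that]] by simp
    show "s \<otimes>\<^bsub>BijGroup K\<^esub> t \<in> \<G>" if "s \<in> \<G>" "t \<in> \<G>" for s t
      using gal_compose[OF that] that by (simp add: BijGroup_def gal_Bij)
  qed
  then have "group (BijGroup K\<lparr>carrier := \<G>\<rparr>)" by (rule B.subgroup_imp_group)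
  then show ?thesis by (simp add: gal_group_def)
qed

sublocale G: group "gal_group K k" by (rule gal_group)

lemma gal_mult_apply: "s \<in> \<G> \<Longrightarrow> t \<in> \<G> \<Longrightarrow> x \<in> K \<Longrightarrow> (s \<star> t) x = s (t x)"
  using gal_Bij[of s] gal_Bij[of t] by (simp add: gal_group_def BijGroup_def compose_eq)

lemma gal_one_apply: "x \<in> K \<Longrightarrow> \<one>\<^bsub>gal_group K k\<^esub> x = x"
  by (simp add: gal_group_def BijGroup_def)

lemma gal_inv_apply: "s \<in> \<G> \<Longrightarrow> x \<in> K \<Longrightarrow> ginv s (s x) = x"
  using gal_mult_apply[of "ginv s" s x] gal_one_apply[of x] by simp

lemma gal_apply_inv: "s \<in> \<G> \<Longrightarrow> x \<in> K \<Longrightarrow> s (ginv s x) = x"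
  using gal_mult_apply[of s "ginv s" x] gal_one_apply[of x] by simp

lemma fixed_mem: "x \<in> K \<Longrightarrow> (\<And>s. s \<in> \<G> \<Longrightarrow> s x = x) \<Longrightarrow> x \<in> k"
  using galois unfolding galois_ext_def by blast

lemma gal_translate_bij: "t \<in> \<G> \<Longrightarrow> bij_betw (\<lambda>s. t \<star> s) \<G> \<G>"
  by (rule bij_betwI[where g = "\<lambda>s. ginv t \<star> s"]) (auto simp: G.m_assoc[symmetric])

lemma gal_rtranslate_bij: "t \<in> \<G> \<Longrightarrow> bij_betw (\<lambda>s. s \<star> t) \<G> \<G>"
  by (rule bij_betwI[where g = "\<lambda>s. s \<star> ginv t"]) (auto simp: G.m_assoc)

lemma poly_over_base: "poly_over k \<subseteq> poly_over K"
  by (rule poly_over_mono[OF base_subset])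

lemma map_poly_gal_base:
  assumes "s \<in> \<G>" "p \<in> poly_over k"
  shows "map_poly s p = p"
  using map_poly_cong_poly_over[of p k s "\<lambda>x. x"] assms gal_fixes_base by simp

lemma poly_over_baseI:
  assumes "p \<in> poly_over K" "\<And>s. s \<in> \<G> \<Longrightarrow> map_poly s p = p"
  shows "p \<in> poly_over k"
  unfolding poly_over_def
proof (intro CollectI allI fixed_mem)
  fix i show "Polynomial.coeff p i \<in> K" by (rule poly_overD[OF assms(1)])
  fix s assume s: "s \<in> \<G>"
  interpret s: subfield_hom K s by (rule gal_hom[OF s])
  show "s (Polynomial.coeff p i) = Polynomial.coeff p i"
    using s.coeff_map_poly_hom[of p i] assms(2)[OF s] by simp
qed

lemma poly_gal_apply:
  assumes "s \<in> \<G>" "p \<in> poly_over k" "x \<in> K"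
  shows "poly p (s x) = s (poly p x)"
  using subfield_hom.poly_map_poly_hom[OF gal_hom[OF assms(1)], of p x] assms poly_over_base
  by (auto simp: map_poly_gal_base)

end

section \<open>Primitive elements\<close>

context galois_extension
begin

lemma ex_primitive_element:
  assumes S: "finite S" "S \<subseteq> \<G>"
  obtains \<theta> where "\<theta> \<in> K" "inj_on (\<lambda>s. s \<theta>) S"
proof -
  define V where "V = (\<lambda>(s, t :: 'a \<Rightarrow> 'a). {x \<in> K. (s x :: 'a) = t x})"
  define \<V> where "\<V> = V ` {(s, t). s \<in> S \<and> t \<in> S \<and> s \<noteq> t}"
  have "{(s, t). s \<in> S \<and> t \<in> S \<and> s \<noteq> t} \<subseteq> S \<times> S" by auto
  then have "finite \<V>" unfolding \<V>_def using S(1) finite_subset finite_cartesian_product by blast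
  then have "\<exists>x\<in>K. \<forall>V\<in>\<V>. x \<notin> V"
  proof (rule not_covered_by_subspaces[OF _ K.add_subgroup])
    fix W assume "W \<in> \<V>"
    then obtain s t where st: "s \<in> \<G>" "t \<in> \<G>" "s \<noteq> t" "W = {x \<in> K. s x = t x}"
      using S(2) by (auto simp: \<V>_def V_def)
    interpret s: subfield_hom K s by (rule gal_hom[OF st(1)])
    interpret t: subfield_hom K t by (rule gal_hom[OF st(2)])
    have "add_subgroup W"
      by (rule add_subgroupI) (auto simp: st(4) s.hom_zero t.hom_zero s.hom_diff t.hom_diff K.zero_mem K.diff_mem)
    moreover have "\<not> K \<subseteq> W" using gal_ext[OF st(1,2)] st(3,4) by blast
    ultimately show "add_subgroup W \<and> \<not> K \<subseteq> W" by blast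
    fix n :: nat and u assume n: "n > 0" and nu: "of_nat n * u \<in> W"
    have "(of_nat n * u) / of_nat n \<in> K"
      using nu by (intro K.divide_mem K.of_nat_mem) (simp add: st(4))
    then have uK: "u \<in> K" using n by simp
    then have "of_nat n * s u = of_nat n * t u"
      using nu by (simp add: st(4) s.hom_mult t.hom_mult s.hom_of_nat t.hom_of_nat K.of_nat_mem)
    then show "u \<in> W" using n uK by (simp add: st(4))
  qed
  then obtain \<theta> where \<theta>: "\<theta> \<in> K" "\<forall>V\<in>\<V>. \<theta> \<notin> V" by blast
  have "inj_on (\<lambda>s. s \<theta>) S" using \<theta> by (intro inj_onI) (auto simp: \<V>_def V_def)
  with \<theta>(1) show ?thesis by (rule that)
qed

lemma card_le_degree_root:
  assumes S: "S \<subseteq> \<G>" and \<theta>: "\<theta> \<in> K" "inj_on (\<lambda>s. s \<theta>) S"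
    and p: "p \<in> poly_over k" "p \<noteq> 0" "poly p \<theta> = 0"
  shows "card S \<le> Polynomial.degree p"
proof -
  have root: "poly p (s \<theta>) = 0" if s: "s \<in> S" for s
  proof -
    have sG: "s \<in> \<G>" using S s by blast
    have "poly p (s \<theta>) = s 0" using poly_gal_apply[OF sG p(1) \<theta>(1)] unfolding p(3) .
    then show ?thesis by (simp only: subfield_hom.hom_zero[OF gal_hom[OF sG]])
  qed
  have "card S = card ((\<lambda>s. s \<theta>) ` S)" using card_image[OF \<theta>(2)] by simp
  also have "\<dots> \<le> card {x. poly p x = 0}"
    by (rule card_mono[OF poly_roots_finite[OF p(2)]]) (use root in blast)
  also have "\<dots> \<le> Polynomial.degree p" by (rule card_poly_roots_bound[OF p(2)])
  finally show ?thesis .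
qed

lemma finite_gal: "finite \<G>"
proof -
  have "card S \<le> rat_degree K" if S: "finite S" "S \<subseteq> \<G>" for S
  proof -
    obtain \<theta> where \<theta>: "\<theta> \<in> K" "inj_on (\<lambda>s. s \<theta>) S" by (rule ex_primitive_element[OF S])
    obtain p where p: "p \<noteq> 0" "Polynomial.degree p \<le> rat_degree K" "\<forall>i. Polynomial.coeff p i \<in> \<int>" "poly p \<theta> = 0"
      by (rule K.ex_int_poly_root[OF \<theta>(1)])
    have "Polynomial.coeff p i \<in> k" for i
      using p(3)[rule_format, of i] by (cases rule: Ints_cases) (simp add: k.of_int_mem)
    then have "p \<in> poly_over k" by (simp add: poly_over_def)
    then show ?thesis using card_le_degree_root[OF S(2) \<theta> _ p(1,4)] p(2) by simp
  qed
  then show ?thesis by (meson finite_if_finite_subsets_card_bdd)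
qed

abbreviation "gal_order \<equiv> card \<G>"

lemma gal_order_pos: "gal_order > 0"
  using finite_gal G.one_closed by (auto simp: card_gt_0_iff)

lemma
  assumes "t \<in> \<G>" "x \<in> K"
  shows sum_reindex_gal: "(\<Sum>s\<in>\<G>. t (s x)) = (\<Sum>s\<in>\<G>. s x)"
    and prod_reindex_gal: "(\<Prod>s\<in>\<G>. t (s x)) = (\<Prod>s\<in>\<G>. s x)"
  using sum.reindex_bij_betw[OF gal_translate_bij[OF assms(1)], of "\<lambda>s. s x"]
    prod.reindex_bij_betw[OF gal_translate_bij[OF assms(1)], of "\<lambda>s. s x"] assms
  by (simp_all add: gal_mult_apply)

definition conj_poly :: "'a \<Rightarrow> 'a poly" where
  "conj_poly x = (\<Prod>s\<in>\<G>. [:- s x, 1:])"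

lemma degree_conj_poly: "Polynomial.degree (conj_poly x) = gal_order"
  unfolding conj_poly_def by (subst degree_prod_eq_sum_degree) (auto simp: finite_gal)

lemma conj_poly_over_base:
  assumes x: "x \<in> K"
  shows "conj_poly x \<in> poly_over k"
proof (rule poly_over_baseI)
  have K: "[:- s x, 1:] \<in> poly_over K" if "s \<in> \<G>" for s by (rule K.poly_over_linear[OF gal_mem[OF that x]])
  then show "conj_poly x \<in> poly_over K" unfolding conj_poly_def by (rule K.poly_over_prod)
  fix t assume t: "t \<in> \<G>"
  interpret t: subfield_hom K t by (rule gal_hom[OF t])
  have "map_poly t (conj_poly x) = (\<Prod>s\<in>\<G>. [:- t (s x), 1:])"
    unfolding conj_poly_def using K
    by (simp add: t.map_poly_hom_prod t.map_poly_hom_linear gal_mem[OF _ x] del: map_poly_pCons)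
  also have "\<dots> = (\<Prod>s\<in>\<G>. [:- (t \<star> s) x, 1:])" by (rule prod.cong[OF refl]) (simp add: gal_mult_apply t x)
  also have "\<dots> = conj_poly x"
    unfolding conj_poly_def by (rule prod.reindex_bij_betw[OF gal_translate_bij[OF t]])
  finally show "map_poly t (conj_poly x) = conj_poly x" .
qed

text \<open>Lagrange interpolation of the values \<open>s x\<close> at the points \<open>s \<theta>\<close> is Galois invariant.\<close>

definition lagrange_basis :: "'a \<Rightarrow> ('a \<Rightarrow> 'a) \<Rightarrow> 'a poly" where
  "lagrange_basis \<theta> s = (\<Prod>t\<in>\<G> - {s}. [:- t \<theta>, 1:])"

lemma lagrange_basis_over: "\<theta> \<in> K \<Longrightarrow> lagrange_basis \<theta> s \<in> poly_over K"
  unfolding lagrange_basis_def by (rule K.poly_over_prod, rule K.poly_over_linear) (simp add: gal_mem)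

lemma map_poly_lagrange_basis:
  assumes \<theta>: "\<theta> \<in> K" and u: "u \<in> \<G>" and s: "s \<in> \<G>"
  shows "map_poly u (lagrange_basis \<theta> s) = lagrange_basis \<theta> (u \<star> s)"
proof -
  interpret u: subfield_hom K u by (rule gal_hom[OF u])
  have bij: "bij_betw (\<lambda>t. u \<star> t) (\<G> - {s}) (\<G> - {u \<star> s})"
    using bij_betw_DiffI[OF gal_translate_bij[OF u], of "{s}" "{u \<star> s}"] s u by (simp add: bij_betw_def)
  have "map_poly u (lagrange_basis \<theta> s) = (\<Prod>t\<in>\<G> - {s}. map_poly u [:- t \<theta>, 1:])"
    unfolding lagrange_basis_def
    by (rule u.map_poly_hom_prod, rule K.poly_over_linear) (use gal_mem[OF _ \<theta>] in blast)
  also have "\<dots> = (\<Prod>t\<in>\<G> - {s}. [:- (u \<star> t) \<theta>, 1:])"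
  proof (rule prod.cong[OF refl])
    fix t assume t: "t \<in> \<G> - {s}"
    then show "map_poly u [:- t \<theta>, 1:] = [:- (u \<star> t) \<theta>, 1:]"
      using u.map_poly_hom_linear[OF gal_mem[of t, OF _ \<theta>]] gal_mult_apply[OF u, of t, OF _ \<theta>]
      by (simp del: map_poly_pCons)
  qed
  also have "\<dots> = lagrange_basis \<theta> (u \<star> s)"
    unfolding lagrange_basis_def by (rule prod.reindex_bij_betw[OF bij, of "\<lambda>t. [:- t \<theta>, 1:]"])
  finally show ?thesis .
qed

lemma degree_lagrange_basis_le:
  assumes "s \<in> \<G>"
  shows "Polynomial.degree (lagrange_basis \<theta> s) \<le> gal_order - 1"
  unfolding lagrange_basis_def using degree_prod_sum_le[of "\<G> - {s}" "\<lambda>t. [:- t \<theta>, 1:]"] finite_gal assms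
  by (simp add: o_def)

lemma poly_lagrange_basis_zero:
  assumes "\<theta> \<in> K" "s \<in> \<G>" "s \<noteq> \<one>\<^bsub>gal_group K k\<^esub>"
  shows "poly (lagrange_basis \<theta> s) \<theta> = 0"
  using assms finite_gal gal_one_apply[OF assms(1)]
  by (auto simp: lagrange_basis_def poly_prod intro!: bexI[of _ "\<one>\<^bsub>gal_group K k\<^esub>"])

lemma poly_lagrange_basis_one_nonzero:
  assumes \<theta>: "\<theta> \<in> K" "inj_on (\<lambda>s. s \<theta>) \<G>"
  shows "poly (lagrange_basis \<theta> \<one>\<^bsub>gal_group K k\<^esub>) \<theta> \<noteq> 0"
proof -
  let ?e = "\<one>\<^bsub>gal_group K k\<^esub>"
  have "\<theta> \<noteq> s \<theta>" if "s \<in> \<G> - {?e}" for s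
    using that inj_on_eq_iff[OF \<theta>(2), of s ?e] gal_one_apply[OF \<theta>(1)] by auto
  then show ?thesis using finite_gal by (auto simp: lagrange_basis_def poly_prod)
qed

definition lagrange_coeff :: "'a \<Rightarrow> 'a \<Rightarrow> ('a \<Rightarrow> 'a) \<Rightarrow> 'a" where
  "lagrange_coeff \<theta> x s = s x / poly (lagrange_basis \<theta> s) (s \<theta>)"

lemma lagrange_coeff_mem:
  assumes "\<theta> \<in> K" "x \<in> K" "s \<in> \<G>"
  shows "lagrange_coeff \<theta> x s \<in> K"
  unfolding lagrange_coeff_def
  by (rule K.divide_mem[OF gal_mem K.poly_mem[OF lagrange_basis_over gal_mem]]) (rule assms)+

lemma gal_lagrange_coeff:
  assumes \<theta>: "\<theta> \<in> K" and x: "x \<in> K" and u: "u \<in> \<G>" and s: "s \<in> \<G>"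
  shows "u (lagrange_coeff \<theta> x s) = lagrange_coeff \<theta> x (u \<star> s)"
proof -
  interpret u: subfield_hom K u by (rule gal_hom[OF u])
  let ?p = "poly (lagrange_basis \<theta> s) (s \<theta>)"
  have p: "?p \<in> K" by (rule K.poly_mem[OF lagrange_basis_over[OF \<theta>] gal_mem[OF s \<theta>]])
  have "u (lagrange_coeff \<theta> x s) = u (s x) / u ?p"
    using u.hom_mult[OF gal_mem[OF s x] K.inverse_mem[OF p]] u.hom_inverse[OF p]
    by (simp add: lagrange_coeff_def divide_inverse)
  also have "u ?p = poly (lagrange_basis \<theta> (u \<star> s)) ((u \<star> s) \<theta>)"
    unfolding gal_mult_apply[OF u s \<theta>] map_poly_lagrange_basis[OF \<theta> u s, symmetric]
    by (rule u.poly_map_poly_hom[OF lagrange_basis_over[OF \<theta>] gal_mem[OF s \<theta>], symmetric])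
  finally show ?thesis by (simp add: lagrange_coeff_def gal_mult_apply u s x)
qed

definition lagrange_poly :: "'a \<Rightarrow> 'a \<Rightarrow> 'a poly" where
  "lagrange_poly \<theta> x = (\<Sum>s\<in>\<G>. Polynomial.smult (lagrange_coeff \<theta> x s) (lagrange_basis \<theta> s))"

lemma lagrange_poly_over_base:
  assumes \<theta>: "\<theta> \<in> K" and x: "x \<in> K"
  shows "lagrange_poly \<theta> x \<in> poly_over k"
proof (rule poly_over_baseI)
  note mem = lagrange_coeff_mem[OF \<theta> x] lagrange_basis_over[OF \<theta>]
  show "lagrange_poly \<theta> x \<in> poly_over K"
    unfolding lagrange_poly_def by (intro K.poly_over_sum K.poly_over_smult mem)
  fix u assume u: "u \<in> \<G>"
  interpret u: subfield_hom K u by (rule gal_hom[OF u])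
  have "map_poly u (lagrange_poly \<theta> x) =
      (\<Sum>s\<in>\<G>. Polynomial.smult (lagrange_coeff \<theta> x (u \<star> s)) (lagrange_basis \<theta> (u \<star> s)))"
    unfolding lagrange_poly_def using map_poly_lagrange_basis[OF \<theta> u] gal_lagrange_coeff[OF \<theta> x u]
    by (simp add: u.map_poly_hom_sum u.map_poly_hom_smult K.poly_over_smult mem)
  also have "\<dots> = lagrange_poly \<theta> x"
    unfolding lagrange_poly_def by (rule sum.reindex_bij_betw[OF gal_translate_bij[OF u]])
  finally show "map_poly u (lagrange_poly \<theta> x) = lagrange_poly \<theta> x" .
qed

lemma poly_lagrange_poly:
  assumes \<theta>: "\<theta> \<in> K" "inj_on (\<lambda>s. s \<theta>) \<G>" and x: "x \<in> K"
  shows "poly (lagrange_poly \<theta> x) \<theta> = x"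
proof -
  let ?e = "\<one>\<^bsub>gal_group K k\<^esub>"
  have "poly (lagrange_poly \<theta> x) \<theta> = lagrange_coeff \<theta> x ?e * poly (lagrange_basis \<theta> ?e) \<theta>"
    unfolding lagrange_poly_def poly_sum using finite_gal poly_lagrange_basis_zero[OF \<theta>(1)]
    by (simp add: sum.remove[of _ ?e])
  then show ?thesis using poly_lagrange_basis_one_nonzero[OF \<theta>] by (simp add: lagrange_coeff_def gal_one_apply \<theta>(1) x)
qed

lemma base_interpolation:
  assumes \<theta>: "\<theta> \<in> K" "inj_on (\<lambda>s. s \<theta>) \<G>" and x: "x \<in> K"
  obtains q where "q \<in> poly_over k" "Polynomial.degree q < gal_order" "poly q \<theta> = x"
proof
  have "Polynomial.degree (lagrange_poly \<theta> x) \<le> gal_order - 1"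
    unfolding lagrange_poly_def
    by (rule degree_sum_le[OF finite_gal order_trans[OF degree_smult_le degree_lagrange_basis_le]])
  then show "Polynomial.degree (lagrange_poly \<theta> x) < gal_order" using gal_order_pos by linarith
qed (rule lagrange_poly_over_base[OF \<theta>(1) x], rule poly_lagrange_poly[OF \<theta> x])

lemma poly_base_root_imp_dvd:
  assumes \<theta>: "\<theta> \<in> K" "inj_on (\<lambda>s. s \<theta>) \<G>" and q: "q \<in> poly_over k" "poly q \<theta> = 0"
  shows "q = conj_poly \<theta> * (q div conj_poly \<theta>)"
proof -
  let ?f = "conj_poly \<theta>"
  have nonzero: "?f \<noteq> 0" using degree_conj_poly[of \<theta>] gal_order_pos by auto
  have "poly ?f \<theta> = 0"
    using finite_gal gal_one_apply[OF \<theta>(1)] by (auto simp: conj_poly_def poly_prod intro!: bexI[of _ "\<one>\<^bsub>gal_group K k\<^esub>"])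
  then have "poly (q mod ?f) \<theta> = 0"
    using q(2) by (metis add_0 mult_div_mod_eq mult_zero_left poly_add poly_mult)
  moreover have "q mod ?f \<in> poly_over k"
    using k.poly_over_div_mod[OF q(1) conj_poly_over_base[OF \<theta>(1)]] by blast
  ultimately have "q mod ?f = 0"
    using card_le_degree_root[OF order_refl \<theta>, of "q mod ?f"] degree_mod_less[OF nonzero, of q]
    unfolding degree_conj_poly by linarith
  then show ?thesis using mult_div_mod_eq[of ?f q] by simp
qed

lemma power_basis:
  assumes \<theta>: "\<theta> \<in> K" "inj_on (\<lambda>s. s \<theta>) \<G>" and x: "x \<in> K"
  obtains c where "\<forall>j<gal_order. c j \<in> k" "x = (\<Sum>j<gal_order. c j * \<theta> ^ j)"
proof -
  obtain q where q: "q \<in> poly_over k" "Polynomial.degree q < gal_order" "poly q \<theta> = x"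
    by (rule base_interpolation[OF assms])
  have "poly q \<theta> = (\<Sum>j<gal_order. Polynomial.coeff q j * \<theta> ^ j)"
    unfolding poly_altdef using q(2) by (intro sum.mono_neutral_left) (auto simp: coeff_eq_0)
  then show ?thesis using that[of "Polynomial.coeff q"] poly_overD[OF q(1)] q(3) by simp
qed

lemma powers_independent:
  assumes \<theta>: "\<theta> \<in> K" "inj_on (\<lambda>s. s \<theta>) \<G>"
    and c: "\<forall>j<gal_order. c j \<in> k" "\<exists>j<gal_order. c j \<noteq> 0"
  shows "(\<Sum>j<gal_order. c j * \<theta> ^ j) \<noteq> 0"
proof
  assume relation: "(\<Sum>j<gal_order. c j * \<theta> ^ j) = 0"
  define p where "p = (\<Sum>j<gal_order. monom (c j) j)"
  have coeff: "Polynomial.coeff p j = (if j < gal_order then c j else 0)" for j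
    by (simp add: p_def Polynomial.coeff_sum if_distrib sum.delta' cong: if_cong)
  obtain i where i: "i < gal_order" "c i \<noteq> 0" using c(2) by blast
  then have p: "p \<noteq> 0" using coeff[of i] by auto
  have "p \<in> poly_over k" unfolding p_def using c(1) by (intro k.poly_over_sum k.poly_over_monom) auto
  moreover have "poly p \<theta> = 0" using relation by (simp add: p_def poly_sum poly_monom)
  ultimately have "gal_order \<le> Polynomial.degree p" by (rule card_le_degree_root[OF order_refl \<theta> _ p])
  moreover have "Polynomial.degree p < gal_order" using i by (intro degree_lessI) (auto simp: coeff)
  ultimately show False by simp
qed

lemma base_dependent:
  assumes x: "\<And>i. i \<le> gal_order \<Longrightarrow> x i \<in> K"
  obtains c where "\<forall>i\<le>gal_order. c i \<in> k" "\<exists>i\<le>gal_order. c i \<noteq> 0" "(\<Sum>i\<le>gal_order. c i * x i) = 0"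
proof -
  obtain \<theta> where \<theta>: "\<theta> \<in> K" "inj_on (\<lambda>s. s \<theta>) \<G>" by (rule ex_primitive_element[OF finite_gal order_refl])
  have "\<forall>i\<in>{..gal_order}. \<exists>a. (\<forall>j<gal_order. a j \<in> k) \<and> x i = (\<Sum>j<gal_order. a j * \<theta> ^ j)"
    using power_basis[OF \<theta>] x by (metis atMost_iff)
  then obtain a where a: "\<forall>i\<in>{..gal_order}. (\<forall>j<gal_order. a i j \<in> k) \<and> x i = (\<Sum>j<gal_order. a i j * \<theta> ^ j)"
    by (rule bchoice[THEN exE])
  have "\<exists>c. (\<forall>i\<in>{..gal_order}. c i \<in> k) \<and> (\<exists>i\<in>{..gal_order}. c i \<noteq> 0) \<and>
      (\<forall>j\<in>{..<gal_order}. (\<Sum>i\<in>{..gal_order}. a i j * c i) = 0)"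
    by (rule k.homogeneous_system_solution) (use a in auto)
  then obtain c where c: "\<forall>i\<le>gal_order. c i \<in> k" "\<exists>i\<le>gal_order. c i \<noteq> 0"
    "\<forall>j<gal_order. (\<Sum>i\<le>gal_order. a i j * c i) = 0" by auto
  have "(\<Sum>i\<le>gal_order. c i * x i) = (\<Sum>i\<le>gal_order. \<Sum>j<gal_order. a i j * c i * \<theta> ^ j)"
    using a by (intro sum.cong refl) (simp add: sum_distrib_left mult_ac)
  also have "\<dots> = (\<Sum>j<gal_order. (\<Sum>i\<le>gal_order. a i j * c i) * \<theta> ^ j)"
    unfolding sum_distrib_right by (rule sum.swap)
  also have "\<dots> = 0" using c(3) by simp
  finally show ?thesis by (rule that[OF c(1,2)])
qed

end

section \<open>Trace and norm of elements\<close>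

context galois_extension
begin

definition trace :: "'a \<Rightarrow> 'a" where "trace x = (\<Sum>s\<in>\<G>. s x)"

lemma trace_mem: "x \<in> K \<Longrightarrow> trace x \<in> k"
proof (rule fixed_mem)
  assume x: "x \<in> K"
  show "trace x \<in> K" unfolding trace_def by (rule K.sum_mem) (rule gal_mem[OF _ x])
  fix t assume t: "t \<in> \<G>"
  interpret t: subfield_hom K t by (rule gal_hom[OF t])
  show "t (trace x) = trace x" using sum_reindex_gal[OF t x] by (simp add: trace_def t.hom_sum gal_mem[OF _ x])
qed

lemma trace_add: "x \<in> K \<Longrightarrow> y \<in> K \<Longrightarrow> trace (x + y) = trace x + trace y"
  unfolding trace_def sum.distrib[symmetric] by (intro sum.cong refl subfield_hom.hom_add[OF gal_hom])

lemma trace_diff: "x \<in> K \<Longrightarrow> y \<in> K \<Longrightarrow> trace (x - y) = trace x - trace y"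
  unfolding trace_def sum_subtractf[symmetric] by (intro sum.cong refl subfield_hom.hom_diff[OF gal_hom])

lemma trace_scale: "a \<in> k \<Longrightarrow> x \<in> K \<Longrightarrow> trace (a * x) = a * trace x"
  unfolding trace_def sum_distrib_left
  by (rule sum.cong[OF refl]) (metis subfield_hom.hom_mult[OF gal_hom] base_mem gal_fixes_base)

lemma trace_of_nat: "trace (of_nat m) = of_nat m * of_nat gal_order"
proof -
  have "trace (of_nat m) = (\<Sum>s\<in>\<G>. of_nat m)"
    unfolding trace_def by (intro sum.cong refl subfield_hom.hom_of_nat[OF gal_hom])
  then show ?thesis by (simp add: mult.commute)
qed

lemma trace_zero: "trace 0 = 0"
  using trace_of_nat[of 0] by simp

lemma trace_sum: "(\<And>i. i \<in> I \<Longrightarrow> f i \<in> K) \<Longrightarrow> trace (sum f I) = (\<Sum>i\<in>I. trace (f i))"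
  by (induction I rule: infinite_finite_induct) (auto simp: trace_zero trace_add K.sum_mem)

lemma elem_norm_mem: "x \<in> K \<Longrightarrow> elem_norm K k x \<in> k"
proof (rule fixed_mem)
  assume x: "x \<in> K"
  show "elem_norm K k x \<in> K" unfolding elem_norm_def by (rule K.prod_mem) (rule gal_mem[OF _ x])
  fix t assume t: "t \<in> \<G>"
  interpret t: subfield_hom K t by (rule gal_hom[OF t])
  show "t (elem_norm K k x) = elem_norm K k x"
    using prod_reindex_gal[OF t x] by (simp add: elem_norm_def t.hom_prod gal_mem[OF _ x])
qed

lemma elem_norm_nonzero: "x \<in> K \<Longrightarrow> x \<noteq> 0 \<Longrightarrow> elem_norm K k x \<noteq> 0"
  using finite_gal subfield_hom.hom_nonzero[OF gal_hom] by (simp add: elem_norm_def prod_zero_iff)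

lemma elem_norm_one: "elem_norm K k 1 = 1"
proof -
  have "elem_norm K k 1 = (\<Prod>s\<in>\<G>. 1)"
    unfolding elem_norm_def by (rule prod.cong[OF refl subfield_hom.hom_one[OF gal_hom]])
  then show ?thesis by simp
qed

lemma elem_norm_mult: "x \<in> K \<Longrightarrow> y \<in> K \<Longrightarrow> elem_norm K k (x * y) = elem_norm K k x * elem_norm K k y"
  unfolding elem_norm_def prod.distrib[symmetric] by (intro prod.cong refl subfield_hom.hom_mult[OF gal_hom])

lemma ex_trace_annihilator:
  assumes m: "m < gal_order" and x: "\<forall>i<m. x i \<in> K"
  obtains c where "c \<in> K" "c \<noteq> 0" "\<forall>i<m. trace (c * x i) = 0"
proof -
  obtain \<theta> where \<theta>: "\<theta> \<in> K" "inj_on (\<lambda>s. s \<theta>) \<G>" by (rule ex_primitive_element[OF finite_gal order_refl])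
  have \<theta>x: "\<theta> ^ j * x i \<in> K" if "i < m" for i j using x \<theta>(1) that by (simp add: K.mult_mem K.power_mem)
  have "\<exists>e. (\<forall>j\<in>{..<gal_order}. e j \<in> k) \<and> (\<exists>j\<in>{..<gal_order}. e j \<noteq> 0) \<and>
      (\<forall>i\<in>{..<m}. (\<Sum>j\<in>{..<gal_order}. trace (\<theta> ^ j * x i) * e j) = 0)"
    by (rule k.homogeneous_system_solution) (use m \<theta>x in \<open>auto intro!: trace_mem\<close>)
  then obtain e where e: "\<forall>j<gal_order. e j \<in> k" "\<exists>j<gal_order. e j \<noteq> 0"
    "\<forall>i<m. (\<Sum>j<gal_order. trace (\<theta> ^ j * x i) * e j) = 0" by auto
  define c where "c = (\<Sum>j<gal_order. e j * \<theta> ^ j)"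
  have "trace (c * x i) = 0" if i: "i < m" for i
  proof -
    have "trace (c * x i) = trace (\<Sum>j<gal_order. e j * (\<theta> ^ j * x i))"
      by (simp add: c_def sum_distrib_right mult.assoc)
    also have "\<dots> = (\<Sum>j<gal_order. trace (e j * (\<theta> ^ j * x i)))"
      by (rule trace_sum, rule K.mult_mem[OF base_mem]) (use e(1) \<theta>x[OF i] in auto)
    also have "\<dots> = (\<Sum>j<gal_order. trace (\<theta> ^ j * x i) * e j)"
      by (rule sum.cong[OF refl]) (use e(1) \<theta>x[OF i] in \<open>auto simp: trace_scale mult.commute\<close>)
    also have "\<dots> = 0" using e(3) i by blast
    finally show ?thesis .
  qed
  moreover have "c \<in> K" unfolding c_def
    by (rule K.sum_mem, rule K.mult_mem[OF base_mem K.power_mem]) (use e(1) \<theta>(1) in auto)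
  moreover have "c \<noteq> 0" unfolding c_def by (rule powers_independent[OF \<theta> e(1,2)])
  ultimately show ?thesis using that by blast
qed

end

section \<open>Norms of totally positive elements\<close>

lemma (in subfield_set) ring_hom_iff_subfield_hom:
  fixes h :: "'a \<Rightarrow> 'b::field_char_0"
  shows "h \<in> Ring.ring_hom (ring_on F) (ring_of_type_algebra :: 'b ring) \<longleftrightarrow> subfield_hom F h"
proof
  assume "h \<in> Ring.ring_hom (ring_on F) (ring_of_type_algebra :: 'b ring)"
  then show "subfield_hom F h" by unfold_locales (auto simp: Ring.ring_hom_def)
next
  assume "subfield_hom F h"
  then interpret subfield_hom F h .
  show "h \<in> Ring.ring_hom (ring_on F) (ring_of_type_algebra :: 'b ring)"
    by (auto simp: Ring.ring_hom_def hom_add hom_mult hom_one)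
qed

lemma (in subfield_set) tot_pos_iff:
  "x \<in> tot_pos F \<longleftrightarrow> x \<in> F \<and> x \<noteq> 0 \<and> (\<forall>h::'a \<Rightarrow> real. subfield_hom F h \<longrightarrow> h x > 0)"
  by (auto simp: tot_pos_def ring_hom_iff_subfield_hom)

lemma (in subfield_set) tot_pos_subset: "x \<in> tot_pos F \<Longrightarrow> x \<in> F"
  and tot_pos_nonzero: "x \<in> tot_pos F \<Longrightarrow> x \<noteq> 0"
  by (simp_all add: tot_pos_iff)

lemma prod_involution_cnj_pos:
  fixes f :: "'b \<Rightarrow> complex"
  assumes "finite S" "\<And>x. x \<in> S \<Longrightarrow> j x \<in> S" "\<And>x. x \<in> S \<Longrightarrow> j (j x) = x"
    and "\<And>x. x \<in> S \<Longrightarrow> f (j x) = cnj (f x)" "\<And>x. x \<in> S \<Longrightarrow> f x \<noteq> 0"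
    and "\<And>x. x \<in> S \<Longrightarrow> j x = x \<Longrightarrow> Re (f x) > 0"
  shows "\<exists>r>0. (\<Prod>x\<in>S. f x) = of_real r"
  using assms
proof (induction "card S" arbitrary: S rule: less_induct)
  case less
  show ?case
  proof (cases "S = {}")
    case True
    then show ?thesis by (intro exI[of _ 1]) simp
  next
    case False
    then obtain x where x: "x \<in> S" by blast
    define Y where "Y = S - {x, j x}"
    have "card Y < card S" unfolding Y_def using less.prems(1) x by (intro psubset_card_mono) auto
    moreover have "j y \<in> Y" if "y \<in> Y" for y
      using that less.prems(2,3) x unfolding Y_def by (metis DiffD1 DiffD2 DiffI insertE insertI1 insertI2 singletonD)
    ultimately obtain r where r: "r > 0" "(\<Prod>x\<in>Y. f x) = of_real r"
      using less.hyps[of Y] less.prems by (force simp: Y_def)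
    show ?thesis
    proof (cases "j x = x")
      case True
      have "f x = of_real (Re (f x))"
        using less.prems(4)[OF x] True by (simp add: complex_eq_iff)
      moreover have "(\<Prod>x\<in>S. f x) = f x * (\<Prod>x\<in>Y. f x)"
        using less.prems(1) x True by (simp add: Y_def prod.remove)
      ultimately have "(\<Prod>x\<in>S. f x) = of_real (Re (f x) * r)" using r(2) by (metis of_real_mult)
      then show ?thesis using less.prems(6)[OF x True] r(1) by (intro exI[of _ "Re (f x) * r"]) simp
    next
      case False
      have "(\<Prod>x\<in>S. f x) = f x * (f (j x) * (\<Prod>x\<in>Y. f x))"
        using less.prems(1) x False less.prems(2)[OF x]
        by (simp add: Y_def prod.remove[of S x] prod.remove[of "S - {x}" "j x"] Diff_insert2[symmetric] insert_commute)
      also have "\<dots> = of_real ((cmod (f x))\<^sup>2 * r)"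
        using less.prems(4)[OF x] r(2) by (simp only: of_real_mult complex_norm_square mult.assoc)
      finally show ?thesis
        using less.prems(5)[OF x] r(1) by (intro exI[of _ "(cmod (f x))\<^sup>2 * r"]) simp
    qed
  qed
qed

context galois_extension
begin

text \<open>
  Every \<open>x \<in> K\<close> is \<open>q(\<theta>)\<close> for a polynomial \<open>q\<close> over \<open>k\<close>, and \<open>x \<mapsto> (\<tau> q)(z)\<close> does not depend on the
  choice of \<open>q\<close>.
\<close>

lemma extend_embedding:
  fixes \<tau> :: "'a \<Rightarrow> 'b::field_char_0"
  assumes \<tau>: "subfield_hom k \<tau>" and \<theta>: "\<theta> \<in> K" "inj_on (\<lambda>s. s \<theta>) \<G>"
    and z: "poly (map_poly \<tau> (conj_poly \<theta>)) z = 0"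
  obtains \<rho> where "subfield_hom K \<rho>" "\<forall>a\<in>k. \<rho> a = \<tau> a"
proof -
  interpret \<tau>: subfield_hom k \<tau> by (rule \<tau>)
  have "\<forall>x\<in>K. \<exists>q. q \<in> poly_over k \<and> poly q \<theta> = x" using base_interpolation[OF \<theta>] by metis
  then obtain Q where Q: "\<forall>x\<in>K. Q x \<in> poly_over k \<and> poly (Q x) \<theta> = x" by (rule bchoice[THEN exE])
  define \<rho> where "\<rho> = (\<lambda>x. poly (map_poly \<tau> (Q x)) z)"
  have indep: "poly (map_poly \<tau> p) z = poly (map_poly \<tau> q) z"
    if pq: "p \<in> poly_over k" "q \<in> poly_over k" "poly p \<theta> = poly q \<theta>" for p q
  proof -
    have d: "p - q \<in> poly_over k" "poly (p - q) \<theta> = 0" using pq by (simp_all add: k.poly_over_diff)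
    have "map_poly \<tau> (p - q) = map_poly \<tau> (conj_poly \<theta>) * map_poly \<tau> ((p - q) div conj_poly \<theta>)"
      by (subst poly_base_root_imp_dvd[OF \<theta> d], rule \<tau>.map_poly_hom_mult)
         (use k.poly_over_div_mod d(1) conj_poly_over_base[OF \<theta>(1)] in blast)+
    then have "poly (map_poly \<tau> (p - q)) z = 0" using z by simp
    moreover have "map_poly \<tau> p = map_poly \<tau> (p - q) + map_poly \<tau> q"
      using \<tau>.map_poly_hom_add[OF d(1) pq(2)] by simp
    ultimately show ?thesis by simp
  qed
  have \<rho>: "\<rho> x = poly (map_poly \<tau> q) z" if "q \<in> poly_over k" "poly q \<theta> = x" "x \<in> K" for q x
    unfolding \<rho>_def using Q that by (intro indep) auto
  have const: "\<rho> a = \<tau> a" if a: "a \<in> k" for a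
    using \<rho>[OF k.poly_over_monom[OF a, of 0]] a base_mem
    by (simp add: poly_monom map_poly_monom \<tau>.hom_zero)
  have "subfield_hom K \<rho>"
  proof
    show "\<rho> 1 = 1" using const[OF k.one_mem] \<tau>.hom_one by simp
    fix x y assume xy: "x \<in> K" "y \<in> K"
    then have Qxy: "Q x \<in> poly_over k" "Q y \<in> poly_over k" "poly (Q x) \<theta> = x" "poly (Q y) \<theta> = y" using Q by auto
    show "\<rho> (x + y) = \<rho> x + \<rho> y"
      using \<rho>[OF k.poly_over_add[OF Qxy(1,2)] _ K.add_mem[OF xy]] Qxy
      by (simp add: \<rho>_def \<tau>.map_poly_hom_add)
    show "\<rho> (x * y) = \<rho> x * \<rho> y"
      using \<rho>[OF k.poly_over_mult[OF Qxy(1,2)] _ K.mult_mem[OF xy]] Qxy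
      by (simp add: \<rho>_def \<tau>.map_poly_hom_mult)
  qed
  then show ?thesis using const by (intro that) auto
qed

lemma conjugate_embeddings:
  fixes \<rho> \<rho>' :: "'a \<Rightarrow> 'b::field_char_0"
  assumes \<rho>: "subfield_hom K \<rho>" and \<rho>': "subfield_hom K \<rho>'" and eq: "\<And>a. a \<in> k \<Longrightarrow> \<rho>' a = \<rho> a"
  obtains s where "s \<in> \<G>" "\<forall>x\<in>K. \<rho>' x = \<rho> (s x)"
proof -
  interpret \<rho>: subfield_hom K \<rho> by (rule \<rho>)
  interpret \<rho>': subfield_hom K \<rho>' by (rule \<rho>')
  obtain \<theta> where \<theta>: "\<theta> \<in> K" "inj_on (\<lambda>s. s \<theta>) \<G>" by (rule ex_primitive_element[OF finite_gal order_refl])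
  let ?f = "conj_poly \<theta>"
  note f = conj_poly_over_base[OF \<theta>(1)]
  have map_eq: "map_poly \<rho>' q = map_poly \<rho> q" if "q \<in> poly_over k" for q
    using that eq by (rule map_poly_cong_poly_over)
  have "poly ?f \<theta> = 0"
    using finite_gal gal_one_apply[OF \<theta>(1)] by (auto simp: conj_poly_def poly_prod intro!: bexI[of _ "\<one>\<^bsub>gal_group K k\<^esub>"])
  then have "poly (map_poly \<rho> ?f) (\<rho>' \<theta>) = 0"
    using \<rho>'.poly_map_poly_hom[OF subsetD[OF poly_over_base f] \<theta>(1)] map_eq[OF f] \<rho>'.hom_zero by simp
  moreover have "map_poly \<rho> ?f = (\<Prod>s\<in>\<G>. [:- \<rho> (s \<theta>), 1:])"
    unfolding conj_poly_def
    by (subst \<rho>.map_poly_hom_prod)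
       (simp_all add: K.poly_over_linear gal_mem[OF _ \<theta>(1)] \<rho>.map_poly_hom_linear del: map_poly_pCons)
  ultimately obtain s where s: "s \<in> \<G>" "\<rho>' \<theta> = \<rho> (s \<theta>)" using finite_gal by (auto simp: poly_prod)
  have "\<rho>' x = \<rho> (s x)" if x: "x \<in> K" for x
  proof -
    obtain q where q: "q \<in> poly_over k" "Polynomial.degree q < gal_order" "poly q \<theta> = x"
      by (rule base_interpolation[OF \<theta> x])
    note q_over_K = subsetD[OF poly_over_base q(1)]
    have "\<rho>' x = poly (map_poly \<rho> q) (\<rho> (s \<theta>))"
      using \<rho>'.poly_map_poly_hom[OF q_over_K \<theta>(1)] map_eq[OF q(1)] s(2) q(3) by simp
    also have "\<dots> = \<rho> (s x)"
      using \<rho>.poly_map_poly_hom[OF q_over_K gal_mem[OF s(1) \<theta>(1)]] poly_gal_apply[OF s(1) q(1) \<theta>(1)] q(3) by simp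
    finally show ?thesis .
  qed
  with s(1) show ?thesis by (intro that) auto
qed

lemma real_embedding_extension:
  fixes \<tau> :: "'a \<Rightarrow> real"
  assumes \<tau>: "subfield_hom k \<tau>"
  obtains \<rho> :: "'a \<Rightarrow> complex" and j
  where "subfield_hom K \<rho>" "\<forall>a\<in>k. \<rho> a = of_real (\<tau> a)" "j \<in> \<G>" "\<forall>x\<in>K. \<rho> (j x) = cnj (\<rho> x)"
proof -
  interpret \<tau>: subfield_hom k \<tau> by (rule \<tau>)
  let ?\<tau> = "\<lambda>x. complex_of_real (\<tau> x)"
  have \<tau>c: "subfield_hom k ?\<tau>" by unfold_locales (simp_all add: \<tau>.hom_add \<tau>.hom_mult \<tau>.hom_one)
  then interpret \<tau>c: subfield_hom k ?\<tau> .
  obtain \<theta> where \<theta>: "\<theta> \<in> K" "inj_on (\<lambda>s. s \<theta>) \<G>" by (rule ex_primitive_element[OF finite_gal order_refl])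
  have "lead_coeff (conj_poly \<theta>) = 1" by (simp add: conj_poly_def lead_coeff_prod)
  then have "Polynomial.coeff (map_poly ?\<tau> (conj_poly \<theta>)) gal_order \<noteq> 0"
    by (simp add: \<tau>c.coeff_map_poly_hom degree_conj_poly \<tau>c.hom_one)
  then have "Polynomial.degree (map_poly ?\<tau> (conj_poly \<theta>)) > 0"
    using le_degree[of _ gal_order] gal_order_pos by fastforce
  then obtain z where z: "poly (map_poly ?\<tau> (conj_poly \<theta>)) z = 0"
    using fundamental_theorem_of_algebra constant_degree by (metis less_irrefl)
  obtain \<rho> where \<rho>: "subfield_hom K \<rho>" "\<forall>a\<in>k. \<rho> a = ?\<tau> a" by (rule extend_embedding[OF \<tau>c \<theta> z])
  interpret \<rho>: subfield_hom K \<rho> by (rule \<rho>(1))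
  have "subfield_hom K (\<lambda>x. cnj (\<rho> x))"
    by unfold_locales (simp_all add: \<rho>.hom_add \<rho>.hom_mult \<rho>.hom_one)
  moreover have "cnj (\<rho> a) = \<rho> a" if "a \<in> k" for a using \<rho>(2) that by simp
  ultimately obtain j where "j \<in> \<G>" "\<forall>x\<in>K. cnj (\<rho> x) = \<rho> (j x)"
    by (rule conjugate_embeddings[OF \<rho>(1)])
  then show ?thesis using that[OF \<rho>] by simp
qed

lemma gal_tot_pos:
  assumes s: "s \<in> \<G>" and y: "y \<in> tot_pos K"
  shows "s y \<in> tot_pos K"
  unfolding K.tot_pos_iff
proof (intro conjI allI impI)
  note yK = K.tot_pos_subset[OF y] K.tot_pos_nonzero[OF y]
  show "s y \<in> K" "s y \<noteq> 0" using gal_mem[OF s yK(1)] subfield_hom.hom_nonzero[OF gal_hom[OF s] yK] by auto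
  fix h :: "'a \<Rightarrow> real" assume "subfield_hom K h"
  then have "subfield_hom K (\<lambda>x. h (s x))" by (rule subfield_hom.hom_comp[OF gal_hom[OF s]]) (rule gal_mem[OF s])
  then show "h (s y) > 0" using y unfolding K.tot_pos_iff by blast
qed

lemma tot_pos_real_embedding:
  fixes \<rho> :: "'a \<Rightarrow> complex"
  assumes \<rho>: "subfield_hom K \<rho>" and real: "\<And>x. x \<in> K \<Longrightarrow> cnj (\<rho> x) = \<rho> x" and y: "y \<in> tot_pos K"
  shows "Re (\<rho> y) > 0"
proof -
  interpret \<rho>: subfield_hom K \<rho> by (rule \<rho>)
  have Im: "Im (\<rho> x) = 0" if "x \<in> K" for x using real[OF that] by (simp add: complex_eq_iff)
  have "subfield_hom K (\<lambda>x. Re (\<rho> x))"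
    by unfold_locales (simp_all add: \<rho>.hom_add \<rho>.hom_mult \<rho>.hom_one Im)
  then show ?thesis using y unfolding K.tot_pos_iff by blast
qed

lemma complex_conjugation_involution:
  fixes \<rho> :: "'a \<Rightarrow> complex"
  assumes \<rho>: "subfield_hom K \<rho>" and j: "j \<in> \<G>" "\<forall>x\<in>K. \<rho> (j x) = cnj (\<rho> x)"
  shows "j \<star> j = \<one>\<^bsub>gal_group K k\<^esub>"
proof (rule gal_ext)
  interpret \<rho>: subfield_hom K \<rho> by (rule \<rho>)
  fix x assume x: "x \<in> K"
  then have "\<rho> (j (j x)) = \<rho> x" using j gal_mem[OF j(1)] by simp
  then have "j (j x) = x" using inj_onD[OF \<rho>.hom_inj] x gal_mem[OF j(1)] by blast
  then show "(j \<star> j) x = \<one>\<^bsub>gal_group K k\<^esub> x" by (simp add: gal_mult_apply j(1) gal_one_apply x)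
qed (use j(1) in auto)

lemma elem_norm_tot_pos:
  assumes y: "y \<in> tot_pos K"
  shows "elem_norm K k y \<in> tot_pos k"
  unfolding k.tot_pos_iff
proof (intro conjI allI impI)
  note yK = K.tot_pos_subset[OF y] K.tot_pos_nonzero[OF y]
  show "elem_norm K k y \<in> k" "elem_norm K k y \<noteq> 0" by (simp_all add: elem_norm_mem elem_norm_nonzero yK)
  fix \<tau> :: "'a \<Rightarrow> real" assume \<tau>: "subfield_hom k \<tau>"
  obtain \<rho> :: "'a \<Rightarrow> complex" and j where \<rho>: "subfield_hom K \<rho>" "\<forall>a\<in>k. \<rho> a = of_real (\<tau> a)"
    and j: "j \<in> \<G>" "\<forall>x\<in>K. \<rho> (j x) = cnj (\<rho> x)"
    by (rule real_embedding_extension[OF \<tau>])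
  interpret \<rho>: subfield_hom K \<rho> by (rule \<rho>(1))
  have "\<exists>r>0. (\<Prod>s\<in>\<G>. \<rho> (s y)) = of_real r"
  proof (rule prod_involution_cnj_pos[OF finite_gal, of "\<lambda>s. j \<star> s"])
    fix s assume s: "s \<in> \<G>"
    note syK = gal_mem[OF s yK(1)]
    show "j \<star> s \<in> \<G>" using j(1) s by simp
    show "j \<star> (j \<star> s) = s"
      using j(1) s complex_conjugation_involution[OF \<rho>(1) j] by (simp add: G.m_assoc[symmetric])
    show "\<rho> ((j \<star> s) y) = cnj (\<rho> (s y))" using j s syK yK(1) by (simp add: gal_mult_apply)
    show "\<rho> (s y) \<noteq> 0" using \<rho>.hom_nonzero[OF syK] subfield_hom.hom_nonzero[OF gal_hom[OF s] yK] by simp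
    assume "j \<star> s = s"
    then have "j = \<one>\<^bsub>gal_group K k\<^esub>" using j(1) s by simp
    then have "cnj (\<rho> x) = \<rho> x" if "x \<in> K" for x using j(2) that by (simp add: gal_one_apply)
    then show "Re (\<rho> (s y)) > 0" using tot_pos_real_embedding[OF \<rho>(1)] gal_tot_pos[OF s y] by blast
  qed
  then obtain r where r: "r > 0" "(\<Prod>s\<in>\<G>. \<rho> (s y)) = of_real r" by blast
  have "of_real (\<tau> (elem_norm K k y)) = \<rho> (elem_norm K k y)" using \<rho>(2) elem_norm_mem[OF yK(1)] by simp
  also have "\<dots> = (\<Prod>s\<in>\<G>. \<rho> (s y))"
    unfolding elem_norm_def by (rule \<rho>.hom_prod) (rule gal_mem[OF _ yK(1)])
  finally show "\<tau> (elem_norm K k y) > 0" using r by simp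
qed

end

section \<open>Galois action on ideals\<close>

lemma val_hom:
  assumes F: "number_field_set F" and E: "number_field_set E"
    and h: "h \<in> hom (frac_group F) (frac_group E)" and A: "A \<in> frac_ideals F"
    and other: "\<And>R. R \<in> primes_of F \<Longrightarrow> R \<noteq> P \<Longrightarrow> ideal_val E (h R) Q = 0"
  shows "ideal_val E (h A) Q = ideal_val F A P * ideal_val E (h P) Q"
proof -
  interpret F: number_field_set F by (rule F)
  interpret E: number_field_set E by (rule E)
  interpret I: comm_group "frac_group F" by (rule F.comm_group_frac)
  let ?e = "F.val A"
  note fin = F.val_finite[OF A]
  have prime: "R \<in> primes_of F" if "?e R \<noteq> 0" for R using F.val_nonzero_prime[OF A that] .
  have hR_frac: "h R \<in> frac_ideals E" if "?e R \<noteq> 0" for R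
    using h F.prime_frac[OF prime[OF that]] by (auto simp: hom_def)
  have "h A = h (F.ideal_of ?e)" by (simp only: F.ideal_of_val[OF A])
  also have "\<dots> = pow_prod (frac_group E) h ?e"
    by (rule I.hom_pow_prod[OF E.comm_group_frac h fin]) (simp add: F.prime_frac prime)
  finally have "E.val (h A) Q = (\<Sum>R | ?e R \<noteq> 0. ?e R * E.val (h R) Q)"
    using E.val_pow_prod[OF fin, of h Q] hR_frac by simp
  also have "\<dots> = (\<Sum>R | ?e R \<noteq> 0. if R = P then ?e R * E.val (h R) Q else 0)"
    by (rule sum.cong[OF refl]) (use other prime in auto)
  also have "\<dots> = ?e P * E.val (h P) Q" using fin by (simp add: sum.delta)
  finally show ?thesis .
qed

context galois_extension
begin

abbreviation "OK \<equiv> ints_of K"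
abbreviation "Ok \<equiv> ints_of k"

lemma ints_base_iff: "x \<in> Ok \<longleftrightarrow> x \<in> OK \<and> x \<in> k"
  using base_mem by (auto simp: ints_of_def)

lemma gal_ints: "s \<in> \<G> \<Longrightarrow> x \<in> OK \<Longrightarrow> s x \<in> OK"
  using subfield_hom.hom_algebraic_int[OF gal_hom, of s x] gal_mem[of s x] by (simp add: ints_of_def)

lemma gal_image_ints:
  assumes s: "s \<in> \<G>"
  shows "s ` OK = OK"
proof -
  have "x \<in> s ` OK" if "x \<in> OK" for x
    using gal_apply_inv[OF s K.ints_subset[OF that]] gal_ints[OF G.inv_closed[OF s] that]
    by (metis image_eqI)
  then show ?thesis using gal_ints[OF s] by blast
qed

lemma gal_image_comp: "s \<in> \<G> \<Longrightarrow> t \<in> \<G> \<Longrightarrow> A \<subseteq> K \<Longrightarrow> s ` (t ` A) = (s \<star> t) ` A"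
  unfolding image_image by (rule image_cong[OF refl]) (simp add: gal_mult_apply subsetD)

lemma gal_image_one: "A \<subseteq> K \<Longrightarrow> \<one>\<^bsub>gal_group K k\<^esub> ` A = A"
  using gal_one_apply by (force simp: subset_iff image_def)

lemma gal_image_inv: "s \<in> \<G> \<Longrightarrow> A \<subseteq> K \<Longrightarrow> ginv s ` (s ` A) = A"
  using gal_image_comp[of "ginv s" s A] gal_image_one[of A] by simp

lemma gal_inv_image: "s \<in> \<G> \<Longrightarrow> A \<subseteq> K \<Longrightarrow> s ` (ginv s ` A) = A"
  using gal_image_comp[of s "ginv s" A] gal_image_one[of A] by simp

lemma gal_image_eq_iff: "s \<in> \<G> \<Longrightarrow> A \<subseteq> K \<Longrightarrow> B \<subseteq> K \<Longrightarrow> s ` A = s ` B \<longleftrightarrow> A = B"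
  using gal_image_inv[of s A] gal_image_inv[of s B] by metis

lemma gal_image_ideal_mult:
  assumes s: "s \<in> \<G>" and AB: "A \<subseteq> K" "B \<subseteq> K"
  shows "s ` ideal_mult A B = ideal_mult (s ` A) (s ` B)"
proof
  interpret s: subfield_hom K s by (rule gal_hom[OF s])
  have hom: "a \<in> K" "b \<in> K" "s (a * b) = s a * s b" if "a \<in> A" "b \<in> B" for a b
    using that AB s.hom_mult by blast+
  show "s ` ideal_mult A B \<subseteq> ideal_mult (s ` A) (s ` B)"
  proof (rule image_subsetI)
    fix x assume "x \<in> ideal_mult A B"
    then have "x \<in> K \<and> s x \<in> ideal_mult (s ` A) (s ` B)"
      by (induction rule: ideal_mult_induct)
         (auto simp: hom s.hom_zero s.hom_add K.zero_mem K.add_mem K.mult_mem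
            ideal_mult_zero ideal_mult_add intro: ideal_mult_memI)
    then show "s x \<in> ideal_mult (s ` A) (s ` B)" ..
  qed
  show "ideal_mult (s ` A) (s ` B) \<subseteq> s ` ideal_mult A B"
  proof
    fix y assume "y \<in> ideal_mult (s ` A) (s ` B)"
    then show "y \<in> s ` ideal_mult A B"
    proof (induction rule: ideal_mult_induct)
      case zero
      show ?case using s.hom_zero ideal_mult_zero by (metis image_eqI)
    next
      case (add x y)
      then obtain u v where uv: "u \<in> ideal_mult A B" "v \<in> ideal_mult A B" "x = s u" "y = s v" by blast
      then have "s (u + v) = x + y" using K.ideal_mult_subset[OF AB] by (simp add: s.hom_add subsetD)
      then show ?case using ideal_mult_add[OF uv(1,2)] by (metis image_eqI)
    next
      case (mult x y)
      then obtain a b where ab: "a \<in> A" "b \<in> B" "x = s a" "y = s b" by blast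
      then have "x * y = s (a * b)" by (simp add: hom(3))
      then show ?case using ideal_mult_memI[OF ab(1,2)] by blast
    qed
  qed
qed

lemma gal_image_frac:
  assumes s: "s \<in> \<G>" and A: "A \<in> frac_ideals K"
  shows "s ` A \<in> frac_ideals K"
proof -
  interpret s: subfield_hom K s by (rule gal_hom[OF s])
  note AK = K.frac_subset[OF A]
  have hom_mult: "s (r * x) = s r * s x" if "r \<in> OK" "x \<in> A" for r x
    using that AK K.ints_subset by (intro s.hom_mult) auto
  obtain a where a: "a \<in> A" "a \<noteq> 0" using K.frac_nonzero[OF A] by blast
  obtain e where e: "e \<in> OK" "e \<noteq> 0" "\<forall>a\<in>A. e * a \<in> OK" by (rule K.frac_denominator[OF A])
  note eK = K.ints_subset[OF e(1)]
  show ?thesis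
  proof (rule K.frac_idealI[of _ "s a" "s e"])
    show "s ` A \<subseteq> K" using AK gal_mem[OF s] by blast
    show "add_submodule OK (s ` A)"
    proof (rule add_submoduleI)
      show "add_subgroup (s ` A)"
        using AK by (intro add_subgroup_image[OF K.frac_subgroup[OF A]] s.hom_diff) auto
      fix r x assume "r \<in> OK" "x \<in> s ` A"
      then obtain r' x' where r': "r' \<in> OK" "r = s r'" "x' \<in> A" "x = s x'"
        using gal_image_ints[OF s] by (metis imageE)
      then have "r * x = s (r' * x')" by (simp add: hom_mult)
      then show "r * x \<in> s ` A" using K.frac_mult[OF A r'(1,3)] by simp
    qed
    show "s a \<noteq> 0" using s.hom_nonzero[of a] a AK by blast
    show "s e \<noteq> 0" by (rule s.hom_nonzero[OF eK e(2)])
    show "s e \<in> K" by (rule gal_mem[OF s eK])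
    show "s e * x \<in> OK" if "x \<in> s ` A" for x
      using that e gal_ints[OF s] by (auto simp: hom_mult[symmetric])
  qed (use a in blast)
qed

lemma gal_image_integral:
  assumes s: "s \<in> \<G>" and A: "A \<in> integral_ideals K"
  shows "s ` A \<in> integral_ideals K"
  using gal_image_frac[OF s K.integral_frac[OF A]] K.integral_subset[OF A] gal_ints[OF s]
  by (auto simp: integral_ideals_def)

lemma prime_subset: "P \<in> primes_of K \<Longrightarrow> P \<subseteq> K"
  using K.frac_subset K.prime_frac by blast

lemma gal_image_prime:
  assumes s: "s \<in> \<G>" and P: "P \<in> primes_of K"
  shows "s ` P \<in> primes_of K"
  unfolding K.primes_iff
proof (intro conjI ballI impI)
  let ?t = "ginv s"
  have t: "?t \<in> \<G>" using s by simp
  interpret t: subfield_hom K ?t by (rule gal_hom[OF t])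
  have mem: "x \<in> s ` P \<longleftrightarrow> ?t x \<in> P" if "x \<in> OK" for x
    using gal_image_inv[OF s prime_subset[OF P]] gal_apply_inv[OF s K.ints_subset[OF that]]
    by (metis imageI)
  show "s ` P \<in> integral_ideals K" by (rule gal_image_integral[OF s K.prime_integral[OF P]])
  show "1 \<notin> s ` P" using mem[OF K.ints_one] t.hom_one K.prime_not_one[OF P] by simp
  fix x y assume xy: "x \<in> OK" "y \<in> OK" "x * y \<in> s ` P"
  then have "?t x * ?t y \<in> P"
    using mem[OF K.ints_mult[OF xy(1,2)]] t.hom_mult[of x y] K.ints_subset by simp
  then show "x \<in> s ` P \<or> y \<in> s ` P"
    using K.prime_mult[OF P gal_ints[OF t xy(1)] gal_ints[OF t xy(2)]] mem xy by blast
qed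

lemma gal_image_principal:
  assumes s: "s \<in> \<G>" and x: "x \<in> K"
  shows "s ` principal K x = principal K (s x)"
proof -
  interpret s: subfield_hom K s by (rule gal_hom[OF s])
  have "s ` principal K x = (\<lambda>r. s x * s r) ` OK"
    unfolding principal_def image_image
    by (rule image_cong[OF refl]) (simp add: s.hom_mult x K.ints_subset)
  also have "\<dots> = (\<lambda>r. s x * r) ` (s ` OK)" by (simp add: image_image)
  finally show ?thesis by (simp add: gal_image_ints[OF s] principal_def)
qed

lemma gal_image_hom: "s \<in> \<G> \<Longrightarrow> (\<lambda>A. s ` A) \<in> hom (frac_group K) (frac_group K)"
  by (auto simp: hom_def gal_image_frac gal_image_ideal_mult K.frac_subset simp del: image_iff)

lemma val_gal_image:
  assumes s: "s \<in> \<G>" and A: "A \<in> frac_ideals K" and P: "P \<in> primes_of K"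
  shows "K.val (s ` A) (s ` P) = K.val A P"
proof -
  have "K.val (s ` A) (s ` P) = K.val A P * K.val (s ` P) (s ` P)"
  proof (rule val_hom[OF K.number_field_set_axioms K.number_field_set_axioms gal_image_hom[OF s] A])
    fix R assume "R \<in> primes_of K" "R \<noteq> P"
    then show "K.val (s ` R) (s ` P) = 0"
      using gal_image_eq_iff[OF s prime_subset[OF P] prime_subset] gal_image_prime[OF s]
      by (auto simp: K.val_prime)
  qed
  then show ?thesis using gal_image_prime[OF s P] by (simp add: K.val_prime)
qed

lemma val_gal_image_inv:
  assumes s: "s \<in> \<G>" and A: "A \<in> frac_ideals K" and P: "P \<in> primes_of K"
  shows "K.val (s ` A) P = K.val A (ginv s ` P)"
  using val_gal_image[OF s A gal_image_prime[OF G.inv_closed[OF s] P]] gal_inv_image[OF s prime_subset[OF P]] by simp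

end

section \<open>Extension and contraction of ideals\<close>

context galois_extension
begin

abbreviation "ext a \<equiv> modulus_ext K a"

lemma base_frac_subset: "a \<in> frac_ideals k \<Longrightarrow> a \<subseteq> K"
  using k.frac_subset base_subset by blast

lemma subset_ext: "a \<subseteq> ext a"
proof
  fix x assume "x \<in> a"
  then have "x * 1 \<in> ideal_mult a OK" by (intro ideal_mult_memI K.ints_one)
  then show "x \<in> ext a" by (simp add: modulus_ext_def)
qed

lemma ext_least:
  assumes "add_submodule OK C" "a \<subseteq> C"
  shows "ext a \<subseteq> C"
  unfolding modulus_ext_def
proof (rule ideal_mult_least[OF add_submodule_subgroup[OF assms(1)]])
  fix u v assume "u \<in> a" "v \<in> OK"
  then show "u * v \<in> C" using add_submodule_mult[OF assms(1), of v u] assms(2) by (auto simp: mult.commute)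
qed

lemma ext_submodule: "add_submodule OK (ext a)"
  unfolding modulus_ext_def ideal_mult_commute[of a] by (rule ideal_mult_submodule[OF K.ints_submodule])

lemma ext_mult: "ext (ideal_mult a b) = ideal_mult (ext a) (ext b)"
proof -
  have "ideal_mult (ext a) (ext b) = ideal_mult (ideal_mult a b) (ideal_mult OK OK)"
    unfolding modulus_ext_def by (simp only: ideal_mult_ac)
  then show ?thesis by (simp only: K.ints_mult_ints modulus_ext_def)
qed

lemma ext_frac:
  assumes a: "a \<in> frac_ideals k"
  shows "ext a \<in> frac_ideals K"
proof -
  obtain x where x: "x \<in> a" "x \<noteq> 0" using k.frac_nonzero[OF a] by blast
  obtain e where e: "e \<in> Ok" "e \<noteq> 0" "\<forall>x\<in>a. e * x \<in> Ok" by (rule k.frac_denominator[OF a])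
  show ?thesis
  proof (rule K.frac_idealI[of _ x e])
    show "ext a \<subseteq> K"
      unfolding modulus_ext_def using K.ints_subset by (intro K.ideal_mult_subset base_frac_subset[OF a]) auto
    show "x \<in> ext a" using subset_ext x(1) by blast
    show "e \<in> K" using e(1) K.ints_subset by (simp add: ints_base_iff)
    have eu_integral: "e * u \<in> OK" if "u \<in> a" for u using that e(3) by (simp add: ints_base_iff)
    show "e * y \<in> OK" if "y \<in> ext a" for y
      using that unfolding modulus_ext_def
      by (induction rule: ideal_mult_induct)
         (simp_all add: K.ints_zero distrib_left K.ints_add mult.assoc[symmetric] K.ints_mult eu_integral)
  qed (use x e ext_submodule in auto)
qed

lemma ext_one: "ext Ok = OK"
proof
  show "ext Ok \<subseteq> OK" by (rule ext_least[OF K.ints_submodule]) (simp add: ints_base_iff subset_iff)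
  show "OK \<subseteq> ext Ok"
    using ideal_mult_memI[OF k.ints_one, of _ OK] by (auto simp: modulus_ext_def)
qed

lemma ext_hom: "ext \<in> hom (frac_group k) (frac_group K)"
  by (simp add: hom_def ext_frac ext_mult)

lemma ext_principal: "ext (principal k x) = principal K x"
proof
  show "ext (principal k x) \<subseteq> principal K x"
    by (rule ext_least[OF K.principal_submodule]) (auto simp: principal_def ints_base_iff)
  have "x \<in> principal k x" using k.ints_one by (force simp: k.principal_iff)
  then have "x * r \<in> ext (principal k x)" if "r \<in> OK" for r
    unfolding modulus_ext_def using that by (rule ideal_mult_memI)
  then show "principal K x \<subseteq> ext (principal k x)" by (auto simp: K.principal_iff)
qed

lemma ext_integral: "a \<in> integral_ideals k \<Longrightarrow> ext a \<in> integral_ideals K"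
proof -
  assume a: "a \<in> integral_ideals k"
  have "ext a \<subseteq> ext Ok" unfolding modulus_ext_def
    by (rule ideal_mult_mono[OF k.integral_subset[OF a] order_refl])
  then show ?thesis using ext_frac[OF k.integral_frac[OF a]] by (simp add: integral_ideals_def ext_one)
qed

lemma gal_image_ext:
  assumes s: "s \<in> \<G>" and a: "a \<in> frac_ideals k"
  shows "s ` ext a = ext a"
proof -
  have "s ` a = (\<lambda>x. x) ` a" by (rule image_cong[OF refl]) (use gal_fixes_base[OF s] k.frac_subset[OF a] in blast)
  then have "s ` a = a" by simp
  then show ?thesis
    using gal_image_ideal_mult[OF s base_frac_subset[OF a], of OK] K.ints_subset gal_image_ints[OF s]
    by (auto simp: modulus_ext_def)
qed

lemma ext_eq_ints_imp_eq:
  assumes c: "c \<in> frac_ideals k" and eq: "ext c = OK"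
  shows "c = Ok"
proof (rule antisym)
  have sub: "d \<subseteq> Ok" if "d \<in> frac_ideals k" "ext d = OK" for d
    using subset_ext[of d] that k.frac_subset[OF that(1)] ints_base_iff by blast
  let ?c' = "inv\<^bsub>frac_group k\<^esub> c"
  have c': "?c' \<in> frac_ideals k" by (rule k.frac_inv_closed[OF c])
  show "c \<subseteq> Ok" by (rule sub[OF c eq])
  have "ideal_mult (ext c) (ext ?c') = OK"
    unfolding ext_mult[symmetric] k.frac_inv[OF c] by (rule ext_one)
  then have "ext ?c' = OK" unfolding eq by (simp only: K.ideal_mult_ints_left[OF ext_frac[OF c']])
  then have "ideal_mult c ?c' \<subseteq> ideal_mult c Ok" by (intro ideal_mult_mono order_refl sub[OF c'])
  then show "Ok \<subseteq> c" by (simp only: k.frac_inv[OF c] k.ideal_mult_ints[OF c])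
qed

lemma ext_inject:
  assumes a: "a \<in> frac_ideals k" and b: "b \<in> frac_ideals k" and eq: "ext a = ext b"
  shows "a = b"
proof -
  let ?b' = "inv\<^bsub>frac_group k\<^esub> b"
  have b': "?b' \<in> frac_ideals k" by (rule k.frac_inv_closed[OF b])
  have "ext (ideal_mult a ?b') = ext (ideal_mult b ?b')" by (simp only: ext_mult eq)
  also have "\<dots> = OK" by (simp only: k.frac_inv[OF b] ext_one)
  finally have ab: "ideal_mult a ?b' = Ok" by (rule ext_eq_ints_imp_eq[OF k.ideal_mult_frac[OF a b']])
  have "a = ideal_mult a (ideal_mult b ?b')" by (simp only: k.frac_inv[OF b] k.ideal_mult_ints[OF a])
  also have "\<dots> = ideal_mult b (ideal_mult a ?b')" by (rule ideal_mult_left_commute)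
  also have "\<dots> = b" by (simp only: ab k.ideal_mult_ints[OF b])
  finally show ?thesis .
qed

definition contraction :: "'a set \<Rightarrow> 'a set" where "contraction P = P \<inter> Ok"

lemma contraction_prime:
  assumes P: "P \<in> primes_of K"
  shows "contraction P \<in> primes_of k"
proof -
  obtain m :: nat where m: "m > 0" "of_nat m \<in> P" by (rule K.integral_contains_nat[OF K.prime_integral[OF P]])
  then have "of_nat m \<in> contraction P" "of_nat m \<noteq> (0::'a)" using k.ints_of_nat by (auto simp: contraction_def)
  then have "contraction P \<noteq> {0}" by blast
  moreover have "add_submodule Ok (contraction P)"
    using K.frac_mult[OF K.prime_frac[OF P]] k.ints_mult
    by (intro add_submoduleI)
       (auto simp: contraction_def ints_base_iff intro!: add_subgroup_Int K.prime_subgroup[OF P] k.ints_subgroup)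
  ultimately have "contraction P \<in> integral_ideals k"
    by (auto simp: k.integral_iff contraction_def)
  then show ?thesis
    using K.prime_not_one[OF P] K.prime_mult[OF P] by (auto simp: k.primes_iff contraction_def ints_base_iff)
qed

lemma ext_subset_prime_iff:
  assumes P: "P \<in> primes_of K" and a: "a \<in> integral_ideals k"
  shows "ext a \<subseteq> P \<longleftrightarrow> a \<subseteq> contraction P"
proof
  assume "ext a \<subseteq> P"
  then show "a \<subseteq> contraction P" using subset_ext[of a] k.integral_subset[OF a] by (auto simp: contraction_def)
next
  assume "a \<subseteq> contraction P"
  then show "ext a \<subseteq> P"
    by (intro ext_least K.frac_submodule K.prime_frac[OF P]) (auto simp: contraction_def)
qed

lemma val_ext_prime_iff:
  assumes P: "P \<in> primes_of K" and q: "q \<in> primes_of k"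
  shows "K.val (ext q) P > 0 \<longleftrightarrow> q = contraction P"
proof -
  note q_integral = k.prime_integral[OF q]
  have "K.val (ext q) P > 0 \<longleftrightarrow> q \<subseteq> contraction P"
    using K.subset_prime_iff_val[OF ext_integral[OF q_integral] P] ext_subset_prime_iff[OF P q_integral] by blast
  also have "\<dots> \<longleftrightarrow> q = contraction P"
    using k.prime_maximal[OF q k.prime_integral[OF contraction_prime[OF P]]]
      k.prime_not_one[OF contraction_prime[OF P]] by blast
  finally show ?thesis .
qed

lemma val_ext_nonneg: "a \<in> integral_ideals k \<Longrightarrow> K.val (ext a) P \<ge> 0"
  by (rule K.val_integral_nonneg[OF ext_integral])

lemma val_ext:
  assumes P: "P \<in> primes_of K" and a: "a \<in> frac_ideals k"
  shows "K.val (ext a) P = k.val a (contraction P) * K.val (ext (contraction P)) P"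
proof (rule val_hom[OF k.number_field_set_axioms K.number_field_set_axioms ext_hom a])
  fix q assume q: "q \<in> primes_of k" "q \<noteq> contraction P"
  then show "K.val (ext q) P = 0"
    using val_ext_prime_iff[OF P q(1)] val_ext_nonneg[OF k.prime_integral[OF q(1)], of P] by linarith
qed

lemma val_ext_contraction_pos: "P \<in> primes_of K \<Longrightarrow> K.val (ext (contraction P)) P > 0"
  using val_ext_prime_iff[OF _ contraction_prime] by blast

lemma ex_prime_over:
  assumes q: "q \<in> primes_of k"
  obtains P where "P \<in> primes_of K" "contraction P = q"
proof -
  note q_integral = k.prime_integral[OF q]
  have "1 \<notin> ext q"
  proof
    assume "1 \<in> ext q"
    then have "ext q = OK" by (rule K.integral_eq_ints[OF ext_integral[OF q_integral]])
    then have "q = Ok" by (rule ext_eq_ints_imp_eq[OF k.integral_frac[OF q_integral]])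
    then show False using k.ints_one k.prime_not_one[OF q] by simp
  qed
  then obtain P where P: "P \<in> primes_of K" "ext q \<subseteq> P" by (rule K.ex_prime_above[OF ext_integral[OF q_integral]])
  then have "K.val (ext q) P > 0" using K.subset_prime_iff_val[OF ext_integral[OF q_integral]] by blast
  then show ?thesis using val_ext_prime_iff[OF P(1) q] P(1) that by blast
qed

lemma contraction_gal_image:
  assumes s: "s \<in> \<G>" and P: "P \<in> primes_of K"
  shows "contraction (s ` P) = contraction P"
proof -
  have "K.val (ext (contraction P)) (s ` P) = K.val (ext (contraction P)) P"
    using val_gal_image[OF s ext_frac[OF k.prime_frac[OF contraction_prime[OF P]]] P]
      gal_image_ext[OF s k.prime_frac[OF contraction_prime[OF P]]] by simp
  then show ?thesis
    using val_ext_prime_iff[OF gal_image_prime[OF s P] contraction_prime[OF P]] val_ext_contraction_pos[OF P] by simp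
qed

end

section \<open>The product of the conjugates of an ideal\<close>

context galois_extension
begin

interpretation IK: comm_group "frac_group K" by (rule K.comm_group_frac)

definition conj_norm :: "'a set \<Rightarrow> 'a set" where
  "conj_norm A = finprod (frac_group K) (\<lambda>s. s ` A) \<G>"

lemma conj_norm_frac: "A \<in> frac_ideals K \<Longrightarrow> conj_norm A \<in> frac_ideals K"
  unfolding conj_norm_def using IK.finprod_closed[of "\<lambda>s. s ` A" \<G>] gal_image_frac by auto

lemma conj_norm_hom: "conj_norm \<in> hom (frac_group K) (frac_group K)"
proof (rule homI)
  fix A assume "A \<in> carrier (frac_group K)"
  then show "conj_norm A \<in> carrier (frac_group K)" using conj_norm_frac by simp
next
  fix A B assume "A \<in> carrier (frac_group K)" "B \<in> carrier (frac_group K)"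
  then have AB: "A \<in> frac_ideals K" "B \<in> frac_ideals K" by simp_all
  have "conj_norm (A \<otimes>\<^bsub>frac_group K\<^esub> B) = finprod (frac_group K) (\<lambda>s. s ` A \<otimes>\<^bsub>frac_group K\<^esub> s ` B) \<G>"
    unfolding conj_norm_def using AB
    by (intro IK.finprod_cong'[OF refl])
       (auto simp: gal_image_frac K.ideal_mult_frac gal_image_ideal_mult K.frac_subset simp del: image_iff)
  also have "\<dots> = conj_norm A \<otimes>\<^bsub>frac_group K\<^esub> conj_norm B" unfolding conj_norm_def
    by (rule IK.finprod_multf) (use AB gal_image_frac in auto)
  finally show "conj_norm (A \<otimes>\<^bsub>frac_group K\<^esub> B) = conj_norm A \<otimes>\<^bsub>frac_group K\<^esub> conj_norm B" .
qed

lemma finprod_gal_reindex: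
  assumes "A \<in> frac_ideals K" "bij_betw f \<G> \<G>"
  shows "finprod (frac_group K) (\<lambda>s. f s ` A) \<G> = conj_norm A"
  using IK.finprod_reindex[of "\<lambda>s. s ` A" f \<G>] assms gal_image_frac by (auto simp: bij_betw_def conj_norm_def)

lemma conj_norm_gal_image:
  assumes t: "t \<in> \<G>" and A: "A \<in> frac_ideals K"
  shows "conj_norm (t ` A) = conj_norm A"
proof -
  have "conj_norm (t ` A) = finprod (frac_group K) (\<lambda>s. (s \<star> t) ` A) \<G>"
    unfolding conj_norm_def
    by (rule IK.finprod_cong'[OF refl]) (use gal_image_frac A t gal_image_comp[OF _ t K.frac_subset[OF A]] in auto)
  then show ?thesis using finprod_gal_reindex[OF A gal_rtranslate_bij[OF t]] by simp
qed

lemma gal_image_conj_norm: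
  assumes t: "t \<in> \<G>" and A: "A \<in> frac_ideals K"
  shows "t ` conj_norm A = conj_norm A"
proof -
  have "t ` conj_norm A = finprod (frac_group K) (\<lambda>s. t ` (s ` A)) \<G>"
    unfolding conj_norm_def
    by (rule IK.hom_finprod[OF K.comm_group_frac gal_image_hom[OF t] finite_gal]) (use gal_image_frac A in auto)
  also have "\<dots> = finprod (frac_group K) (\<lambda>s. (t \<star> s) ` A) \<G>"
    by (rule IK.finprod_cong'[OF refl]) (use gal_image_frac A t gal_image_comp[OF t _ K.frac_subset[OF A]] in auto)
  finally show ?thesis using finprod_gal_reindex[OF A gal_translate_bij[OF t]] by simp
qed

lemma val_conj_norm:
  assumes A: "A \<in> frac_ideals K"
  shows "K.val (conj_norm A) P = (\<Sum>s\<in>\<G>. K.val (s ` A) P)"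
  unfolding conj_norm_def by (rule K.val_finprod[OF finite_gal gal_image_frac[OF _ A]])

lemma finprod_principal:
  assumes "finite S" "\<And>i. i \<in> S \<Longrightarrow> f i \<in> K \<and> f i \<noteq> 0"
  shows "finprod (frac_group K) (\<lambda>i. principal K (f i)) S = principal K (prod f S)"
  using assms
proof (induction S rule: finite_induct)
  case empty
  then show ?case by (simp add: K.principal_one)
next
  case (insert i S)
  then show ?case by (subst IK.finprod_insert) (auto simp: K.principal_mult K.principal_frac)
qed

lemma conj_norm_principal:
  assumes y: "y \<in> K" "y \<noteq> 0"
  shows "conj_norm (principal K y) = principal K (elem_norm K k y)"
proof -
  have "conj_norm (principal K y) = finprod (frac_group K) (\<lambda>s. principal K (s y)) \<G>"
    unfolding conj_norm_def
    by (rule IK.finprod_cong'[OF refl])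
       (use gal_image_principal[OF _ y(1)] gal_image_frac[OF _ K.principal_frac[OF y]] in auto)
  also have "\<dots> = principal K (elem_norm K k y)"
    unfolding elem_norm_def using y gal_mem subfield_hom.hom_nonzero[OF gal_hom]
    by (intro finprod_principal[OF finite_gal]) auto
  finally show ?thesis .
qed

end

section \<open>Decomposition of primes\<close>

context galois_extension
begin

lemma conj_norm_integral:
  assumes A: "A \<in> integral_ideals K"
  shows "conj_norm A \<in> integral_ideals K" and "K.abs_norm (conj_norm A) = (\<Prod>s\<in>\<G>. K.abs_norm (s ` A))"
  unfolding conj_norm_def
  using K.abs_norm_finprod[OF finite_gal, of "\<lambda>s. s ` A"] gal_image_integral[OF _ A] by blast+

lemma val_conj_norm_prime:
  assumes P: "P \<in> primes_of K"
  shows "K.val (conj_norm P) Q = int (card {s \<in> \<G>. s ` P = Q})"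
proof -
  have "K.val (conj_norm P) Q = (\<Sum>s\<in>\<G>. if s ` P = Q then 1 else 0)"
    unfolding val_conj_norm[OF K.prime_frac[OF P]]
    by (rule sum.cong[OF refl]) (auto simp: K.val_prime[OF gal_image_prime[OF _ P]])
  then show ?thesis using finite_gal by (simp add: sum.If_cases Int_def)
qed

lemma conj_norm_subset_prime_iff:
  assumes P: "P \<in> primes_of K" and Q: "Q \<in> primes_of K"
  shows "conj_norm P \<subseteq> Q \<longleftrightarrow> (\<exists>s\<in>\<G>. s ` P = Q)"
  unfolding K.subset_prime_iff_val[OF conj_norm_integral(1)[OF K.prime_integral[OF P]] Q] val_conj_norm_prime[OF P]
  using finite_gal by (auto simp: card_gt_0_iff)

lemma ex_mem_avoiding_conjugates:
  assumes P: "P \<in> primes_of K" and Q: "Q \<in> primes_of K" and not_conj: "\<not> (\<exists>s\<in>\<G>. s ` P = Q)"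
  obtains a where "a \<in> Q" "\<forall>s\<in>\<G>. a \<notin> s ` P"
proof -
  obtain x where x: "x \<in> conj_norm P" "x \<notin> Q" using conj_norm_subset_prime_iff[OF P Q] not_conj by blast
  have "x \<in> OK" using x(1) K.integral_subset[OF conj_norm_integral(1)[OF K.prime_integral[OF P]]] by blast
  then obtain y where y: "y \<in> OK" "y * x - 1 \<in> Q" using K.prime_inverse_mod[OF Q _ x(2)] by blast
  have "y * x - 1 \<notin> s ` P" if s: "s \<in> \<G>" for s
  proof
    note sP = gal_image_prime[OF s P]
    assume sub: "y * x - 1 \<in> s ` P"
    have "y * x \<in> s ` P"
      using x(1) conj_norm_subset_prime_iff[OF P sP] s by (intro K.frac_mult[OF K.prime_frac[OF sP] y(1)]) blast
    from add_subgroup_diff[OF K.prime_subgroup[OF sP] this sub] show False using K.prime_not_one[OF sP] by simp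
  qed
  with y(2) show ?thesis by (intro that) auto
qed

lemma elem_norm_ints:
  assumes a: "a \<in> OK"
  shows "elem_norm K k a \<in> Ok"
  using K.ints_prod[of \<G> "\<lambda>s. s a"] gal_ints[OF _ a] elem_norm_mem[OF K.ints_subset[OF a]]
  by (simp add: ints_base_iff elem_norm_def)

lemma elem_norm_mem_contraction:
  assumes Q: "Q \<in> primes_of K" and a: "a \<in> Q"
  shows "elem_norm K k a \<in> contraction Q"
proof -
  let ?e = "\<one>\<^bsub>gal_group K k\<^esub>"
  have aO: "a \<in> OK" using a K.integral_subset[OF K.prime_integral[OF Q]] by blast
  have "elem_norm K k a = (\<Prod>s\<in>\<G> - {?e}. s a) * a"
    unfolding elem_norm_def using finite_gal gal_one_apply[OF K.ints_subset[OF aO]]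
    by (simp add: prod.remove[of _ ?e] mult.commute)
  also have "\<dots> \<in> Q"
    by (rule K.frac_mult[OF K.prime_frac[OF Q] K.ints_prod a]) (use gal_ints[OF _ aO] in blast)
  finally show ?thesis using elem_norm_ints[OF aO] by (simp add: contraction_def)
qed

lemma gal_transitive:
  assumes P: "P \<in> primes_of K" and Q: "Q \<in> primes_of K" and eq: "contraction P = contraction Q"
  shows "\<exists>s\<in>\<G>. s ` P = Q"
proof (rule ccontr)
  assume "\<not> (\<exists>s\<in>\<G>. s ` P = Q)"
  then obtain a where a: "a \<in> Q" "\<forall>s\<in>\<G>. a \<notin> s ` P" by (rule ex_mem_avoiding_conjugates[OF P Q])
  have aO: "a \<in> OK" using a(1) K.integral_subset[OF K.prime_integral[OF Q]] by blast
  have "(\<Prod>s\<in>\<G>. s a) \<in> P"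
    using elem_norm_mem_contraction[OF Q a(1)] eq by (auto simp: contraction_def elem_norm_def)
  then obtain s where s: "s \<in> \<G>" "s a \<in> P"
    using K.prime_prod[OF P finite_gal, of "\<lambda>s. s a"] gal_ints[OF _ aO] by blast
  then have "ginv s (s a) \<in> ginv s ` P" by blast
  then show False using a(2) s(1) gal_inv_apply[OF s(1) K.ints_subset[OF aO]] by simp
qed

end

section \<open>The absolute norm of an extended prime\<close>

context galois_extension
begin

lemma trace_ints: "x \<in> OK \<Longrightarrow> trace x \<in> Ok"
  using trace_mem[OF K.ints_subset] K.ints_sum[of \<G> "\<lambda>s. s x"] gal_ints by (auto simp: ints_base_iff trace_def)

lemma residue_space_ext_prime:
  assumes p: "p \<in> primes_of k"
  shows "residue_space Ok p OK (ext p) gal_order"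
proof
  note p_integral = k.prime_integral[OF p]
  note ext_p_integral = ext_integral[OF p_integral]
  show "add_submodule Ok Ok" by (rule k.ints_submodule)
  show "add_submodule Ok p" "p \<subseteq> Ok" using k.frac_submodule[OF k.prime_frac[OF p]] k.integral_subset[OF p_integral] by auto
  show "\<exists>c'\<in>Ok. c' * c - 1 \<in> p" if "c \<in> Ok" "c \<notin> p" for c by (rule k.prime_inverse_mod[OF p that])
  show "add_submodule Ok OK" "add_submodule Ok (ext p)"
    using K.ints_submodule ext_submodule by (auto simp: add_submodule_def ints_base_iff)
  show "ext p \<subseteq> OK" by (rule K.integral_subset[OF ext_p_integral])
  show "r * x \<in> ext p" if "r \<in> p" "x \<in> OK" for r x
    using ideal_mult_memI[OF that] by (simp add: modulus_ext_def)
  fix v :: "nat \<Rightarrow> 'a" assume v: "\<And>i. i \<le> gal_order \<Longrightarrow> v i \<in> OK"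
  obtain c where c: "\<forall>i\<le>gal_order. c i \<in> k" "\<exists>i\<le>gal_order. c i \<noteq> 0" "(\<Sum>i\<le>gal_order. c i * v i) = 0"
    by (rule base_dependent[OF K.ints_subset[OF v]])
  obtain t where t: "\<forall>i<Suc gal_order. t * c i \<in> Ok" "\<exists>i<Suc gal_order. t * c i \<notin> p"
    by (rule k.clear_denominators[OF p, of "Suc gal_order" c]) (use c(1,2) in \<open>auto simp: less_Suc_eq_le\<close>)
  have "(\<Sum>i\<le>gal_order. t * c i * v i) = t * (\<Sum>i\<le>gal_order. c i * v i)"
    by (simp only: sum_distrib_left mult.assoc)
  then have "(\<Sum>i\<le>gal_order. t * c i * v i) \<in> ext p"
    using add_subgroup_zero[OF K.integral_subgroup[OF ext_p_integral]] by (simp only: c(3) mult_zero_right)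
  then show "\<exists>e. (\<forall>i\<le>gal_order. e i \<in> Ok) \<and> (\<exists>i\<le>gal_order. e i \<notin> p) \<and> (\<Sum>i\<le>gal_order. e i * v i) \<in> ext p"
    using t unfolding less_Suc_eq_le by (intro exI[of _ "\<lambda>i. t * c i"]) blast
qed

definition trace_image :: "'a \<Rightarrow> 'a set" where
  "trace_image c = (\<lambda>y. trace (c * y)) ` OK"

lemma trace_imageE:
  assumes "u \<in> trace_image c"
  obtains y where "y \<in> OK" "u = trace (c * y)"
  using assms by (auto simp: trace_image_def)

lemma trace_image_submodule:
  assumes c: "c \<in> K"
  shows "add_submodule Ok (trace_image c)"
proof (rule add_submoduleI)
  have cyK: "c * y \<in> K" if "y \<in> OK" for y using K.mult_mem[OF c K.ints_subset[OF that]] .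
  show "add_subgroup (trace_image c)" unfolding trace_image_def
    by (rule add_subgroup_image[OF K.ints_subgroup]) (simp add: cyK right_diff_distrib trace_diff)
  fix r u assume r: "r \<in> Ok" and "u \<in> trace_image c"
  then obtain y where y: "y \<in> OK" "u = trace (c * y)" by (blast elim: trace_imageE)
  then have "r * u = trace (c * (r * y))"
    using trace_scale[OF k.ints_subset[OF r] cyK[OF y(1)]] by (simp add: mult.left_commute)
  moreover have "r * y \<in> OK" using r y(1) by (simp add: ints_base_iff K.ints_mult)
  ultimately show "r * u \<in> trace_image c" by (simp add: trace_image_def)
qed

lemma trace_image_frac:
  assumes c: "c \<in> K" "c \<noteq> 0"
  shows "trace_image c \<in> frac_ideals k"
proof -
  obtain m :: nat where m: "m > 0" "of_nat m * inverse c \<in> OK"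
    by (rule K.ints_denominator[OF K.inverse_mem[OF c(1)]])
  obtain e :: nat where e: "e > 0" "of_nat e * c \<in> OK" by (rule K.ints_denominator[OF c(1)])
  have "c * (of_nat m * inverse c) = of_nat m" using c(2) by simp
  then have w: "of_nat m * of_nat gal_order \<in> trace_image c"
    using m(2) trace_of_nat[of m] unfolding trace_image_def by (metis image_eqI)
  show ?thesis
  proof (rule k.frac_idealI[OF _ trace_image_submodule[OF c(1)] w, of "of_nat e"])
    show "trace_image c \<subseteq> k"
      using trace_mem K.mult_mem[OF c(1) K.ints_subset] by (auto simp: trace_image_def)
    show "of_nat e * u \<in> Ok" if u: "u \<in> trace_image c" for u
    proof -
      obtain y where y: "y \<in> OK" "u = trace (c * y)" by (rule trace_imageE[OF u])
      have "of_nat e * u = trace (of_nat e * c * y)"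
        using trace_scale[OF k.of_nat_mem, of "c * y" e] K.mult_mem[OF c(1) K.ints_subset[OF y(1)]]
        by (simp add: y(2) mult.assoc)
      then show ?thesis using trace_ints[OF K.ints_mult[OF e(2) y(1)]] by simp
    qed
  qed (use m(1) e(1) gal_order_pos k.of_nat_mem in auto)
qed

lemma trace_ext:
  assumes c: "c \<in> K" and a: "a \<in> frac_ideals k" and z: "z \<in> ext a"
  shows "trace (c * z) \<in> ideal_mult a (trace_image c)"
proof -
  have "z \<in> K \<and> trace (c * z) \<in> ideal_mult a (trace_image c)"
    using z unfolding modulus_ext_def
  proof (induction rule: ideal_mult_induct)
    case zero
    then show ?case by (simp add: K.zero_mem trace_zero ideal_mult_zero)
  next
    case (add x y)
    then show ?case using c by (simp add: distrib_left trace_add K.mult_mem K.add_mem ideal_mult_add)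
  next
    case (mult r y)
    have rk: "r \<in> k" and yK: "y \<in> K" using mult k.frac_subset[OF a] K.ints_subset by auto
    have "trace (c * (r * y)) = r * trace (c * y)"
      using trace_scale[OF rk K.mult_mem[OF c yK]] by (simp add: mult.left_commute)
    also have "\<dots> \<in> ideal_mult a (trace_image c)"
      using mult by (intro ideal_mult_memI) (auto simp: trace_image_def)
    finally show ?case using K.mult_mem[OF base_mem[OF rk] yK] by simp
  qed
  then show ?thesis ..
qed

text \<open>
  If \<open>c\<close> annihilates a spanning family of \<open>OK\<close> modulo \<open>ext p\<close> under the trace form, then the fractional
  ideal \<open>L = trace_image c\<close> satisfies \<open>L \<subseteq> p L\<close>, which is impossible.
\<close>

lemma gal_order_le_length_spanning:
  assumes p: "p \<in> primes_of k" and x: "\<forall>i<m. x i \<in> OK"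
    and span: "\<forall>y\<in>OK. \<exists>r. (\<forall>i<m. r i \<in> Ok) \<and> y - (\<Sum>i<m. r i * x i) \<in> ext p"
  shows "gal_order \<le> m"
proof (rule ccontr)
  assume "\<not> gal_order \<le> m"
  then have "m < gal_order" "\<forall>i<m. x i \<in> K" using x K.ints_subset by auto
  then obtain c where c: "c \<in> K" "c \<noteq> 0" and ann: "\<forall>i<m. trace (c * x i) = 0" by (rule ex_trace_annihilator)
  note L = trace_image_frac[OF c]
  have "trace_image c \<subseteq> ideal_mult p (trace_image c)"
  proof
    fix u assume "u \<in> trace_image c"
    then obtain y where y: "y \<in> OK" "u = trace (c * y)" by (rule trace_imageE)
    obtain r where r: "\<forall>i<m. r i \<in> Ok" "y - (\<Sum>i<m. r i * x i) \<in> ext p" using span y(1) by blast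
    let ?z = "y - (\<Sum>i<m. r i * x i)"
    have zK: "?z \<in> K" using r(2) K.frac_subset[OF ext_frac[OF k.prime_frac[OF p]]] by blast
    have cxK: "c * x i \<in> K" and rk: "r i \<in> k" if "i < m" for i
      using that x r(1) K.mult_mem[OF c(1)] K.ints_subset k.ints_subset by auto
    have rcxK: "r i * (c * x i) \<in> K" if "i < m" for i by (rule K.mult_mem[OF base_mem[OF rk[OF that]] cxK[OF that]])
    have "u = trace (c * ?z + (\<Sum>i<m. r i * (c * x i)))"
      unfolding y(2) by (simp add: right_diff_distrib sum_distrib_left mult.left_commute)
    also have "\<dots> = trace (c * ?z) + trace (\<Sum>i<m. r i * (c * x i))"
      by (rule trace_add[OF K.mult_mem[OF c(1) zK] K.sum_mem]) (simp add: rcxK)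
    also have "trace (\<Sum>i<m. r i * (c * x i)) = (\<Sum>i<m. r i * trace (c * x i))"
      using trace_sum[of "{..<m}" "\<lambda>i. r i * (c * x i)"] by (simp add: rcxK trace_scale[OF rk cxK])
    also have "\<dots> = 0" using ann by simp
    finally show "u \<in> ideal_mult p (trace_image c)"
      using trace_ext[OF c(1) k.prime_frac[OF p] r(2)] by simp
  qed
  then have "k.val (ideal_mult p (trace_image c)) p \<le> k.val (trace_image c) p"
    using k.subset_iff_val[OF L k.ideal_mult_frac[OF k.prime_frac[OF p] L]] by blast
  then show False by (simp add: k.val_mult[OF k.prime_frac[OF p] L] k.val_prime[OF p])
qed

lemma abs_norm_ext_prime:
  assumes p: "p \<in> primes_of k"
  shows "K.abs_norm (ext p) = k.abs_norm p ^ gal_order"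
proof -
  interpret residue_space Ok p OK "ext p" gal_order by (rule residue_space_ext_prime[OF p])
  obtain m x where spanning_x: "m \<le> gal_order" "\<forall>i<m. x i \<in> OK" "spanning m x"
    and index: "add_index OK (ext p) = add_index Ok p ^ m" by (rule spanning_family)
  have "gal_order \<le> m" using spanning_x(3) unfolding spanning_def by (rule gal_order_le_length_spanning[OF p spanning_x(2)])
  with spanning_x(1) index show ?thesis by (simp add: K.abs_norm_def k.abs_norm_def)
qed

end

section \<open>Residue degrees\<close>

lemma (in ring) card_eq_power_dimension:
  assumes K: "subfield K R" and fin: "finite K" and dim: "dimension n K E"
  shows "card E = card K ^ n"
proof -
  obtain Vs where Vs: "set Vs \<subseteq> carrier R" "independent K Vs" "length Vs = n" "Span K Vs = E"
    using exists_base[OF K dim] by blast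
  let ?L = "{Ks. set Ks \<subseteq> K \<and> length Ks = n}"
  have "bij_betw (\<lambda>Ks. combine Ks Vs) ?L E"
  proof (rule bij_betw_imageI)
    have E: "E = (\<lambda>Ks. combine Ks Vs) ` ?L"
      using unique_decomposition[OF K Vs(2)] Span_eq_combine_set_length_version[OF K Vs(1)] Vs(3,4) by auto
    then show "(\<lambda>Ks. combine Ks Vs) ` ?L = E" ..
    show "inj_on (\<lambda>Ks. combine Ks Vs) ?L"
    proof (rule inj_onI)
      fix Ks Ls assume coords: "Ks \<in> ?L" "Ls \<in> ?L" "combine Ks Vs = combine Ls Vs"
      then have "combine Ks Vs \<in> Span K Vs" using E Vs(4) by blast
      then show "Ks = Ls" using unique_decomposition[OF K Vs(2)] coords Vs(3) by (metis (mono_tags, lifting) mem_Collect_eq)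
    qed
  qed
  then show ?thesis using card_lists_length_eq[OF fin] by (simp add: bij_betw_same_card[symmetric])
qed

lemma (in ring) finite_dimension_carrier:
  assumes K: "subfield K R" and fin: "finite (carrier R)"
  shows "finite_dimension K (carrier R)"
proof -
  obtain us where us: "set us = carrier R" using finite_list[OF fin] by blast
  have "Span K us = carrier R"
    using Span_base_incl[OF K, of us] Span_in_carrier[of K us] subfieldE(3)[OF K] us by auto
  then show ?thesis using Span_finite_dimension[OF K, of us] us by simp
qed

lemma (in domain) finite_imp_field:
  assumes fin: "finite (carrier R)"
  shows "Ring.field R"
proof (rule cring_fieldI2)
  fix a assume a: "a \<in> carrier R" "a \<noteq> \<zero>"
  have "inj_on (\<lambda>b. a \<otimes> b) (carrier R)" using a m_lcancel by (auto simp: inj_on_def)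
  then have "(\<lambda>b. a \<otimes> b) ` carrier R = carrier R" using a(1) by (intro endo_inj_surj[OF fin]) auto
  then show "\<exists>b\<in>carrier R. a \<otimes> b = \<one>" by (metis one_closed imageE)
qed simp

lemma (in domain) finite_subring_imp_subfield:
  assumes S: "subring S R" and fin: "finite S"
  shows "subfield S R"
proof -
  have "domain (R\<lparr>carrier := S\<rparr>)" using subdomainI'[OF S] subdomain_is_domain by blast
  then have "Ring.field (R\<lparr>carrier := S\<rparr>)" using domain.finite_imp_field fin by fastforce
  then show ?thesis using subfield_iff(1) subringE(1)[OF S] by blast
qed

context galois_extension
begin

lemma abs_norm_contraction:
  assumes P: "P \<in> primes_of K"
  shows "k.abs_norm (contraction P) = add_index Ok P"
  unfolding k.abs_norm_def
proof (rule add_index_cong[where f = "\<lambda>x. x", OF k.prime_subgroup[OF contraction_prime[OF P]] K.prime_subgroup[OF P]])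
  show "x - y \<in> P \<longleftrightarrow> x - y \<in> contraction P" if "x \<in> Ok" "y \<in> Ok" for x y
    using k.ints_diff[OF that] by (simp add: contraction_def)
  show "\<exists>x\<in>Ok. z - x \<in> P" if "z \<in> Ok" for z
    using that add_subgroup_zero[OF K.prime_subgroup[OF P]] by (metis diff_self)
qed

lemma abs_norm_prime_res_degree:
  assumes P: "P \<in> primes_of K"
  shows "K.abs_norm P = k.abs_norm (contraction P) ^ res_degree K k P"
proof -
  let ?R = "ring_on OK" and ?h = "\<lambda>x. P +>\<^bsub>ring_on OK\<^esub> x"
  let ?Q = "?R Quot P"
  interpret R: cring ?R by (rule K.cring_ints)
  interpret P: primeideal P ?R using P by (simp add: primes_of_def)
  interpret Q: domain ?Q by (rule P.quotient_is_domain)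
  interpret h: ring_hom_ring ?R ?Q ?h by (rule P.rcos_ring_hom_ring)
  have coset: "?h x = (+) x ` P" for x by (auto simp: a_r_coset_def' add.commute)
  have carrier: "carrier ?Q = add_cosets OK P"
    unfolding FactRing_def A_RCOSETS_def' by (auto simp: coset add_cosets_def)
  have fin: "finite (carrier ?Q)"
    unfolding carrier add_index_pos_iff[OF K.ints_subgroup, symmetric]
    using K.abs_norm_pos[OF K.prime_integral[OF P]] by (simp add: K.abs_norm_def)
  have Ok: "?h ` Ok = add_cosets Ok P" by (auto simp: coset add_cosets_def)
  have "subring Ok ?R"
    by (rule R.subringI)
       (auto simp: ints_base_iff K.ring_on_ints_uminus k.ints_uminus[unfolded ints_base_iff]
         K.ints_one K.ints_mult K.ints_add K.ints_uminus k.one_mem k.mult_mem k.add_mem k.uminus_mem)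
  then have "subring (?h ` Ok) ?Q" by (rule h.img_is_subring)
  moreover have finOk: "finite (?h ` Ok)" by (rule finite_subset[OF _ fin]) (auto simp: ints_base_iff)
  ultimately have subfield_Ok: "subfield (?h ` Ok) ?Q" by (rule Q.finite_subring_imp_subfield)
  have "\<exists>!m. Q.dimension m (?h ` Ok) (carrier ?Q)"
    by (rule Q.unique_dimension[OF subfield_Ok Q.finite_dimension_carrier[OF subfield_Ok fin]])
  then have "Q.dimension (res_degree K k P) (?h ` Ok) (carrier ?Q)"
    unfolding res_degree_def Let_def by (rule theI')
  then have "card (carrier ?Q) = card (?h ` Ok) ^ res_degree K k P"
    by (rule Q.card_eq_power_dimension[OF subfield_Ok finOk])
  then show ?thesis unfolding carrier Ok abs_norm_contraction[OF P] by (simp add: K.abs_norm_def add_index_def)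
qed

lemma abs_norm_gal_image:
  assumes s: "s \<in> \<G>" and A: "A \<in> integral_ideals K"
  shows "K.abs_norm (s ` A) = K.abs_norm A"
  unfolding K.abs_norm_def
proof (rule add_index_cong[symmetric])
  interpret s: subfield_hom K s by (rule gal_hom[OF s])
  note sA = gal_image_integral[OF s A]
  show "add_subgroup A" "add_subgroup (s ` A)" using A sA by (auto intro: K.integral_subgroup)
  show "s x \<in> OK" if "x \<in> OK" for x by (rule gal_ints[OF s that])
  show "s x - s y \<in> s ` A \<longleftrightarrow> x - y \<in> A" if xy: "x \<in> OK" "y \<in> OK" for x y
    using inj_on_image_mem_iff[OF s.hom_inj K.diff_mem K.frac_subset[OF K.integral_frac[OF A]]]
      K.ints_subset xy by (simp add: s.hom_diff[symmetric])
  show "\<exists>x\<in>OK. z - s x \<in> s ` A" if "z \<in> OK" for z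
    using that gal_image_ints[OF s] add_subgroup_zero[OF K.integral_subgroup[OF sA]] by (metis diff_self imageE)
qed

end

section \<open>Norms of ideals\<close>

context galois_extension
begin

interpretation IK: comm_group "frac_group K" by (rule K.comm_group_frac)
interpretation Ik: comm_group "frac_group k" by (rule k.comm_group_frac)

lemma abs_norm_conj_norm_prime:
  assumes P: "P \<in> primes_of K"
  shows "K.abs_norm (conj_norm P) = K.abs_norm (ext (contraction P) [^]\<^bsub>frac_group K\<^esub> res_degree K k P)"
proof -
  note P_integral = K.prime_integral[OF P] and p = contraction_prime[OF P]
  have "K.abs_norm (conj_norm P) = (\<Prod>s\<in>\<G>. K.abs_norm P)"
    unfolding conj_norm_integral(2)[OF P_integral] by (rule prod.cong[OF refl abs_norm_gal_image[OF _ P_integral]])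
  also have "\<dots> = K.abs_norm (ext (contraction P)) ^ res_degree K k P"
    unfolding abs_norm_ext_prime[OF p]
    by (simp add: abs_norm_prime_res_degree[OF P] power_mult[symmetric] mult.commute)
  finally show ?thesis by (simp add: K.abs_norm_nat_pow[OF ext_integral[OF k.prime_integral[OF p]]])
qed

lemma val_conj_norm_prime_proportional:
  assumes P: "P \<in> primes_of K"
  shows "K.val (conj_norm P) Q * K.val (ext (contraction P)) P =
    K.val (conj_norm P) P * K.val (ext (contraction P)) Q"
proof (cases "\<exists>s\<in>\<G>. s ` P = Q")
  case True
  then obtain s where s: "s \<in> \<G>" "Q = s ` P" by blast
  note p = k.prime_frac[OF contraction_prime[OF P]]
  have "K.val (conj_norm P) Q = K.val (conj_norm P) P"
    using val_gal_image[OF s(1) conj_norm_frac[OF K.prime_frac[OF P]] P]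
    by (simp add: s(2) gal_image_conj_norm[OF s(1) K.prime_frac[OF P]])
  moreover have "K.val (ext (contraction P)) Q = K.val (ext (contraction P)) P"
    using val_gal_image[OF s(1) ext_frac[OF p] P] by (simp add: s(2) gal_image_ext[OF s(1) p])
  ultimately show ?thesis by simp
next
  case False
  note p_integral = k.prime_integral[OF contraction_prime[OF P]]
  have "K.val (ext (contraction P)) Q = 0"
  proof (cases "Q \<in> primes_of K")
    case True
    then show ?thesis
      using gal_transitive[OF P True] False val_ext_prime_iff[OF True contraction_prime[OF P]]
        val_ext_nonneg[OF p_integral, of Q] by force
  next
    case notprime: False
    then show ?thesis using K.val_nonzero_prime[OF K.integral_frac[OF ext_integral[OF p_integral]]] by blast
  qed
  moreover have "{s \<in> \<G>. s ` P = Q} = {}" using False by blast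
  then have "K.val (conj_norm P) Q = 0" by (simp only: val_conj_norm_prime[OF P] card.empty of_nat_0)
  ultimately show ?thesis by simp
qed

text \<open>
  The valuations of both sides are proportional to those of \<open>ext (contraction P)\<close>, so one of them contains
  the other; they are equal because their absolute norms agree.
\<close>

lemma conj_norm_prime:
  assumes P: "P \<in> primes_of K"
  shows "conj_norm P = ext (contraction P) [^]\<^bsub>frac_group K\<^esub> res_degree K k P"
proof -
  let ?f = "int (res_degree K k P)" and ?a = "K.val (conj_norm P)" and ?e = "K.val (ext (contraction P))"
  let ?E = "ext (contraction P) [^]\<^bsub>frac_group K\<^esub> res_degree K k P"
  note ext_p_integral = ext_integral[OF k.prime_integral[OF contraction_prime[OF P]]]
  have N: "conj_norm P \<in> integral_ideals K" and E: "?E \<in> integral_ideals K"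
    by (rule conj_norm_integral(1)[OF K.prime_integral[OF P]], rule K.integral_nat_pow[OF ext_p_integral])
  note subset_iff = K.subset_iff_val[OF K.integral_frac K.integral_frac]
  have valE: "K.val ?E Q = ?f * ?e Q" for Q by (rule K.val_nat_pow[OF K.integral_frac[OF ext_p_integral]])
  have e: "?e Q \<ge> 0" "?e P > 0" for Q
    by (rule K.val_integral_nonneg[OF ext_p_integral], rule val_ext_contraction_pos[OF P])
  note proportional = val_conj_norm_prime_proportional[OF P]
  consider (le) "?a P \<le> ?f * ?e P" | (ge) "?f * ?e P \<le> ?a P" by linarith
  then show ?thesis
  proof cases
    case le
    have "?a Q * ?e P \<le> (?f * ?e Q) * ?e P" for Q
      using mult_right_mono[OF le e(1)[of Q]] by (simp add: proportional mult_ac)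
    then have "?E \<subseteq> conj_norm P" unfolding subset_iff[OF E N] valE using e(2) by (simp add: mult_le_cancel_right)
    then show ?thesis using K.abs_norm_eq_imp_eq[OF E N] abs_norm_conj_norm_prime[OF P] by simp
  next
    case ge
    have "(?f * ?e Q) * ?e P \<le> ?a Q * ?e P" for Q
      using mult_right_mono[OF ge e(1)[of Q]] by (simp add: proportional mult_ac)
    then have "conj_norm P \<subseteq> ?E" unfolding subset_iff[OF N E] valE using e(2) by (simp add: mult_le_cancel_right)
    then show ?thesis by (rule K.abs_norm_eq_imp_eq[OF N E _ abs_norm_conj_norm_prime[OF P]])
  qed
qed

lemma contraction_nat_pow_frac:
  "P \<in> primes_of K \<Longrightarrow> contraction P [^]\<^bsub>frac_group k\<^esub> (m::nat) \<in> frac_ideals k"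
  using Ik.nat_pow_closed[of "contraction P" m] k.prime_frac[OF contraction_prime] by simp

lemma ideal_norm_eq_pow_prod:
  assumes A: "A \<in> frac_ideals K"
  shows "ideal_norm K k A =
    pow_prod (frac_group k) (\<lambda>P. contraction P [^]\<^bsub>frac_group k\<^esub> res_degree K k P) (K.val A)"
proof -
  have supp: "{P \<in> primes_of K. K.val A P \<noteq> 0} = {P. K.val A P \<noteq> 0}" using K.val_nonzero_prime[OF A] by blast
  have "contraction P [^]\<^bsub>frac_group k\<^esub> (int (res_degree K k P) * K.val A P) =
      (contraction P [^]\<^bsub>frac_group k\<^esub> res_degree K k P) [^]\<^bsub>frac_group k\<^esub> K.val A P"
    if "P \<in> primes_of K" for P
    using Ik.int_pow_pow[of "contraction P" "int (res_degree K k P)" "K.val A P"]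
      k.prime_frac[OF contraction_prime[OF that]] by (simp add: int_pow_int)
  then show ?thesis
    unfolding ideal_norm_def pow_prod_def supp contraction_def[symmetric]
    using contraction_nat_pow_frac K.val_nonzero_prime[OF A] k.frac_int_pow_closed
    by (intro Ik.finprod_cong'[OF refl]) auto
qed

lemma ideal_norm_frac: "A \<in> frac_ideals K \<Longrightarrow> ideal_norm K k A \<in> frac_ideals k"
  using Ik.pow_prod_closed[of "K.val A" "\<lambda>P. contraction P [^]\<^bsub>frac_group k\<^esub> res_degree K k P"]
    contraction_nat_pow_frac[OF K.val_nonzero_prime] by (simp add: ideal_norm_eq_pow_prod)

lemma ext_ideal_norm:
  assumes A: "A \<in> frac_ideals K"
  shows "ext (ideal_norm K k A) = conj_norm A"
proof -
  let ?u = "\<lambda>P. contraction P [^]\<^bsub>frac_group k\<^esub> res_degree K k P"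
  note prime = K.val_nonzero_prime[OF A] and fin = K.val_finite[OF A]
  have "ext (ideal_norm K k A) = pow_prod (frac_group K) (\<lambda>P. ext (?u P)) (K.val A)"
    unfolding ideal_norm_eq_pow_prod[OF A]
    by (rule Ik.hom_pow_prod[OF K.comm_group_frac ext_hom fin]) (use contraction_nat_pow_frac prime in simp)
  also have "\<dots> = pow_prod (frac_group K) conj_norm (K.val A)"
  proof (rule IK.pow_prod_cong)
    fix P assume "K.val A P \<noteq> 0"
    then have P: "P \<in> primes_of K" by (rule prime)
    have "ext (?u P) = ext (contraction P) [^]\<^bsub>frac_group K\<^esub> res_degree K k P"
      using hom_nat_pow[OF ext_hom _ Ik.is_group IK.is_group, of "contraction P" "res_degree K k P"]
        k.prime_frac[OF contraction_prime[OF P]] by simp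
    then show "ext (?u P) = conj_norm P" using conj_norm_prime[OF P] by simp
    show "conj_norm P \<in> carrier (frac_group K)" using conj_norm_frac[OF K.prime_frac[OF P]] by simp
  qed
  also have "\<dots> = conj_norm (K.ideal_of (K.val A))"
    by (rule IK.hom_pow_prod[OF K.comm_group_frac conj_norm_hom fin, symmetric]) (use K.prime_frac prime in simp)
  finally show ?thesis by (simp only: K.ideal_of_val[OF A])
qed

lemma ideal_norm_mult:
  assumes A: "A \<in> frac_ideals K" and B: "B \<in> frac_ideals K"
  shows "ideal_norm K k (ideal_mult A B) = ideal_mult (ideal_norm K k A) (ideal_norm K k B)"
proof (rule ext_inject)
  show "ext (ideal_norm K k (ideal_mult A B)) = ext (ideal_mult (ideal_norm K k A) (ideal_norm K k B))"
    unfolding ext_mult ext_ideal_norm[OF A] ext_ideal_norm[OF B] ext_ideal_norm[OF K.ideal_mult_frac[OF A B]]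
    using hom_mult[OF conj_norm_hom, of A B] A B by simp
qed (use A B in \<open>simp_all add: ideal_norm_frac K.ideal_mult_frac k.ideal_mult_frac\<close>)

lemma ideal_norm_hom: "ideal_norm K k \<in> hom (frac_group K) (frac_group k)"
  by (simp add: hom_def ideal_norm_frac ideal_norm_mult)

lemma ideal_norm_inv:
  assumes "A \<in> frac_ideals K"
  shows "ideal_norm K k (inv\<^bsub>frac_group K\<^esub> A) = inv\<^bsub>frac_group k\<^esub> (ideal_norm K k A)"
proof -
  interpret group_hom "frac_group K" "frac_group k" "ideal_norm K k"
    by unfold_locales (rule ideal_norm_hom)
  show ?thesis using hom_inv assms by simp
qed

lemma ideal_norm_gal_image:
  assumes s: "s \<in> \<G>" and A: "A \<in> frac_ideals K"
  shows "ideal_norm K k (s ` A) = ideal_norm K k A"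
  by (rule ext_inject[OF ideal_norm_frac[OF gal_image_frac[OF s A]] ideal_norm_frac[OF A]])
     (simp only: ext_ideal_norm[OF A] ext_ideal_norm[OF gal_image_frac[OF s A]] conj_norm_gal_image[OF s A])

lemma ideal_norm_principal:
  assumes y: "y \<in> K" "y \<noteq> 0"
  shows "ideal_norm K k (principal K y) = principal k (elem_norm K k y)"
proof -
  note y_frac = K.principal_frac[OF y]
  have "principal k (elem_norm K k y) \<in> frac_ideals k"
    by (rule k.principal_frac[OF elem_norm_mem[OF y(1)] elem_norm_nonzero[OF y]])
  with ideal_norm_frac[OF y_frac] show ?thesis
    by (rule ext_inject) (simp only: ext_ideal_norm[OF y_frac] conj_norm_principal[OF y] ext_principal)
qed

end

section \<open>Hilbert 90 for ideals\<close>

text \<open>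
  Rounding down is harmless: if \<open>a\<close> has sum zero, a shift changes the sum of the partial sums by a multiple of \<open>n\<close>.
\<close>

definition mean_partial_sum :: "nat \<Rightarrow> (nat \<Rightarrow> int) \<Rightarrow> int" where
  "mean_partial_sum n a = (\<Sum>i<n. \<Sum>j<i. a j) div int n"

lemma mean_partial_sum_shift:
  assumes n: "n > 0" and total: "(\<Sum>i<n. a i) = 0"
  shows "mean_partial_sum n (\<lambda>i. a (Suc i)) = mean_partial_sum n a - a 0"
proof -
  have telescope: "(\<Sum>j<i. a (Suc j)) = (\<Sum>j<i. a j) + a i - a 0" for i
    using sum_lessThan_telescope[of a i] by (simp add: sum_subtractf)
  have "(\<Sum>i<n. \<Sum>j<i. a (Suc j)) = (\<Sum>i<n. \<Sum>j<i. a j) + int n * (- a 0)"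
    unfolding telescope using total by (simp add: sum.distrib sum_subtractf)
  then show ?thesis unfolding mean_partial_sum_def using n by (simp only: div_mult_self2)
qed

lemma mean_partial_sum_nonzero:
  assumes "mean_partial_sum n a \<noteq> 0"
  obtains i where "i < n" "a i \<noteq> 0"
proof -
  have "(\<Sum>i<n. \<Sum>j<i. a j) \<noteq> 0" using assms by (auto simp: mean_partial_sum_def)
  then obtain i where i: "i < n" "(\<Sum>j<i. a j) \<noteq> 0" by (meson lessThan_iff sum.neutral)
  then obtain j where "j < i" "a j \<noteq> 0" by (meson lessThan_iff sum.neutral)
  with i(1) show ?thesis by (intro that) auto
qed

locale cyclic_extension = galois_extension +
  fixes \<sigma> :: "'a \<Rightarrow> 'a"
  assumes generator: "\<sigma> \<in> \<G>" and cyclic: "\<G> = generate (gal_group K k) {\<sigma>}"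
begin

abbreviation \<sigma>_pow :: "nat \<Rightarrow> 'a \<Rightarrow> 'a" where "\<sigma>_pow i \<equiv> \<sigma> [^]\<^bsub>gal_group K k\<^esub> i"

lemma gal_power_mem: "\<sigma>_pow i \<in> \<G>"
  using generator by (rule G.nat_pow_closed)

lemma gal_power_bij: "bij_betw \<sigma>_pow {..<gal_order} \<G>"
proof -
  have "G.ord \<sigma> = gal_order" using G.generate_pow_card[OF generator] cyclic by simp
  then have "inj_on \<sigma>_pow {0..gal_order - 1}" using G.ord_inj[OF generator] by simp
  moreover have "{0..gal_order - 1} = {..<gal_order}" using gal_order_pos by auto
  ultimately have inj: "inj_on \<sigma>_pow {..<gal_order}" by simp
  have "\<sigma>_pow ` {..<gal_order} = \<G>"
    by (rule card_subset_eq[OF finite_gal]) (use gal_power_mem card_image[OF inj] in auto)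
  with inj show ?thesis by (simp add: bij_betw_def)
qed

lemma val_gal_power_shift:
  assumes A: "A \<in> frac_ideals K" and P: "P \<in> primes_of K"
  shows "K.val (\<sigma>_pow i ` A) (ginv \<sigma> ` P) = K.val (\<sigma>_pow (Suc i) ` A) P"
proof -
  have "\<sigma>_pow (Suc i) ` A = \<sigma> ` (\<sigma>_pow i ` A)"
    unfolding G.nat_pow_Suc2[OF generator] gal_image_comp[OF generator gal_power_mem K.frac_subset[OF A]] ..
  then show ?thesis by (simp add: val_gal_image_inv[OF generator gal_image_frac[OF gal_power_mem A] P])
qed

lemma sum_val_gal_powers:
  assumes A: "A \<in> frac_ideals K" and N: "ideal_norm K k A = Ok"
  shows "(\<Sum>i<gal_order. K.val (\<sigma>_pow i ` A) P) = 0"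
proof -
  have "(\<Sum>i<gal_order. K.val (\<sigma>_pow i ` A) P) = K.val (conj_norm A) P"
    unfolding val_conj_norm[OF A] by (rule sum.reindex_bij_betw[OF gal_power_bij])
  also have "conj_norm A = OK" using ext_ideal_norm[OF A] by (simp add: N ext_one)
  finally show ?thesis by (simp add: K.val_ints)
qed

text \<open>\<open>orbit_mean A\<close> is the divisor of an ideal \<open>B\<close> with \<open>A = B / \<sigma>(B)\<close> if \<open>A\<close> has norm one.\<close>

definition orbit_mean :: "'a set \<Rightarrow> 'a set \<Rightarrow> int" where
  "orbit_mean A P = mean_partial_sum gal_order (\<lambda>i. K.val (\<sigma>_pow i ` A) P)"

lemma orbit_mean_shift:
  assumes A: "A \<in> frac_ideals K" "ideal_norm K k A = Ok" and P: "P \<in> primes_of K"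
  shows "orbit_mean A (ginv \<sigma> ` P) = orbit_mean A P - K.val A P"
  using mean_partial_sum_shift[OF gal_order_pos sum_val_gal_powers[OF A]] gal_image_one[OF K.frac_subset[OF A(1)]]
  by (simp add: orbit_mean_def val_gal_power_shift[OF A(1) P] del: G.nat_pow_Suc)

lemma orbit_mean_nonzero:
  assumes "orbit_mean A P \<noteq> 0"
  obtains i where "i < gal_order" "K.val (\<sigma>_pow i ` A) P \<noteq> 0"
  using assms unfolding orbit_mean_def by (rule mean_partial_sum_nonzero)

lemma orbit_mean_divisor:
  assumes A: "A \<in> frac_ideals K"
  shows "K.divisor (orbit_mean A)"
proof -
  let ?S = "\<Union>i<gal_order. {P. K.val (\<sigma>_pow i ` A) P \<noteq> 0}"
  note frac = gal_image_frac[OF gal_power_mem A]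
  have "{P. orbit_mean A P \<noteq> 0} \<subseteq> ?S" by (auto elim: orbit_mean_nonzero)
  moreover have "finite ?S" using K.val_finite[OF frac] by blast
  moreover have "?S \<subseteq> primes_of K" using K.val_nonzero_prime[OF frac] by blast
  ultimately show ?thesis unfolding K.divisor_def using finite_subset by blast
qed

lemma ideal_hilbert_90:
  assumes A: "A \<in> frac_ideals K" and N: "ideal_norm K k A = Ok"
  obtains B where "B \<in> frac_ideals K" "K.val B = orbit_mean A" "A = ideal_mult B (inv\<^bsub>frac_group K\<^esub> (\<sigma> ` B))"
proof -
  define B where "B = K.ideal_of (orbit_mean A)"
  have B: "B \<in> frac_ideals K" and valB: "K.val B = orbit_mean A"
    unfolding B_def by (rule K.ideal_of_frac[OF orbit_mean_divisor[OF A]], rule K.val_ideal_of[OF orbit_mean_divisor[OF A]])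
  note sB = gal_image_frac[OF generator B]
  let ?C = "ideal_mult B (inv\<^bsub>frac_group K\<^esub> (\<sigma> ` B))"
  have C: "?C \<in> frac_ideals K" by (rule K.ideal_mult_frac[OF B K.frac_inv_closed[OF sB]])
  have "K.val A P = K.val ?C P" for P
  proof (cases "P \<in> primes_of K")
    case True
    have "K.val ?C P = orbit_mean A P - K.val (\<sigma> ` B) P"
      by (simp add: K.val_mult[OF B K.frac_inv_closed[OF sB]] K.val_inv[OF sB] valB)
    also have "K.val (\<sigma> ` B) P = orbit_mean A (ginv \<sigma> ` P)"
      by (simp only: val_gal_image_inv[OF generator B True] valB)
    finally show ?thesis by (simp add: orbit_mean_shift[OF A N True])
  next
    case False
    then show ?thesis using K.val_nonzero_prime[OF A] K.val_nonzero_prime[OF C] by metis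
  qed
  then have "A = ?C" by (intro K.val_inject[OF A C] HOL.ext)
  with B valB show ?thesis by (rule that)
qed

end

section \<open>Ray class groups\<close>

context subfield_set
begin

lemma tot_pos_one: "1 \<in> tot_pos F"
  by (simp add: tot_pos_iff one_mem subfield_hom.hom_one)

lemma tot_pos_mult:
  assumes "x \<in> tot_pos F" "y \<in> tot_pos F"
  shows "x * y \<in> tot_pos F"
  using assms unfolding tot_pos_iff by (simp add: mult_mem subfield_hom.hom_mult)

lemma tot_pos_inverse:
  assumes "x \<in> tot_pos F"
  shows "inverse x \<in> tot_pos F"
  using assms unfolding tot_pos_iff by (simp add: inverse_mem subfield_hom.hom_inverse)

end

context number_field_set
begin

interpretation I: comm_group "frac_group F" by (rule comm_group_frac)

lemma cong_one_iff:
  "cong_one F m x \<longleftrightarrow> x = 1 \<or> (\<forall>P\<in>supp F m. val m P \<le> elem_val F (x - 1) P)"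
  by (simp add: cong_one_def)

lemma cong_one_mult:
  assumes x: "x \<in> F" "x \<noteq> 0" "\<And>P. P \<in> supp F m \<Longrightarrow> elem_val F x P = 0" "cong_one F m x"
    and y: "y \<in> F" "cong_one F m y"
  shows "cong_one F m (x * y)"
proof (cases "x = 1 \<or> y = 1 \<or> x * y = 1")
  case True
  then show ?thesis using x(4) y(2) by (auto simp: cong_one_iff)
next
  case False
  have "val m P \<le> elem_val F (x * y - 1) P" if P: "P \<in> supp F m" for P
  proof -
    have "val m P \<le> elem_val F (x * (y - 1)) P"
      using elem_val_mult[OF x(1,2) diff_mem[OF y(1) one_mem], of P] x(3)[OF P] y(2) P False
      by (auto simp: cong_one_iff)
    moreover have "val m P \<le> elem_val F (x - 1) P" using x(4) P False by (auto simp: cong_one_iff)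
    ultimately have "val m P \<le> elem_val F (x * (y - 1) + (x - 1)) P"
      using False x y by (intro elem_val_add) (auto intro!: mult_mem diff_mem one_mem simp: algebra_simps)
    then show ?thesis by (simp add: algebra_simps)
  qed
  then show ?thesis by (simp add: cong_one_iff)
qed

lemma cong_one_inverse:
  assumes x: "x \<in> F" "x \<noteq> 0" "\<And>P. P \<in> supp F m \<Longrightarrow> elem_val F x P = 0" "cong_one F m x"
  shows "cong_one F m (inverse x)"
proof (cases "x = 1")
  case False
  have "elem_val F (inverse x - 1) P = elem_val F (x - 1) P" if P: "P \<in> supp F m" for P
  proof -
    have "inverse x - 1 = - (inverse x * (x - 1))" using x(2) by (simp add: algebra_simps)
    then have "elem_val F (inverse x - 1) P = elem_val F (inverse x * (x - 1)) P"
      by (simp only: elem_val_uminus)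
    also have "\<dots> = elem_val F (x - 1) P"
      using elem_val_mult[OF inverse_mem[OF x(1)] _ diff_mem[OF x(1) one_mem], of P] False x(2)
        elem_val_inverse[OF x(1,2), of P] x(3)[OF P] by simp
    finally show ?thesis .
  qed
  then show ?thesis using x(4) False by (auto simp: cong_one_iff)
qed (simp add: cong_one_iff)

lemma ray_elems_subset: "x \<in> ray_elems F m \<Longrightarrow> x \<in> F"
  and ray_elems_nonzero: "x \<in> ray_elems F m \<Longrightarrow> x \<noteq> 0"
  by (simp_all add: ray_elems_def tot_pos_subset tot_pos_nonzero)

lemma ray_elems_one: "1 \<in> ray_elems F m"
  by (simp add: ray_elems_def tot_pos_one elem_val_one cong_one_iff)

lemma ray_elems_mult:
  assumes x: "x \<in> ray_elems F m" and y: "y \<in> ray_elems F m"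
  shows "x * y \<in> ray_elems F m"
  using x y ray_elems_subset[OF x] ray_elems_nonzero[OF x] ray_elems_subset[OF y] ray_elems_nonzero[OF y]
    cong_one_mult[of x m y]
  by (simp add: ray_elems_def tot_pos_mult elem_val_mult)

lemma ray_elems_inverse:
  assumes x: "x \<in> ray_elems F m"
  shows "inverse x \<in> ray_elems F m"
  using x ray_elems_subset[OF x] ray_elems_nonzero[OF x] cong_one_inverse[of x m]
  by (simp add: ray_elems_def tot_pos_inverse elem_val_inverse)

lemma ray_elems_prod: "(\<And>i. i \<in> S \<Longrightarrow> f i \<in> ray_elems F m) \<Longrightarrow> prod f S \<in> ray_elems F m"
  by (induction S rule: infinite_finite_induct) (auto simp: ray_elems_one ray_elems_mult)

lemma principal_eq_ints_iff:
  assumes "x \<in> F" "x \<noteq> 0"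
  shows "principal F x = \<O> \<longleftrightarrow> x \<in> Units (ring_on \<O>)"
proof
  assume eq: "principal F x = \<O>"
  have "x \<in> \<O>" using eq ints_one by (force simp: principal_iff)
  moreover have "1 \<in> principal F x" using eq ints_one by simp
  then obtain r where "r \<in> \<O>" "1 = x * r" by (auto simp: principal_iff)
  ultimately show "x \<in> Units (ring_on \<O>)" by (auto simp: Units_def mult.commute intro!: bexI[of _ r])
next
  assume "x \<in> Units (ring_on \<O>)"
  then obtain r where r: "x \<in> \<O>" "r \<in> \<O>" "x * r = 1" by (auto simp: Units_def)
  have "1 \<in> principal F x" using r by (force simp: principal_iff)
  then show "principal F x = \<O>" by (rule integral_eq_ints[OF principal_integral[OF r(1) assms(2)]])
qed

lemma ray_units_iff: "x \<in> ray_units F m \<longleftrightarrow> x \<in> ray_elems F m \<and> principal F x = \<O>"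
proof -
  have "x \<in> ray_units F m \<longleftrightarrow> x \<in> tot_pos F \<and> principal F x = \<O> \<and> cong_one F m x"
    using principal_eq_ints_iff[OF tot_pos_subset tot_pos_nonzero] by (auto simp: ray_units_def)
  then show ?thesis by (auto simp: ray_elems_def elem_val_def val_ints)
qed

lemma ideal_group_iff: "A \<in> carrier (ideal_group F T) \<longleftrightarrow> A \<in> frac_ideals F \<and> (\<forall>P\<in>T. val A P = 0)"
  by (simp add: ideal_group_def)

lemma ideal_group_simps [simp]:
  "A \<otimes>\<^bsub>ideal_group F T\<^esub> B = ideal_mult A B" "\<one>\<^bsub>ideal_group F T\<^esub> = \<O>"
  by (simp_all add: ideal_group_def)

lemma ideal_group_frac: "A \<in> carrier (ideal_group F T) \<Longrightarrow> A \<in> frac_ideals F"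
  by (simp add: ideal_group_iff)

lemma ideal_group_subgroup: "subgroup (carrier (ideal_group F T)) (frac_group F)"
proof (rule I.subgroupI)
  have "\<O> \<in> carrier (ideal_group F T)"
    by (simp add: ideal_group_iff val_ints integral_frac[OF ints_integral])
  then show "carrier (ideal_group F T) \<noteq> {}" by blast
qed (auto simp: ideal_group_iff val_inv frac_inv_closed val_mult ideal_mult_frac)

lemma comm_group_ideal_group: "comm_group (ideal_group F T)"
proof -
  have "group (ideal_group F T)"
    using I.subgroup_imp_group[OF ideal_group_subgroup[of T]] by (simp add: ideal_group_def)
  then show ?thesis by (rule group.group_comm_groupI) (simp only: ideal_group_simps ideal_mult_commute)
qed

lemma ideal_group_inv:
  assumes "A \<in> carrier (ideal_group F T)"
  shows "inv\<^bsub>ideal_group F T\<^esub> A = inv\<^bsub>frac_group F\<^esub> A"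
  using I.m_inv_consistent[OF ideal_group_subgroup assms] by (simp add: ideal_group_def)

lemma principal_ideal_group:
  assumes x: "x \<in> ray_elems F m"
  shows "principal F x \<in> carrier (ideal_group F (supp F m))"
  using x principal_frac[OF ray_elems_subset[OF x] ray_elems_nonzero[OF x]]
  by (simp add: ideal_group_iff ray_elems_def elem_val_def)

lemma ray_group_subgroup: "subgroup (ray_group F m) (ideal_group F (supp F m))"
proof -
  interpret J: comm_group "ideal_group F (supp F m)" by (rule comm_group_ideal_group)
  show ?thesis
  proof (rule J.subgroupI)
    show "ray_group F m \<subseteq> carrier (ideal_group F (supp F m))"
      using principal_ideal_group by (auto simp: ray_group_def)
    show "ray_group F m \<noteq> {}" using ray_elems_one by (auto simp: ray_group_def)
    fix A assume "A \<in> ray_group F m"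
    then obtain x where x: "x \<in> ray_elems F m" "A = principal F x" by (auto simp: ray_group_def)
    then have "inv\<^bsub>ideal_group F (supp F m)\<^esub> A = principal F (inverse x)"
      using principal_inverse[OF ray_elems_subset ray_elems_nonzero]
      by (simp add: ideal_group_inv[OF principal_ideal_group])
    then show "inv\<^bsub>ideal_group F (supp F m)\<^esub> A \<in> ray_group F m"
      using ray_elems_inverse[OF x(1)] by (simp add: ray_group_def)
    fix B assume "B \<in> ray_group F m"
    then obtain y where y: "y \<in> ray_elems F m" "B = principal F y" by (auto simp: ray_group_def)
    then show "A \<otimes>\<^bsub>ideal_group F (supp F m)\<^esub> B \<in> ray_group F m"
      using ray_elems_mult[OF x(1)] by (simp add: ray_group_def x(2) principal_mult[symmetric])
  qed
qed

lemma comm_group_ray_class_group: "comm_group (ray_class_group F m)"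
  unfolding ray_class_group_def
  by (rule comm_group.abelian_FactGroup[OF comm_group_ideal_group ray_group_subgroup])

lemma ray_class_hom: "group_hom (ideal_group F (supp F m)) (ray_class_group F m) (ray_class F m)"
proof -
  interpret J: comm_group "ideal_group F (supp F m)" by (rule comm_group_ideal_group)
  interpret C: comm_group "ray_class_group F m" by (rule comm_group_ray_class_group)
  show ?thesis
    using normal.r_coset_hom_Mod[OF J.subgroup_imp_normal[OF ray_group_subgroup[of m]]]
    by unfold_locales (simp add: ray_class_group_def ray_class_def[abs_def])
qed

lemma carrier_ray_class_group:
  "carrier (ray_class_group F m) = ray_class F m ` carrier (ideal_group F (supp F m))"
  by (auto simp: ray_class_group_def carrier_FactGroup ray_class_def)

lemma mem_ray_class_iff: "B \<in> ray_class F m A \<longleftrightarrow> (\<exists>y\<in>ray_elems F m. B = ideal_mult (principal F y) A)"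
  by (auto simp: ray_class_def r_coset_def ray_group_def)

lemma mem_ray_class_self:
  assumes "A \<in> carrier (ideal_group F (supp F m))"
  shows "A \<in> ray_class F m A"
  using group.rcos_self[OF comm_group.axioms(2)[OF comm_group_ideal_group] assms ray_group_subgroup]
  by (simp add: ray_class_def)

lemma ray_class_eq_iff:
  assumes A: "A \<in> carrier (ideal_group F (supp F m))" and B: "B \<in> carrier (ideal_group F (supp F m))"
  shows "ray_class F m A = ray_class F m B \<longleftrightarrow> (\<exists>y\<in>ray_elems F m. A = ideal_mult (principal F y) B)"
proof -
  interpret J: comm_group "ideal_group F (supp F m)" by (rule comm_group_ideal_group)
  have "ray_class F m A = ray_class F m B \<longleftrightarrow> A \<in> ray_class F m B"
    using mem_ray_class_self[OF A] J.repr_independence[OF _ B ray_group_subgroup, of A]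
    by (auto simp: ray_class_def)
  then show ?thesis by (simp only: mem_ray_class_iff)
qed

lemma ray_class_eq_one_iff:
  assumes A: "A \<in> carrier (ideal_group F (supp F m))"
  shows "ray_class F m A = \<one>\<^bsub>ray_class_group F m\<^esub> \<longleftrightarrow> (\<exists>y\<in>ray_elems F m. A = principal F y)"
proof -
  interpret group_hom "ideal_group F (supp F m)" "ray_class_group F m" "ray_class F m" by (rule ray_class_hom)
  have "ray_class F m A = ray_class F m \<O> \<longleftrightarrow> (\<exists>y\<in>ray_elems F m. A = ideal_mult (principal F y) \<O>)"
    using ray_class_eq_iff[OF A] G.one_closed by simp
  then show ?thesis
    using hom_one ideal_mult_ints[OF principal_frac[OF ray_elems_subset ray_elems_nonzero]] by simp
qed

end

section \<open>Ray class groups in Galois extensions\<close>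

context galois_extension
begin

lemma elem_val_gal:
  assumes s: "s \<in> \<G>" and x: "x \<in> K" "x \<noteq> 0" and P: "P \<in> primes_of K"
  shows "elem_val K (s x) P = elem_val K x (ginv s ` P)"
  unfolding elem_val_def gal_image_principal[OF s x(1), symmetric]
  by (rule val_gal_image_inv[OF s K.principal_frac[OF x] P])

lemma elem_val_base:
  assumes x: "x \<in> k" "x \<noteq> 0" and P: "P \<in> primes_of K"
  shows "elem_val K x P = elem_val k x (contraction P) * K.val (ext (contraction P)) P"
  unfolding elem_val_def ext_principal[symmetric] by (rule val_ext[OF P k.principal_frac[OF x]])

end

locale ray_extension = galois_extension +
  fixes \<mm> :: "'a set"
  assumes modulus: "\<mm> \<in> integral_ideals k"
begin

abbreviation "\<mm>K \<equiv> modulus_ext K \<mm>"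
abbreviation "T \<equiv> supp k \<mm>"
abbreviation "TK \<equiv> supp K \<mm>K"
abbreviation "IK \<equiv> ideal_group K TK"
abbreviation "Ik \<equiv> ideal_group k T"
abbreviation "UK \<equiv> ray_elems K \<mm>K"
abbreviation "Uk \<equiv> ray_elems k \<mm>"
abbreviation "ClK \<equiv> ray_class_group K \<mm>K"
abbreviation "Clk \<equiv> ray_class_group k \<mm>"
abbreviation "classK \<equiv> ray_class K \<mm>K"
abbreviation "classk \<equiv> ray_class k \<mm>"
abbreviation "N \<equiv> ideal_norm K k"

lemma modulus_ext_integral: "\<mm>K \<in> integral_ideals K"
  by (rule ext_integral[OF modulus])

lemmas modulus_frac = k.integral_frac[OF modulus]
lemmas modulus_ext_frac = K.integral_frac[OF modulus_ext_integral]

lemma supp_ext_iff: "P \<in> TK \<longleftrightarrow> P \<in> primes_of K \<and> contraction P \<in> T"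
proof -
  have "K.val \<mm>K P \<noteq> 0 \<longleftrightarrow> k.val \<mm> (contraction P) \<noteq> 0" if "P \<in> primes_of K"
    using val_ext[OF that modulus_frac] val_ext_contraction_pos[OF that] by simp
  then show ?thesis
    using K.supp_iff_val[OF modulus_ext_integral] k.supp_iff_val[OF modulus] K.val_nonzero_prime[OF modulus_ext_frac]
    by auto
qed

lemma supp_ext_prime: "P \<in> TK \<Longrightarrow> P \<in> primes_of K"
  by (simp add: supp_ext_iff)

lemma gal_image_supp_ext: "s \<in> \<G> \<Longrightarrow> P \<in> TK \<Longrightarrow> s ` P \<in> TK"
  by (simp add: supp_ext_iff gal_image_prime contraction_gal_image)

lemma ex_prime_over_supp:
  assumes "q \<in> T"
  obtains P where "P \<in> TK" "contraction P = q"
proof -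
  have "q \<in> primes_of k" using assms by (simp add: supp_def)
  then obtain P where "P \<in> primes_of K" "contraction P = q" by (rule ex_prime_over)
  with assms show ?thesis by (intro that) (auto simp: supp_ext_iff)
qed

lemma gal_image_ideal_group:
  assumes s: "s \<in> \<G>" and A: "A \<in> carrier IK"
  shows "s ` A \<in> carrier IK"
  using A gal_image_frac[OF s] val_gal_image_inv[OF s _ supp_ext_prime] gal_image_supp_ext[OF G.inv_closed[OF s]]
  by (simp add: K.ideal_group_iff)

lemma ideal_norm_ideal_group:
  assumes A: "A \<in> carrier IK"
  shows "N A \<in> carrier Ik"
proof -
  note A_frac = K.ideal_group_frac[OF A]
  have "k.val (N A) q = 0" if q: "q \<in> T" for q
  proof -
    obtain P where P: "P \<in> TK" "contraction P = q" by (rule ex_prime_over_supp[OF q])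
    have "K.val (conj_norm A) P = 0" unfolding val_conj_norm[OF A_frac]
      using gal_image_ideal_group[OF _ A] P(1) by (intro sum.neutral) (simp add: K.ideal_group_iff)
    then show ?thesis
      using val_ext[OF supp_ext_prime[OF P(1)] ideal_norm_frac[OF A_frac]] val_ext_contraction_pos[OF supp_ext_prime[OF P(1)]]
      by (simp add: ext_ideal_norm[OF A_frac] P(2))
  qed
  then show ?thesis using ideal_norm_frac[OF A_frac] by (simp add: k.ideal_group_iff)
qed

lemma gal_cong_one:
  assumes s: "s \<in> \<G>" and y: "y \<in> K" "cong_one K \<mm>K y"
  shows "cong_one K \<mm>K (s y)"
proof (cases "y = 1")
  case False
  interpret s: subfield_hom K s by (rule gal_hom[OF s])
  have "K.val \<mm>K P \<le> elem_val K (s y - 1) P" if P: "P \<in> TK" for P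
  proof -
    have "elem_val K (s y - 1) P = elem_val K (y - 1) (ginv s ` P)"
      using elem_val_gal[OF s K.diff_mem[OF y(1) K.one_mem] _ supp_ext_prime[OF P]] False
      by (simp add: s.hom_diff y(1) K.one_mem s.hom_one)
    moreover have "K.val \<mm>K P = K.val \<mm>K (ginv s ` P)"
      using val_gal_image_inv[OF s modulus_ext_frac supp_ext_prime[OF P]] gal_image_ext[OF s modulus_frac] by simp
    ultimately show ?thesis
      using y(2) False gal_image_supp_ext[OF G.inv_closed[OF s] P] by (simp add: K.cong_one_iff)
  qed
  then show ?thesis by (simp add: K.cong_one_iff)
qed (simp add: K.cong_one_iff subfield_hom.hom_one[OF gal_hom[OF s]])

lemma gal_ray_elems:
  assumes s: "s \<in> \<G>" and y: "y \<in> UK"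
  shows "s y \<in> UK"
proof -
  note yK = K.ray_elems_subset[OF y] K.ray_elems_nonzero[OF y]
  have "elem_val K (s y) P = 0" if "P \<in> TK" for P
    using elem_val_gal[OF s yK supp_ext_prime[OF that]] y gal_image_supp_ext[OF G.inv_closed[OF s] that]
    by (simp add: ray_elems_def)
  then show ?thesis
    using y gal_tot_pos[OF s] gal_cong_one[OF s yK(1)] by (simp add: ray_elems_def)
qed

lemma cong_one_base:
  assumes x: "x \<in> k" "cong_one K \<mm>K x"
  shows "cong_one k \<mm> x"
proof (cases "x = 1")
  case False
  have "k.val \<mm> q \<le> elem_val k (x - 1) q" if q: "q \<in> T" for q
  proof -
    obtain P where P: "P \<in> TK" "contraction P = q" by (rule ex_prime_over_supp[OF q])
    note prime = supp_ext_prime[OF P(1)]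
    have "K.val \<mm>K P \<le> elem_val K (x - 1) P" using x(2) P(1) False by (simp add: K.cong_one_iff)
    then show ?thesis
      using elem_val_base[OF k.diff_mem[OF x(1) k.one_mem] _ prime] val_ext[OF prime modulus_frac]
        val_ext_contraction_pos[OF prime] False by (simp add: P(2))
  qed
  then show ?thesis by (simp add: k.cong_one_iff)
qed (simp add: k.cong_one_iff)

lemma ray_elems_base:
  assumes x: "x \<in> tot_pos k" "x \<in> UK"
  shows "x \<in> Uk"
proof -
  note xk = k.tot_pos_subset[OF x(1)] k.tot_pos_nonzero[OF x(1)]
  have "elem_val k x q = 0" if q: "q \<in> T" for q
  proof -
    obtain P where P: "P \<in> TK" "contraction P = q" by (rule ex_prime_over_supp[OF q])
    note prime = supp_ext_prime[OF P(1)]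
    have "elem_val K x P = 0" using x(2) P(1) by (simp add: ray_elems_def)
    then show ?thesis using elem_val_base[OF xk prime] val_ext_contraction_pos[OF prime] by (simp add: P(2))
  qed
  then show ?thesis using x cong_one_base[OF xk(1)] by (simp add: ray_elems_def)
qed

lemma elem_norm_ray_elems:
  assumes y: "y \<in> UK"
  shows "elem_norm K k y \<in> Uk"
proof (rule ray_elems_base)
  show "elem_norm K k y \<in> tot_pos k" by (rule elem_norm_tot_pos) (use y in \<open>simp add: ray_elems_def\<close>)
  show "elem_norm K k y \<in> UK" unfolding elem_norm_def by (rule K.ray_elems_prod) (rule gal_ray_elems[OF _ y])
qed

lemma ideal_norm_principal_ray_elems: "y \<in> UK \<Longrightarrow> N (principal K y) = principal k (elem_norm K k y)"
  by (rule ideal_norm_principal[OF K.ray_elems_subset K.ray_elems_nonzero])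

sublocale ClK: comm_group ClK by (rule K.comm_group_ray_class_group)
sublocale Clk: comm_group Clk by (rule k.comm_group_ray_class_group)
sublocale IK: comm_group IK by (rule K.comm_group_ideal_group)
sublocale classK: group_hom IK ClK classK by (rule K.ray_class_hom)
sublocale classk: group_hom Ik Clk classk by (rule k.ray_class_hom)

lemma ray_class_cases:
  assumes "h \<in> carrier ClK"
  obtains A where "A \<in> carrier IK" "h = classK A"
  using assms by (auto simp: K.carrier_ray_class_group)

lemma class_act_ray_class:
  assumes s: "s \<in> \<G>" and A: "A \<in> carrier IK"
  shows "class_act s (classK A) = classK (s ` A)"
proof (rule Set.set_eqI)
  fix B
  have image: "s ` ideal_mult (principal K y) A = ideal_mult (principal K (s y)) (s ` A)" if y: "y \<in> UK" for y
    using gal_image_ideal_mult[OF s K.frac_subset K.frac_subset] K.ideal_group_frac[OF A]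
      K.ideal_group_frac[OF K.principal_ideal_group[OF y]] gal_image_principal[OF s K.ray_elems_subset[OF y]]
    by simp
  show "B \<in> class_act s (classK A) \<longleftrightarrow> B \<in> classK (s ` A)"
  proof
    assume "B \<in> class_act s (classK A)"
    then obtain y where "y \<in> UK" "B = s ` ideal_mult (principal K y) A"
      by (auto simp: class_act_def K.mem_ray_class_iff)
    then show "B \<in> classK (s ` A)" using image gal_ray_elems[OF s] by (auto simp: K.mem_ray_class_iff)
  next
    assume "B \<in> classK (s ` A)"
    then obtain y where y: "y \<in> UK" "B = ideal_mult (principal K y) (s ` A)" by (auto simp: K.mem_ray_class_iff)
    have z: "ginv s y \<in> UK" by (rule gal_ray_elems[OF G.inv_closed[OF s] y(1)])
    have "B = s ` ideal_mult (principal K (ginv s y)) A"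
      unfolding image[OF z] gal_apply_inv[OF s K.ray_elems_subset[OF y(1)]] by (rule y(2))
    moreover have "ideal_mult (principal K (ginv s y)) A \<in> classK A" using z by (auto simp: K.mem_ray_class_iff)
    ultimately show "B \<in> class_act s (classK A)" unfolding class_act_def by blast
  qed
qed

lemma class_norm_ray_class:
  assumes A: "A \<in> carrier IK"
  shows "class_norm K k \<mm> (classK A) = classk (N A)"
proof -
  have "classk (N B) = classk (N A)" if B: "B \<in> classK A" for B
  proof -
    obtain y where y: "y \<in> UK" "B = ideal_mult (principal K y) A" using B by (auto simp: K.mem_ray_class_iff)
    note yI = K.principal_ideal_group[OF y(1)]
    have "B \<in> carrier IK" using IK.m_closed[OF yI A] by (simp add: y(2))
    moreover have "N B = ideal_mult (principal k (elem_norm K k y)) (N A)"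
      unfolding y(2) ideal_norm_mult[OF K.ideal_group_frac[OF yI] K.ideal_group_frac[OF A]]
        ideal_norm_principal_ray_elems[OF y(1)] ..
    ultimately show ?thesis
      using k.ray_class_eq_iff[OF ideal_norm_ideal_group ideal_norm_ideal_group[OF A]] elem_norm_ray_elems[OF y(1)]
      by blast
  qed
  then show ?thesis unfolding class_norm_def using K.mem_ray_class_self[OF A] by blast
qed

lemma class_norm_hom: "class_norm K k \<mm> \<in> hom ClK Clk"
proof (rule homI)
  fix h assume "h \<in> carrier ClK"
  then obtain A where A: "A \<in> carrier IK" "h = classK A" by (rule ray_class_cases)
  note norm_A = class_norm_ray_class[OF A(1)] ideal_norm_ideal_group[OF A(1)]
  show "class_norm K k \<mm> h \<in> carrier Clk" unfolding A(2) norm_A(1) by (rule classk.hom_closed[OF norm_A(2)])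
  fix h' assume "h' \<in> carrier ClK"
  then obtain B where B: "B \<in> carrier IK" "h' = classK B" by (rule ray_class_cases)
  note norm_B = class_norm_ray_class[OF B(1)] ideal_norm_ideal_group[OF B(1)]
  have "class_norm K k \<mm> (h \<otimes>\<^bsub>ClK\<^esub> h') = classk (N (ideal_mult A B))"
    unfolding A(2) B(2) classK.hom_mult[OF A(1) B(1), symmetric] class_norm_ray_class[OF IK.m_closed[OF A(1) B(1)]]
    by simp
  also have "\<dots> = classk (N A \<otimes>\<^bsub>Ik\<^esub> N B)"
    using ideal_norm_mult[OF K.ideal_group_frac[OF A(1)] K.ideal_group_frac[OF B(1)]] by simp
  also have "\<dots> = class_norm K k \<mm> h \<otimes>\<^bsub>Clk\<^esub> class_norm K k \<mm> h'"
    unfolding A(2) B(2) norm_A(1) norm_B(1) by (rule classk.hom_mult[OF norm_A(2) norm_B(2)])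
  finally show "class_norm K k \<mm> (h \<otimes>\<^bsub>ClK\<^esub> h') = class_norm K k \<mm> h \<otimes>\<^bsub>Clk\<^esub> class_norm K k \<mm> h'" .
qed

lemma class_norm_eq_one_iff:
  assumes A: "A \<in> carrier IK"
  shows "class_norm K k \<mm> (classK A) = \<one>\<^bsub>Clk\<^esub> \<longleftrightarrow> (\<exists>x\<in>Uk. N A = principal k x)"
  unfolding class_norm_ray_class[OF A] by (rule k.ray_class_eq_one_iff[OF ideal_norm_ideal_group[OF A]])

end

section \<open>Homomorphisms induced by correspondences\<close>

locale group_correspondence = L: group L + Q: comm_group Q
  for L :: "('a, 'm) monoid_scheme" (structure) and Q :: "('b, 'n) monoid_scheme" (structure) +
  fixes R :: "'a \<Rightarrow> 'b \<Rightarrow> bool" and D :: "'b set"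
  assumes subgroup: "subgroup D Q"
    and closed: "R x q \<Longrightarrow> q \<in> carrier Q"
    and total: "x \<in> carrier L \<Longrightarrow> \<exists>q. R x q"
    and mult: "R x q \<Longrightarrow> R y r \<Longrightarrow> R (x \<otimes>\<^bsub>L\<^esub> y) (q \<otimes>\<^bsub>Q\<^esub> r)"
    and unique: "R x q \<Longrightarrow> R x r \<Longrightarrow> q \<otimes>\<^bsub>Q\<^esub> inv\<^bsub>Q\<^esub> r \<in> D"
begin

definition induced_map :: "'a \<Rightarrow> 'b set" where
  "induced_map x = D #>\<^bsub>Q\<^esub> (SOME q. R x q)"

lemma induced_map_eq:
  assumes q: "R x q"
  shows "induced_map x = D #>\<^bsub>Q\<^esub> q"
proof -
  let ?r = "SOME r. R x r"
  have r: "R x ?r" using q by (rule someI)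
  have "?r = (?r \<otimes>\<^bsub>Q\<^esub> inv\<^bsub>Q\<^esub> q) \<otimes>\<^bsub>Q\<^esub> q" using closed[OF q] closed[OF r] by (simp add: Q.m_assoc)
  then have "?r \<in> D #>\<^bsub>Q\<^esub> q" using unique[OF r q] unfolding r_coset_def by blast
  then show ?thesis
    unfolding induced_map_def by (rule Q.repr_independence[OF _ closed[OF q] subgroup, symmetric])
qed

lemma normal: "D \<lhd> Q"
  by (rule Q.subgroup_imp_normal[OF subgroup])

lemma induced_map_hom: "group_hom L (Q Mod D) induced_map"
proof -
  interpret Mod: group "Q Mod D" by (rule normal.factorgroup_is_group[OF normal])
  have coset: "group_hom Q (Q Mod D) (\<lambda>q. D #>\<^bsub>Q\<^esub> q)"
    using normal.r_coset_hom_Mod[OF normal] by unfold_locales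
  show ?thesis
  proof (unfold_locales, rule homI)
    fix x assume "x \<in> carrier L"
    then obtain q where q: "R x q" using total by blast
    show "induced_map x \<in> carrier (Q Mod D)"
      unfolding induced_map_eq[OF q] by (rule group_hom.hom_closed[OF coset closed[OF q]])
    fix y assume "y \<in> carrier L"
    then obtain r where r: "R y r" using total by blast
    show "induced_map (x \<otimes>\<^bsub>L\<^esub> y) = induced_map x \<otimes>\<^bsub>Q Mod D\<^esub> induced_map y"
      unfolding induced_map_eq[OF q] induced_map_eq[OF r] induced_map_eq[OF mult[OF q r]]
      by (rule group_hom.hom_mult[OF coset closed[OF q] closed[OF r]])
  qed
qed

lemma induced_map_surj:
  assumes onto: "\<And>q. q \<in> carrier Q \<Longrightarrow> \<exists>x\<in>carrier L. R x q"
  shows "induced_map ` carrier L = carrier (Q Mod D)"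
proof
  show "induced_map ` carrier L \<subseteq> carrier (Q Mod D)" using group_hom.hom_closed[OF induced_map_hom] by blast
  show "carrier (Q Mod D) \<subseteq> induced_map ` carrier L"
  proof
    fix c assume "c \<in> carrier (Q Mod D)"
    then obtain q where q: "q \<in> carrier Q" "c = D #>\<^bsub>Q\<^esub> q" by (auto simp: carrier_FactGroup)
    then obtain x where "x \<in> carrier L" "R x q" using onto by blast
    then show "c \<in> induced_map ` carrier L" using induced_map_eq q(2) by blast
  qed
qed

lemma mem_kernel_induced_map_iff:
  assumes "x \<in> carrier L" "R x q"
  shows "x \<in> kernel L (Q Mod D) induced_map \<longleftrightarrow> q \<in> D"
  using assms Q.coset_join1[OF _ closed[OF assms(2)] subgroup] Q.coset_join2[OF closed[OF assms(2)] subgroup]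
  by (auto simp: kernel_def induced_map_eq[OF assms(2)] FactGroup_def)

end

lemma mult_group_on_simps [simp]:
  "carrier (mult_group_on S) = S" "x \<otimes>\<^bsub>mult_group_on S\<^esub> y = x * y" "\<one>\<^bsub>mult_group_on S\<^esub> = 1"
  by (simp_all add: mult_group_on_def)

lemma group_mult_group_on:
  assumes "0 \<notin> S" "1 \<in> S" "\<And>x y. x \<in> S \<Longrightarrow> y \<in> S \<Longrightarrow> x * y \<in> S" "\<And>x. x \<in> S \<Longrightarrow> inverse x \<in> S"
  shows "group (mult_group_on S)"
proof (rule groupI)
  fix x assume "x \<in> carrier (mult_group_on S)"
  then have "x \<in> S" "x \<noteq> 0" using assms(1) by auto
  then show "\<exists>y\<in>carrier (mult_group_on S). y \<otimes>\<^bsub>mult_group_on S\<^esub> x = \<one>\<^bsub>mult_group_on S\<^esub>"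
    using assms(4) by (intro bexI[of _ "inverse x"]) simp_all
qed (use assms in \<open>auto simp: mult.assoc\<close>)

lemma short_exact_kernel:
  assumes hom: "group_hom (mult_group_on S) H f" and surj: "f ` S = carrier H"
  shows "short_exact (mult_group_on (kernel (mult_group_on S) H f)) (\<lambda>x. x) (mult_group_on S) f H"
proof -
  interpret f: group_hom "mult_group_on S" H f by (rule hom)
  let ?E = "kernel (mult_group_on S) H f"
  have "group ((mult_group_on S)\<lparr>carrier := ?E\<rparr>)" by (rule f.G.subgroup_imp_group[OF f.subgroup_kernel])
  then have "group (mult_group_on ?E)" by (simp add: mult_group_on_def)
  then have "group_hom (mult_group_on ?E) (mult_group_on S) (\<lambda>x. x)"
    by (auto simp: group_hom_def group_hom_axioms_def hom_def kernel_def f.G.is_group)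
  then show ?thesis using hom surj by (simp add: short_exact_def)
qed

lemma (in comm_group) hom_div_hom:
  assumes "f \<in> hom G G"
  shows "group_hom G G (\<lambda>x. x \<otimes> inv f x)"
proof -
  interpret f: group_hom G G f by unfold_locales (rule assms)
  show ?thesis by unfold_locales (auto simp: hom_def inv_mult m_ac)
qed

section \<open>The exact sequence\<close>

context ray_extension
begin

lemma class_act_hom:
  assumes s: "s \<in> \<G>"
  shows "class_act s \<in> hom ClK ClK"
proof (rule homI)
  fix h assume "h \<in> carrier ClK"
  then obtain A where A: "A \<in> carrier IK" "h = classK A" by (rule ray_class_cases)
  note sA = gal_image_ideal_group[OF s A(1)]
  show "class_act s h \<in> carrier ClK"
    unfolding A(2) class_act_ray_class[OF s A(1)] by (rule classK.hom_closed[OF sA])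
  fix h' assume "h' \<in> carrier ClK"
  then obtain B where B: "B \<in> carrier IK" "h' = classK B" by (rule ray_class_cases)
  have "s ` (A \<otimes>\<^bsub>IK\<^esub> B) = s ` A \<otimes>\<^bsub>IK\<^esub> s ` B"
    using gal_image_ideal_mult[OF s K.frac_subset K.frac_subset] K.ideal_group_frac[OF A(1)] K.ideal_group_frac[OF B(1)]
    by simp
  then show "class_act s (h \<otimes>\<^bsub>ClK\<^esub> h') = class_act s h \<otimes>\<^bsub>ClK\<^esub> class_act s h'"
    unfolding A(2) B(2) class_act_ray_class[OF s A(1)] class_act_ray_class[OF s B(1)]
      classK.hom_mult[OF A(1) B(1), symmetric] class_act_ray_class[OF s IK.m_closed[OF A(1) B(1)]]
    by (simp only: classK.hom_mult[OF sA gal_image_ideal_group[OF s B(1)]])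
qed

lemma ray_class_principal: "y \<in> UK \<Longrightarrow> classK (principal K y) = \<one>\<^bsub>ClK\<^esub>"
  using K.ray_class_eq_one_iff[OF K.principal_ideal_group] by blast

end

locale ray_exact_sequence = cyclic_extension K k \<sigma> + ray_extension K k \<mm>
  for K k :: "'a::field_char_0 set" and \<sigma> \<mm> +
  fixes \<I> :: "'a set set"
  assumes ideals: "subgroup \<I> IK"
begin

definition "H = classK ` \<I>"
definition "ideal_conj_quot B = B \<otimes>\<^bsub>IK\<^esub> inv\<^bsub>IK\<^esub> (\<sigma> ` B)"
definition "class_conj_quot h = h \<otimes>\<^bsub>ClK\<^esub> inv\<^bsub>ClK\<^esub> (class_act \<sigma> h)"
definition "H_tilde = {h \<in> carrier ClK. class_conj_quot h \<in> H}"
definition "D = class_conj_quot ` H_tilde"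
definition "NH = kernel (ClK\<lparr>carrier := H\<rparr>) Clk (class_norm K k \<mm>)"
definition "\<Lambda> = {x \<in> Uk. principal k x \<in> N ` \<I>}"

lemma ideals_mem: "A \<in> \<I> \<Longrightarrow> A \<in> carrier IK"
  using subgroup.subset[OF ideals] by blast

lemma ray_class_image_set_mult: "classK ` (\<I> <#>\<^bsub>IK\<^esub> ray_group K \<mm>K) = H"
proof
  have "classK (A \<otimes>\<^bsub>IK\<^esub> principal K y) = classK A" if "A \<in> \<I>" "y \<in> UK" for A y
    unfolding classK.hom_mult[OF ideals_mem[OF that(1)] K.principal_ideal_group[OF that(2)]] ray_class_principal[OF that(2)]
    by (rule ClK.r_one[OF classK.hom_closed[OF ideals_mem[OF that(1)]]])
  then show "classK ` (\<I> <#>\<^bsub>IK\<^esub> ray_group K \<mm>K) \<subseteq> H"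
    by (auto simp: set_mult_def ray_group_def H_def simp del: K.ideal_group_simps)
  have "A \<in> \<I> <#>\<^bsub>IK\<^esub> ray_group K \<mm>K" if A: "A \<in> \<I>" for A
  proof -
    have "A = A \<otimes>\<^bsub>IK\<^esub> \<one>\<^bsub>IK\<^esub>" using IK.r_one[OF ideals_mem[OF A]] by (rule sym)
    then show ?thesis using A subgroup.one_closed[OF K.ray_group_subgroup] unfolding set_mult_def by blast
  qed
  then show "H \<subseteq> classK ` (\<I> <#>\<^bsub>IK\<^esub> ray_group K \<mm>K)" by (auto simp: H_def)
qed

lemma subgroup_H: "subgroup H ClK"
  unfolding H_def by (rule classK.subgroup_img_is_subgroup[OF ideals])

lemma ideal_conj_quot_closed: "B \<in> carrier IK \<Longrightarrow> ideal_conj_quot B \<in> carrier IK"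
  unfolding ideal_conj_quot_def by (intro IK.m_closed IK.inv_closed gal_image_ideal_group[OF generator])

lemma class_conj_quot_ray_class:
  assumes B: "B \<in> carrier IK"
  shows "class_conj_quot (classK B) = classK (ideal_conj_quot B)"
  using B gal_image_ideal_group[OF generator B]
  by (simp add: class_conj_quot_def ideal_conj_quot_def class_act_ray_class[OF generator B] del: K.ideal_group_simps)

lemma ideal_norm_conj_quot:
  assumes B: "B \<in> carrier IK"
  shows "N (ideal_conj_quot B) = Ok"
proof -
  note sB = gal_image_ideal_group[OF generator B]
  note frac = K.ideal_group_frac[OF B] K.ideal_group_frac[OF sB]
  have "N (ideal_conj_quot B) = ideal_mult (N B) (inv\<^bsub>frac_group k\<^esub> (N B))"
    using ideal_norm_mult[OF frac(1) K.frac_inv_closed[OF frac(2)]] ideal_norm_inv[OF frac(2)]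
      ideal_norm_gal_image[OF generator frac(1)]
    by (simp add: ideal_conj_quot_def K.ideal_group_inv[OF sB])
  then show ?thesis by (simp only: k.frac_inv[OF ideal_norm_frac[OF frac(1)]])
qed

lemma class_conj_quot_hom: "group_hom ClK ClK class_conj_quot"
  using ClK.hom_div_hom[OF class_act_hom[OF generator]] by (simp add: class_conj_quot_def[abs_def])

lemma subgroup_H_tilde: "subgroup H_tilde ClK"
proof -
  interpret quot: group_hom ClK ClK class_conj_quot by (rule class_conj_quot_hom)
  interpret H: subgroup H ClK by (rule subgroup_H)
  show ?thesis unfolding H_tilde_def
    by (rule ClK.subgroupI) (auto intro: exI[of _ "\<one>\<^bsub>ClK\<^esub>"])
qed

lemma subgroup_D: "subgroup D ClK"
  unfolding D_def by (rule group_hom.subgroup_img_is_subgroup[OF class_conj_quot_hom subgroup_H_tilde])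

lemma mem_NH_iff: "h \<in> NH \<longleftrightarrow> h \<in> H \<and> class_norm K k \<mm> h = \<one>\<^bsub>Clk\<^esub>"
  by (simp add: NH_def kernel_def)

lemma ray_class_mem_NH_iff:
  "A \<in> carrier IK \<Longrightarrow> classK A \<in> NH \<longleftrightarrow> classK A \<in> H \<and> (\<exists>x\<in>Uk. N A = principal k x)"
  by (simp add: mem_NH_iff class_norm_eq_one_iff)

lemma subgroup_NH: "subgroup NH ClK"
proof -
  interpret H: group "ClK\<lparr>carrier := H\<rparr>" by (rule ClK.subgroup_imp_group[OF subgroup_H])
  have "class_norm K k \<mm> \<in> hom (ClK\<lparr>carrier := H\<rparr>) Clk"
    using hom_carrier[OF class_norm_hom] hom_mult[OF class_norm_hom] subgroup.mem_carrier[OF subgroup_H]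
    by (intro homI) (simp_all add: image_subset_iff)
  then have "group_hom (ClK\<lparr>carrier := H\<rparr>) Clk (class_norm K k \<mm>)" by unfold_locales
  then have "subgroup NH (ClK\<lparr>carrier := H\<rparr>)" unfolding NH_def by (rule group_hom.subgroup_kernel)
  then show ?thesis by (rule ClK.incl_subgroup[OF subgroup_H])
qed

lemma D_subset_NH: "D \<subseteq> NH"
proof
  fix d assume "d \<in> D"
  then obtain h where h: "h \<in> carrier ClK" "class_conj_quot h \<in> H" "d = class_conj_quot h"
    by (auto simp: D_def H_tilde_def)
  obtain B where B: "B \<in> carrier IK" "h = classK B" by (rule ray_class_cases[OF h(1)])
  have "N (ideal_conj_quot B) = principal k 1" by (simp add: ideal_norm_conj_quot[OF B(1)] k.principal_one)
  then show "d \<in> NH"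
    using h(2,3) k.ray_elems_one ray_class_mem_NH_iff[OF ideal_conj_quot_closed[OF B(1)]]
    unfolding B(2) class_conj_quot_ray_class[OF B(1)] by blast
qed

lemma norm_one_imp_ray_class_mem_D:
  assumes A: "A \<in> carrier IK" "N A = Ok" and H: "classK A \<in> H"
  shows "classK A \<in> D"
proof -
  obtain B where B: "B \<in> frac_ideals K" "K.val B = orbit_mean A"
    and AB: "A = ideal_mult B (inv\<^bsub>frac_group K\<^esub> (\<sigma> ` B))"
    by (rule ideal_hilbert_90[OF K.ideal_group_frac[OF A(1)] A(2)])
  have "orbit_mean A P = 0" if P: "P \<in> TK" for P
  proof (rule ccontr)
    assume "orbit_mean A P \<noteq> 0"
    then obtain i where "K.val (\<sigma>_pow i ` A) P \<noteq> 0" by (rule orbit_mean_nonzero)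
    then show False using gal_image_ideal_group[OF gal_power_mem A(1)] P by (simp add: K.ideal_group_iff)
  qed
  then have BI: "B \<in> carrier IK" using B by (simp add: K.ideal_group_iff)
  have "A = ideal_conj_quot B"
    using AB by (simp add: ideal_conj_quot_def K.ideal_group_inv[OF gal_image_ideal_group[OF generator BI]])
  then have eq: "classK A = class_conj_quot (classK B)" by (simp only: class_conj_quot_ray_class[OF BI])
  with H have "classK B \<in> H_tilde" using classK.hom_closed[OF BI] by (simp add: H_tilde_def)
  then show ?thesis unfolding D_def eq by (rule imageI)
qed

lemma ray_class_mem_D_imp_unit_norm:
  assumes A: "A \<in> \<I>" and x: "x \<in> Uk" "N A = principal k x" and D: "classK A \<in> D"
  shows "\<exists>\<epsilon> y. x = \<epsilon> * elem_norm K k y \<and> \<epsilon> \<in> ray_units k \<mm> \<and> y \<in> UK"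
proof -
  note AI = ideals_mem[OF A]
  obtain h where h: "h \<in> carrier ClK" "classK A = class_conj_quot h" using D by (auto simp: D_def H_tilde_def)
  obtain B where B: "B \<in> carrier IK" "h = classK B" by (rule ray_class_cases[OF h(1)])
  let ?B = "ideal_conj_quot B"
  have BI: "?B \<in> carrier IK" by (rule ideal_conj_quot_closed[OF B(1)])
  have "classK A = classK ?B" using h(2) by (simp only: B(2) class_conj_quot_ray_class[OF B(1)])
  then obtain y where y: "y \<in> UK" "A = ideal_mult (principal K y) ?B" using K.ray_class_eq_iff[OF AI BI] by blast
  let ?n = "elem_norm K k y"
  note n = elem_norm_ray_elems[OF y(1)]
  have "principal k x = ideal_mult (principal k ?n) Ok"
    unfolding x(2)[symmetric] y(2) ideal_norm_conj_quot[OF B(1), symmetric]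
      ideal_norm_principal_ray_elems[OF y(1), symmetric]
    by (rule ideal_norm_mult[OF K.ideal_group_frac[OF K.principal_ideal_group[OF y(1)]] K.ideal_group_frac[OF BI]])
  also have "\<dots> = principal k ?n" by (rule k.ideal_mult_ints[OF k.ideal_group_frac[OF k.principal_ideal_group[OF n]]])
  finally have "principal k (x * inverse ?n) = principal k (?n * inverse ?n)" by (simp only: k.principal_mult)
  then have "x * inverse ?n \<in> ray_units k \<mm>"
    using k.ray_elems_mult[OF x(1) k.ray_elems_inverse[OF n]] k.ray_elems_nonzero[OF n]
    by (simp add: k.ray_units_iff k.principal_one)
  moreover have "x = x * inverse ?n * ?n" using k.ray_elems_nonzero[OF n] by simp
  ultimately show ?thesis using y(1) by blast
qed

lemma unit_norm_imp_ray_class_mem_D: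
  assumes A: "A \<in> \<I>" "N A = principal k (\<epsilon> * elem_norm K k y)" and \<epsilon>: "\<epsilon> \<in> ray_units k \<mm>" and y: "y \<in> UK"
  shows "classK A \<in> D"
proof -
  note AI = ideals_mem[OF A(1)]
  let ?p = "principal K (inverse y)"
  have y': "inverse y \<in> UK" by (rule K.ray_elems_inverse[OF y])
  note pI = K.principal_ideal_group[OF y']
  have same_class: "classK (A \<otimes>\<^bsub>IK\<^esub> ?p) = classK A"
    unfolding classK.hom_mult[OF AI pI] ray_class_principal[OF y'] by (rule ClK.r_one[OF classK.hom_closed[OF AI]])
  have "elem_norm K k y * elem_norm K k (inverse y) = 1"
    using elem_norm_mult[of y "inverse y"] K.ray_elems_subset[OF y] K.ray_elems_nonzero[OF y] K.ray_elems_subset[OF y']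
    by (simp add: elem_norm_one)
  then have cancel: "\<epsilon> * elem_norm K k y * elem_norm K k (inverse y) = \<epsilon>" by (simp add: mult.assoc)
  have "N (A \<otimes>\<^bsub>IK\<^esub> ?p) = principal k (\<epsilon> * elem_norm K k y * elem_norm K k (inverse y))"
    using ideal_norm_mult[OF K.ideal_group_frac[OF AI] K.ideal_group_frac[OF pI]]
    by (simp add: A(2) ideal_norm_principal_ray_elems[OF y'] k.principal_mult[symmetric])
  then have "N (A \<otimes>\<^bsub>IK\<^esub> ?p) = Ok" using \<epsilon> unfolding cancel by (simp add: k.ray_units_iff)
  then have "classK (A \<otimes>\<^bsub>IK\<^esub> ?p) \<in> D"
    by (rule norm_one_imp_ray_class_mem_D[OF IK.m_closed[OF AI pI]]) (simp only: same_class H_def imageI[OF A(1)])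
  then show ?thesis by (simp only: same_class)
qed

definition norm_class_rel :: "'a \<Rightarrow> 'a set set \<Rightarrow> bool" where
  "norm_class_rel x h \<longleftrightarrow> x \<in> Uk \<and> (\<exists>A\<in>\<I>. N A = principal k x \<and> h = classK A)"

lemma norm_class_relE:
  assumes "norm_class_rel x h"
  obtains A where "x \<in> Uk" "A \<in> \<I>" "N A = principal k x" "h = classK A"
  using assms by (auto simp: norm_class_rel_def)

lemma norm_class_rel_nonzero: "norm_class_rel x h \<Longrightarrow> x \<noteq> 0"
  using k.ray_elems_nonzero by (auto elim: norm_class_relE)

lemma mem_\<Lambda>_iff: "x \<in> \<Lambda> \<longleftrightarrow> (\<exists>h. norm_class_rel x h)"
  by (auto simp: \<Lambda>_def norm_class_rel_def)

lemma mem_NH_iff_norm_class_rel: "h \<in> NH \<longleftrightarrow> (\<exists>x. norm_class_rel x h)"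
proof -
  have "h \<in> NH \<longleftrightarrow> (\<exists>A\<in>\<I>. h = classK A \<and> classK A \<in> NH)" by (auto simp: mem_NH_iff H_def)
  also have "\<dots> \<longleftrightarrow> (\<exists>x. norm_class_rel x h)"
    using ray_class_mem_NH_iff[OF ideals_mem] unfolding norm_class_rel_def H_def by blast
  finally show ?thesis .
qed

lemma norm_class_rel_mult:
  assumes "norm_class_rel x h" "norm_class_rel y h'"
  shows "norm_class_rel (x * y) (h \<otimes>\<^bsub>ClK\<^esub> h')"
proof -
  obtain A where A: "x \<in> Uk" "A \<in> \<I>" "N A = principal k x" "h = classK A" using assms(1) by (rule norm_class_relE)
  obtain B where B: "y \<in> Uk" "B \<in> \<I>" "N B = principal k y" "h' = classK B" using assms(2) by (rule norm_class_relE)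
  note I = ideals_mem[OF A(2)] ideals_mem[OF B(2)]
  have "N (A \<otimes>\<^bsub>IK\<^esub> B) = principal k (x * y)"
    using ideal_norm_mult[OF K.ideal_group_frac[OF I(1)] K.ideal_group_frac[OF I(2)]]
    by (simp add: A(3) B(3) k.principal_mult)
  moreover have "h \<otimes>\<^bsub>ClK\<^esub> h' = classK (A \<otimes>\<^bsub>IK\<^esub> B)" unfolding A(4) B(4) by (rule classK.hom_mult[OF I, symmetric])
  ultimately show ?thesis
    using k.ray_elems_mult[OF A(1) B(1)] subgroup.m_closed[OF ideals A(2) B(2)]
    unfolding norm_class_rel_def by blast
qed

lemma norm_class_rel_inverse:
  assumes "norm_class_rel x h"
  shows "norm_class_rel (inverse x) (inv\<^bsub>ClK\<^esub> h)"
proof -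
  obtain A where A: "x \<in> Uk" "A \<in> \<I>" "N A = principal k x" "h = classK A" using assms by (rule norm_class_relE)
  note I = ideals_mem[OF A(2)]
  have "N (inv\<^bsub>IK\<^esub> A) = principal k (inverse x)"
    using ideal_norm_inv[OF K.ideal_group_frac[OF I]] k.principal_inverse[OF k.ray_elems_subset[OF A(1)] k.ray_elems_nonzero[OF A(1)]]
    by (simp add: K.ideal_group_inv[OF I] A(3))
  moreover have "inv\<^bsub>ClK\<^esub> h = classK (inv\<^bsub>IK\<^esub> A)" unfolding A(4) by (rule classK.hom_inv[OF I, symmetric])
  ultimately show ?thesis
    using k.ray_elems_inverse[OF A(1)] subgroup.m_inv_closed[OF ideals A(2)] unfolding norm_class_rel_def by blast
qed

lemma norm_class_rel_one_imp_mem_D: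
  assumes "norm_class_rel 1 h"
  shows "h \<in> D"
proof -
  obtain A where A: "A \<in> \<I>" "N A = principal k 1" "h = classK A" using assms by (rule norm_class_relE)
  then show ?thesis
    using norm_one_imp_ray_class_mem_D[OF ideals_mem[OF A(1)]] by (simp add: k.principal_one H_def)
qed

lemma group_\<Lambda>: "group (mult_group_on \<Lambda>)"
proof (rule group_mult_group_on)
  show "0 \<notin> \<Lambda>" using norm_class_rel_nonzero by (auto simp: mem_\<Lambda>_iff)
  have "\<one>\<^bsub>ClK\<^esub> \<in> NH" by (rule subgroup.one_closed[OF subgroup_NH])
  then obtain x where x: "norm_class_rel x \<one>\<^bsub>ClK\<^esub>" by (auto simp: mem_NH_iff_norm_class_rel)
  from norm_class_rel_mult[OF x norm_class_rel_inverse[OF x]] norm_class_rel_nonzero[OF x]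
  show "1 \<in> \<Lambda>" by (auto simp: mem_\<Lambda>_iff)
qed (use norm_class_rel_mult norm_class_rel_inverse in \<open>unfold mem_\<Lambda>_iff, blast+\<close>)

sublocale correspondence: group_correspondence "mult_group_on \<Lambda>" "ClK\<lparr>carrier := NH\<rparr>" norm_class_rel D
proof -
  have NH: "group (ClK\<lparr>carrier := NH\<rparr>)" by (rule ClK.subgroup_imp_group[OF subgroup_NH])
  have "comm_group (ClK\<lparr>carrier := NH\<rparr>)"
    using subgroup.subset[OF subgroup_NH] ClK.m_comm by (intro group.group_comm_groupI[OF NH]) auto
  moreover have "group_correspondence_axioms (mult_group_on \<Lambda>) (ClK\<lparr>carrier := NH\<rparr>) norm_class_rel D"
  proof (rule group_correspondence_axioms.intro)
    show "subgroup D (ClK\<lparr>carrier := NH\<rparr>)" by (rule ClK.subgroup_incl[OF subgroup_D subgroup_NH D_subset_NH])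
    show "h \<otimes>\<^bsub>ClK\<lparr>carrier := NH\<rparr>\<^esub> inv\<^bsub>ClK\<lparr>carrier := NH\<rparr>\<^esub> h' \<in> D"
      if related: "norm_class_rel x h" "norm_class_rel x h'" for x h h'
    proof -
      have "h' \<in> NH" using related(2) by (auto simp: mem_NH_iff_norm_class_rel)
      moreover have "norm_class_rel 1 (h \<otimes>\<^bsub>ClK\<^esub> inv\<^bsub>ClK\<^esub> h')"
        using norm_class_rel_mult[OF related(1) norm_class_rel_inverse[OF related(2)]] norm_class_rel_nonzero[OF related(1)] by simp
      ultimately show ?thesis
        using norm_class_rel_one_imp_mem_D ClK.m_inv_consistent[OF subgroup_NH] by simp
    qed
  qed (auto simp: mem_NH_iff_norm_class_rel mem_\<Lambda>_iff norm_class_rel_mult)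
  ultimately show "group_correspondence (mult_group_on \<Lambda>) (ClK\<lparr>carrier := NH\<rparr>) norm_class_rel D"
    using group_\<Lambda> by (simp add: group_correspondence_def)
qed

abbreviation "\<phi> \<equiv> correspondence.induced_map"

lemma \<phi>_eq:
  assumes "x \<in> \<Lambda>" "A \<in> \<I>" "N A = principal k x"
  shows "\<phi> x = D #>\<^bsub>ClK\<^esub> classK A"
proof -
  have "norm_class_rel x (classK A)" using assms by (auto simp: norm_class_rel_def \<Lambda>_def)
  from correspondence.induced_map_eq[OF this] show ?thesis by (simp add: r_coset_def)
qed

lemma kernel_\<phi>:
  "kernel (mult_group_on \<Lambda>) (ClK\<lparr>carrier := NH\<rparr> Mod D) \<phi> =
    {\<epsilon> * elem_norm K k y | \<epsilon> y. \<epsilon> \<in> ray_units k \<mm> \<and> y \<in> UK} \<inter> \<Lambda>"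
proof -
  have "x \<in> kernel (mult_group_on \<Lambda>) (ClK\<lparr>carrier := NH\<rparr> Mod D) \<phi> \<longleftrightarrow>
      (\<exists>\<epsilon> y. x = \<epsilon> * elem_norm K k y \<and> \<epsilon> \<in> ray_units k \<mm> \<and> y \<in> UK)" if x: "x \<in> \<Lambda>" for x
  proof -
    obtain A where A: "x \<in> Uk" "A \<in> \<I>" "N A = principal k x" using x by (auto simp: \<Lambda>_def)
    then have "norm_class_rel x (classK A)" by (auto simp: norm_class_rel_def)
    then show ?thesis
      using correspondence.mem_kernel_induced_map_iff[of x "classK A"] x
        ray_class_mem_D_imp_unit_norm[OF A(2,1,3)] unit_norm_imp_ray_class_mem_D[OF A(2)] A(3)
      by (metis mult_group_on_simps(1))
  qed
  then show ?thesis by (auto simp: kernel_def)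
qed

lemma short_exact_\<phi>:
  "short_exact
    (mult_group_on ({\<epsilon> * elem_norm K k y | \<epsilon> y. \<epsilon> \<in> ray_units k \<mm> \<and> y \<in> UK} \<inter> \<Lambda>))
    (\<lambda>x. x) (mult_group_on \<Lambda>) \<phi> (ClK\<lparr>carrier := NH\<rparr> Mod D)"
  unfolding kernel_\<phi>[symmetric]
proof (rule short_exact_kernel[OF correspondence.induced_map_hom])
  have "\<exists>x\<in>\<Lambda>. norm_class_rel x h" if "h \<in> NH" for h
    using that unfolding mem_NH_iff_norm_class_rel mem_\<Lambda>_iff Bex_def by blast
  then show "\<phi> ` \<Lambda> = carrier (ClK\<lparr>carrier := NH\<rparr> Mod D)"
    using correspondence.induced_map_surj by simp
qed

end

theorem theorem3p3:
  fixes K k \<mm> :: "'a::field_char_0 set"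
    and \<sigma> :: "'a \<Rightarrow> 'a"
    and \<I> :: "'a set set"
  defines "G \<equiv> gal_group K k"
    and "\<mm>K \<equiv> modulus_ext K \<mm>"
  defines "IK \<equiv> ideal_group K (supp K \<mm>K)"
    and "ClK \<equiv> ray_class_group K \<mm>K"
    and "Clk \<equiv> ray_class_group k \<mm>"
  defines "H \<equiv> ray_class K \<mm>K ` (\<I> <#>\<^bsub>IK\<^esub> ray_group K \<mm>K)"
    and "\<delta> \<equiv> (\<lambda>h. h \<otimes>\<^bsub>ClK\<^esub> inv\<^bsub>ClK\<^esub> (class_act \<sigma> h))"
  defines "H' \<equiv> {h \<in> carrier ClK. \<delta> h \<in> H}"
    and "NH \<equiv> kernel (ClK\<lparr>carrier := H\<rparr>) Clk (class_norm K k \<mm>)"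
    and "\<Lambda> \<equiv> {x \<in> ray_elems k \<mm>. principal k x \<in> ideal_norm K k ` \<I>}"
  assumes "number_field k" and "number_field K" and "galois_ext K k"
    and "\<sigma> \<in> carrier G" and "carrier G = generate G {\<sigma>}"
    and "\<mm> \<in> integral_ideals k"
    and "subgroup \<I> IK"
    and "subgroup H ClK" and "\<forall>s \<in> carrier G. \<forall>h \<in> H. class_act s h \<in> H"
  shows "\<delta> ` H' \<subseteq> NH \<and>
    (\<exists>\<phi>. short_exact
           (mult_group_on ({\<epsilon> * elem_norm K k y | \<epsilon> y.
               \<epsilon> \<in> ray_units k \<mm> \<and> y \<in> ray_elems K \<mm>K} \<inter> \<Lambda>))
           (\<lambda>x. x)
           (mult_group_on \<Lambda>)
           \<phi>
           (ClK\<lparr>carrier := NH\<rparr> Mod (\<delta> ` H')) \<and>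
         (\<forall>x\<in>\<Lambda>. \<forall>A\<in>\<I>. ideal_norm K k A = principal k x \<longrightarrow>
            \<phi> x = (\<delta> ` H') #>\<^bsub>ClK\<^esub> ray_class K \<mm>K A))"
proof -
  interpret S: ray_exact_sequence K k \<sigma> \<mm> \<I>
    using assms(11-17) unfolding G_def IK_def \<mm>K_def
    by (simp add: ray_exact_sequence_def ray_exact_sequence_axioms_def ray_extension_def ray_extension_axioms_def
      cyclic_extension_def cyclic_extension_axioms_def galois_extension_def galois_extension_axioms_def
      number_field_set_def)
  have H: "H = S.H" unfolding H_def IK_def \<mm>K_def by (rule S.ray_class_image_set_mult)
  have \<delta>: "\<delta> = S.class_conj_quot" by (rule HOL.ext) (simp add: \<delta>_def S.class_conj_quot_def ClK_def \<mm>K_def)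
  have D: "\<delta> ` H' = S.D" unfolding H'_def \<delta> H ClK_def \<mm>K_def S.D_def S.H_tilde_def ..
  have NH: "NH = S.NH" unfolding NH_def H ClK_def Clk_def \<mm>K_def S.NH_def ..
  have \<Lambda>: "\<Lambda> = S.\<Lambda>" unfolding \<Lambda>_def S.\<Lambda>_def ..
  show ?thesis
    unfolding D NH \<Lambda> ClK_def \<mm>K_def using S.D_subset_NH S.short_exact_\<phi> S.\<phi>_eq by blast
qed

end
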